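(* Let $c\in\mathbb{R}$, $a>0$ and $\sigma>0$. (1) If $f\in H^1_c(\mathbb{H}_a)$, then for every $q\in[1,\infty]$, $$\mathrm{dist}_q(f,\mathscr{B}^1_{c,\sigma})\le 2\,\|f\|_{H^1_c(\mathbb{H}_a)}\left(\frac{2}{aq}\right)^{1/q}e^{-a\sigma},$$ where for $q=\infty$ the factor $(2/(aq))^{1/q}$ is read as $1$. (2) If $f\in H^2_c(\mathbb{H}_a)$, then $$\mathrm{dist}_2(f,\mathscr{B}^2_{c,\sigma})\le 2\sqrt{\pi}\,\|f\|_{H^2_c(\mathbb{H}_a)}\,e^{-a\sigma},$$ and furthermore, for every $q\in[1,2[$, $$\mathrm{dist}_q(f,\mathscr{B}^2_{c,\sigma})\le 2\sqrt{\pi}\left(\frac{2-q}{qa}\right)^{\frac1q-\frac12}\|f\|_{H^2_c(\mathbb{H}_a)}\,e^{-a\sigma}.$$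
   Context: $\mathbb{R}^+=\,]0,\infty[$, $\mathbb{H}:=\{(r,\theta): r\in\mathbb{R}^+,\ \theta\in\mathbb{R}\}$, and for $a>0$, $\mathbb{H}_a:=\{(r,\theta)\in\mathbb{H}:\theta\in\,]-a,a[\,\}$. For $c\in\mathbb{R}$ and $1\le p<\infty$, $X^p_c$ is the space of measurable functions $\varphi:\mathbb{R}^+\to\mathbb{C}$ with $\|\varphi\|_{X^p_c}:=\left(\int_0^\infty|\varphi(r)|^p r^{cp-1}\,dr\right)^{1/p}<\infty$. Polar-analytic: a function $f:\mathcal{D}\to\mathbb{C}$ on a domain $\mathcal{D}\subset\mathbb{H}$ is polar-analytic on $\mathcal{D}$ if for every $(r_0,\theta_0)\in\mathcal{D}$ the limit $$\lim_{(r,\theta)\to(r_0,\theta_0)}\frac{f(r,\theta)-f(r_0,\theta_0)}{re^{i\theta}-r_0e^{i\theta_0}}$$ exists in $\mathbb{C}$, independently of how $(r,\theta)$ approaches $(r_0,\theta_0)$ within $\mathcal{D}$. Mellin--Bernstein space: for $c\in\mathbb{R}$, $\sigma>0$, $p\in[1,\infty[$, $\mathscr{B}^p_{c,\sigma}$ is the set of all functions $g:\mathbb{H}\to\mathbb{C}$ such that (i) $g$ is polar-analytic on $\mathbb{H}$; (ii) $g(\cdot,0)\in X^p_c$; (iii) there is a constant $C_g>0$ with $|g(r,\theta)|\le C_g r^{-c}e^{\sigma|\theta|}$ for all $(r,\theta)\in\mathbb{H}$. Mellin--Hardy space: for $a>0$, $c\in\mathbb{R}$, $p\ge1$, $H^p_c(\mathbb{H}_a)$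 is the set of all functions $f:\mathbb{H}_a\to\mathbb{C}$ such that (i) $f$ is polar-analytic on $\mathbb{H}_a$; (ii) $f(\cdot,\theta)\in X^p_c$ for each $\theta\in\,]-a,a[$; (iii) $$\|f\|_{H^p_c(\mathbb{H}_a)}:=\sup_{0<\theta<a}\left(\frac{\|f(\cdot,\theta)\|^p_{X^p_c}+\|f(\cdot,-\theta)\|^p_{X^p_c}}{2}\right)^{1/p}<+\infty.$$ Distance: for $c\in\mathbb{R}$ and $q\in[1,\infty]$, $G^q_c$ is the linear space of all functions $\varphi:\mathbb{R}^+\to\mathbb{C}$ having a representation $$\varphi(x)=\frac1{2\pi}\int_{-\infty}^{\infty}\psi(v)\,x^{-c-iv}\,dv\qquad(x>0)$$ with $\psi\in L^1(\mathbb{R})\cap L^q(\mathbb{R})$ (such $\psi$ is unique a.e.); it is normed by $[\![\varphi]\!]_q:=\|\psi\|_{L^q(\mathbb{R})}$ (essential supremum norm if $q=\infty$). For $f\in H^p_c(\mathbb{H}_a)$, the distance to the Mellin--Bernstein space is defined via restrictions to the positive real line: $$\mathrm{dist}_q(f,\mathscr{B}^p_{c,\sigma}):=\inf_{g\in\mathscr{B}^p_{c,\sigma}}[\![f(\cdot,0)-g(\cdot,0)]\!]_q .$$ In the cases considered ($p=1$, $q\in[1,\infty]$; $p=2$, $q\in[1,2]$) the restrictions $f(\cdot,0)$ and $g(\cdot,0)$ belong to $G^q_c$. *)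

theory Defs
  imports "HOL-Analysis.Analysis" "HOL-Probability.Essential_Supremum"
begin

definition polar_halfplane :: "(real \<times> real) set"
  where "polar_halfplane = {(r, \<theta>). 0 < r}"

definition polar_strip :: "real \<Rightarrow> (real \<times> real) set"
  where "polar_strip a = {(r, \<theta>). 0 < r \<and> - a < \<theta> \<and> \<theta> < a}"

text \<open>
  Functions on the positive half-line, on the polar half-plane and on a strip are represented by
  total functions; every notion below depends only on the values on the respective domain.
\<close>

definition X_space :: "real \<Rightarrow> real \<Rightarrow> (real \<Rightarrow> complex) set"
  where "X_space p c = {\<phi>. set_borel_measurable lebesgue {0<..} \<phi> \<and>
    set_integrable lebesgue {0<..} (\<lambda>r. cmod (\<phi> r) powr p * r powr (c * p - 1))}"

definition X_norm :: "real \<Rightarrow> real \<Rightarrow> (real \<Rightarrow> complex) \<Rightarrow> real"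
  where "X_norm p c \<phi> =
    (LINT r:{0<..}|lebesgue. cmod (\<phi> r) powr p * r powr (c * p - 1)) powr (1 / p)"

definition polar_analytic_on :: "(real \<times> real \<Rightarrow> complex) \<Rightarrow> (real \<times> real) set \<Rightarrow> bool"
  where "polar_analytic_on f D \<longleftrightarrow> (\<forall>(r0, \<theta>0)\<in>D. \<exists>L.
    ((\<lambda>(r, \<theta>). (f (r, \<theta>) - f (r0, \<theta>0)) / (rcis r \<theta> - rcis r0 \<theta>0)) \<longlongrightarrow> L)
      (at (r0, \<theta>0) within D))"

definition mellin_bernstein :: "real \<Rightarrow> real \<Rightarrow> real \<Rightarrow> (real \<times> real \<Rightarrow> complex) set"
  where "mellin_bernstein p c \<sigma> = {g. polar_analytic_on g polar_halfplane \<and>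
    (\<lambda>r. g (r, 0)) \<in> X_space p c \<and>
    (\<exists>C>0. \<forall>(r, \<theta>)\<in>polar_halfplane. cmod (g (r, \<theta>)) \<le> C * r powr (- c) * exp (\<sigma> * \<bar>\<theta>\<bar>))}"

definition hardy_mean :: "real \<Rightarrow> real \<Rightarrow> (real \<times> real \<Rightarrow> complex) \<Rightarrow> real \<Rightarrow> real"
  where "hardy_mean p c f \<theta> =
    ((X_norm p c (\<lambda>r. f (r, \<theta>)) powr p + X_norm p c (\<lambda>r. f (r, - \<theta>)) powr p) / 2) powr (1 / p)"

definition mellin_hardy :: "real \<Rightarrow> real \<Rightarrow> real \<Rightarrow> (real \<times> real \<Rightarrow> complex) set"
  where "mellin_hardy p c a = {f. polar_analytic_on f (polar_strip a) \<and>
    (\<forall>\<theta>\<in>{- a<..<a}. (\<lambda>r. f (r, \<theta>)) \<in> X_space p c) \<and>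
    bdd_above (hardy_mean p c f ` {0<..<a})}"

definition mellin_hardy_norm :: "real \<Rightarrow> real \<Rightarrow> real \<Rightarrow> (real \<times> real \<Rightarrow> complex) \<Rightarrow> real"
  where "mellin_hardy_norm p c a f = (SUP \<theta>\<in>{0<..<a}. hardy_mean p c f \<theta>)"

definition L_space :: "ennreal \<Rightarrow> (real \<Rightarrow> complex) set"
  where "L_space q = {\<psi> \<in> borel_measurable lebesgue.
    if q = \<infinity> then esssup lebesgue (\<lambda>v. ennreal (cmod (\<psi> v))) < \<infinity>
    else integrable lebesgue (\<lambda>v. cmod (\<psi> v) powr enn2real q)}"

definition L_norm :: "ennreal \<Rightarrow> (real \<Rightarrow> complex) \<Rightarrow> real"
  where "L_norm q \<psi> =
    (if q = \<infinity> then enn2real (esssup lebesgue (\<lambda>v. ennreal (cmod (\<psi> v))))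
     else (LINT v|lebesgue. cmod (\<psi> v) powr enn2real q) powr (1 / enn2real q))"

definition G_representation :: "ennreal \<Rightarrow> real \<Rightarrow> (real \<Rightarrow> complex) \<Rightarrow> (real \<Rightarrow> complex) \<Rightarrow> bool"
  where "G_representation q c \<phi> \<psi> \<longleftrightarrow> \<psi> \<in> L_space 1 \<inter> L_space q \<and>
    (\<forall>x>0. \<phi> x = 1 / (2 * complex_of_real pi) *
      (LINT v|lebesgue. \<psi> v * complex_of_real x powr (- complex_of_real c - \<i> * complex_of_real v)))"

definition G_space :: "ennreal \<Rightarrow> real \<Rightarrow> (real \<Rightarrow> complex) set"
  where "G_space q c = {\<phi>. \<exists>\<psi>. G_representation q c \<phi> \<psi>}"

text \<open>
  The representing function is unique almost everywhere, so the choice does not matter.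
\<close>

definition G_norm :: "ennreal \<Rightarrow> real \<Rightarrow> (real \<Rightarrow> complex) \<Rightarrow> real"
  where "G_norm q c \<phi> = L_norm q (SOME \<psi>. G_representation q c \<phi> \<psi>)"

text \<open>
  A competitor whose difference from \<open>f\<close> lies outside the normed space has infinite distance;
  it never contributes to the infimum.
\<close>

definition mellin_bernstein_dist ::
    "ennreal \<Rightarrow> real \<Rightarrow> real \<Rightarrow> real \<Rightarrow> (real \<times> real \<Rightarrow> complex) \<Rightarrow> ennreal"
  where "mellin_bernstein_dist q p c \<sigma> f = (INF g\<in>mellin_bernstein p c \<sigma>.
    let \<phi> = (\<lambda>x. f (x, 0) - g (x, 0))
    in if \<phi> \<in> G_space q c then ennreal (G_norm q c \<phi>) else \<infinity>)"

end

theory Submission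
  imports Defs "HOL-Probability.Probability" "HOL-Complex_Analysis.Complex_Analysis"
    "HOL-Real_Asymp.Real_Asymp"
begin

text \<open>
  In logarithmic coordinates \<open>z = ln r + \<i> \<theta>\<close> the function \<open>F z = exp (c z) f(r, \<theta>)\<close> is holomorphic on the
  strip \<open>\<bar>Im z\<bar> < a\<close>, the Mellin representation becomes \<open>F t = 1 / (2 \<pi>) \<integral> \<psi> v exp (- \<i> v t) dv\<close>, and
  shifting the line of integration by \<open>\<theta>\<close> multiplies the spectrum \<open>\<psi>\<close> by \<open>exp (\<theta> v)\<close>.  Applied to both
  \<open>\<theta>\<close> and \<open>- \<theta>\<close> with \<open>\<theta> \<rightarrow> a\<close>, this gives \<open>\<bar>\<psi> v\<bar> \<le> 2 N exp (- a \<bar>v\<bar>)\<close> when \<open>p = 1\<close>, and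
  by Plancherel \<open>\<integral> \<bar>\<psi> v\<bar>\<^sup>2 exp (2 a \<bar>v\<bar>) dv \<le> 4 \<pi> N\<^sup>2\<close> when \<open>p = 2\<close>, where \<open>N\<close> is the Hardy norm.
  The competitor is obtained by restricting \<open>\<psi>\<close> to \<open>[-\<sigma>, \<sigma>]\<close>, so the error is the tail of \<open>\<psi>\<close>.  For \<open>p = 1\<close>
  the sharp cutoff would in general leave \<open>X\<^sup>1\<^sub>c\<close>; a trapezoidal cutoff, whose transform is integrable, is
  used instead, and its flanks are made steep in the limit.
\<close>

subsection \<open>Fourier transforms of integrable functions\<close>

text \<open>The Hardy space supplies neither values on the lines of height \<open>a\<close> and
  \<open>-a\<close> nor pointwise decay along inner lines; it only bounds the mean over the two
  lines \<open>\<theta>\<close> and \<open>- \<theta>\<close>. This shapes the proof in three ways.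
  Estimates are made for \<open>\<theta> < a\<close> and carried to \<open>a\<close> by a limit or
  by Fatou. The shift of the line of integration rests on integrability of the vertical connections
  instead of their vanishing at infinity. The pair of lines is matched with \<open>exp (\<theta> *
  |v|) \<le> exp (\<theta> * v) + exp (- \<theta> * v)\<close>, whence the constant
  \<open>2 * N\<close> for \<open>p = 1\<close> and \<open>4 * pi = 2 * pi * 2\<close> for
  \<open>p = 2\<close>.

  The distance is defined through a chosen representing function, so uniqueness of the spectrum
  belongs to the proof; it is derived from the uniqueness theorem for characteristic functions. The
  transform is unnormalised with a positive exponent, so a Mellin representation at \<open>x\<close>
  is \<open>exp (- c * ln x) * ft \<psi> (- ln x) / (2 * pi)\<close>.\<close>

definition ft :: "(real \<Rightarrow> complex) \<Rightarrow> real \<Rightarrow> complex"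
  where "ft h v = (LINT t|lborel. h t * iexp (v * t))"

lemma ft_integrable: "integrable lborel h \<Longrightarrow> integrable lborel (\<lambda>t. h t * iexp (v * t))"
  by (rule Bochner_Integration.integrable_bound[of lborel h]) (auto simp: norm_mult)

lemma ft_measurable [measurable]:
  assumes [measurable]: "h \<in> borel_measurable borel"
  shows "ft h \<in> borel_measurable borel"
  unfolding ft_def[abs_def] by measurable

lemma ft_bound:
  assumes "integrable lborel h"
  shows "cmod (ft h v) \<le> (LINT t|lborel. cmod (h t))"
proof -
  have "cmod (ft h v) \<le> (LINT t|lborel. cmod (h t * iexp (v * t)))"
    unfolding ft_def by (rule integral_norm_bound)
  thus ?thesis by (simp add: norm_mult)
qed

lemma ft_diff:
  assumes "integrable lborel h" "integrable lborel k"
  shows "ft (\<lambda>t. h t - k t) v = ft h v - ft k v"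
  unfolding ft_def left_diff_distrib
  by (intro Bochner_Integration.integral_diff ft_integrable assms)

section \<open>Interchange of integrals against a bounded kernel\<close>

lemma integrable_product_bounded_kernel:
  fixes f g :: "real \<Rightarrow> complex" and K :: "real \<Rightarrow> real \<Rightarrow> complex"
  assumes f: "integrable lborel f" and g: "integrable lborel g"
    and K [measurable]: "(\<lambda>(x, y). K x y) \<in> borel_measurable (borel \<Otimes>\<^sub>M borel)"
    and C: "\<And>x y. cmod (K x y) \<le> C"
  shows "integrable (lborel \<Otimes>\<^sub>M lborel) (\<lambda>(x, y). f x * g y * K x y)"
proof -
  have [measurable]: "f \<in> borel_measurable borel" "g \<in> borel_measurable borel"
    using f g by auto
  have "integrable (lborel \<Otimes>\<^sub>M lborel) (\<lambda>(x, y). C * (f x * g y))"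
  proof (rule lborel_pair.Fubini_integrable)
    show "integrable lborel (\<lambda>x. LINT y|lborel. cmod (case (x, y) of (x, y) \<Rightarrow> C * (f x * g y)))"
      using f by (simp add: norm_mult)
    show "AE x in lborel. integrable lborel (\<lambda>y. case (x, y) of (x, y) \<Rightarrow> C * (f x * g y))"
      using g by simp
  qed simp
  moreover have "cmod (f x * g y * K x y) \<le> cmod (C * (f x * g y))" for x y
  proof -
    have "0 \<le> C" using C[of 0 0] norm_ge_zero order_trans by blast
    moreover have "cmod (f x * g y) * cmod (K x y) \<le> cmod (f x * g y) * C"
      by (intro mult_left_mono C) simp
    ultimately show ?thesis
      by (simp add: norm_mult mult_ac)
  qed
  ultimately show ?thesis
    by (elim Bochner_Integration.integrable_bound) (auto intro!: AE_I2)
qed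

text \<open>The common Fubini step: \<open>f\<close> and \<open>g\<close> are integrable and the
  coupling sits in the bounded \<open>K\<close>, so the integrand is absolutely integrable on the
  plane. In the applications \<open>K\<close> is a character, or a box function times a
  character.\<close>

lemma integral_swap_bounded_kernel:
  fixes f g :: "real \<Rightarrow> complex" and K :: "real \<Rightarrow> real \<Rightarrow> complex"
  assumes "integrable lborel f" "integrable lborel g"
    and "(\<lambda>(x, y). K x y) \<in> borel_measurable (borel \<Otimes>\<^sub>M borel)"
    and "\<And>x y. cmod (K x y) \<le> C"
  shows "(LINT x|lborel. f x * (LINT y|lborel. g y * K x y)) =
         (LINT y|lborel. g y * (LINT x|lborel. f x * K x y))"
proof -
  have "(LINT x|lborel. (LINT y|lborel. f x * g y * K x y)) =
         (LINT y|lborel. (LINT x|lborel. f x * g y * K x y))"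
    using lborel_pair.Fubini_integral[OF integrable_product_bounded_kernel[OF assms]] by simp
  moreover have "(LINT y|lborel. f x * g y * K x y) = f x * (LINT y|lborel. g y * K x y)" for x
    by (simp add: mult.assoc)
  moreover have "(LINT x|lborel. f x * g y * K x y) = g y * (LINT x|lborel. f x * K x y)" for y
    by (simp flip: integral_mult_right_zero add: mult_ac)
  ultimately show ?thesis by simp
qed

section \<open>Gaussian regularisation and Fourier inversion\<close>

lemma integrable_gaussian:
  assumes "0 < \<delta>"
  shows "integrable lborel (\<lambda>v::real. complex_of_real (exp (- (\<delta> * v)\<^sup>2 / 2)))"
proof -
  have "integrable lborel (\<lambda>v. sqrt (2 * pi * (1 / \<delta>)\<^sup>2) * normal_density 0 (1 / \<delta>) v)"
    by (intro integrable_mult_right integrable_normal_density) (use assms in auto)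
  also have "(\<lambda>v. sqrt (2 * pi * (1 / \<delta>)\<^sup>2) * normal_density 0 (1 / \<delta>) v) = (\<lambda>v. exp (- (\<delta> * v)\<^sup>2 / 2))"
    using assms by (auto simp: normal_density_def fun_eq_iff field_simps power_mult_distrib)
  finally show ?thesis by simp
qed

text \<open>Rescaling \<open>v\<close> by \<open>\<delta>\<close> reduces this to the characteristic
  function of the standard normal law. The result is kept as \<open>2 * pi\<close> times a
  probability density so that it can act as a mollifier.\<close>

lemma gaussian_transform:
  assumes "0 < \<delta>"
  shows "(LINT v|lborel. complex_of_real (exp (- (\<delta> * v)\<^sup>2 / 2)) * iexp (v * x)) =
    complex_of_real (2 * pi * normal_density 0 \<delta> x)"
proof -
  let ?A = "LINT u|lborel. std_normal_density u *\<^sub>R iexp (x / \<delta> * u)"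
  have "?A = char std_normal_distribution (x / \<delta>)"
    unfolding char_def by (subst integral_density) (simp_all add: measurable_lborel1)
  hence "complex_of_real (exp (- (x / \<delta>)\<^sup>2 / 2)) = ?A"
    by (simp add: char_std_normal_distribution)
  also have "?A = \<delta> *\<^sub>R
      (LINT v|lborel. std_normal_density (\<delta> * v) *\<^sub>R iexp (x / \<delta> * (\<delta> * v)))"
    by (subst lborel_integral_real_affine[where c = \<delta> and t = 0])
       (use assms in \<open>simp_all only: abs_of_pos add_0 less_imp_neq[symmetric] not_False_eq_True\<close>)
  also have "(\<lambda>v. std_normal_density (\<delta> * v) *\<^sub>R iexp (x / \<delta> * (\<delta> * v))) =
      (\<lambda>v. complex_of_real (1 / sqrt (2 * pi)) * (complex_of_real (exp (- (\<delta> * v)\<^sup>2 / 2)) * iexp (v * x)))"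
    using assms by (auto simp: fun_eq_iff std_normal_density_def scaleR_conv_of_real mult_ac)
  finally have *: "complex_of_real (exp (- (x / \<delta>)\<^sup>2 / 2)) = complex_of_real (\<delta> / sqrt (2 * pi)) *
      (LINT v|lborel. complex_of_real (exp (- (\<delta> * v)\<^sup>2 / 2)) * iexp (v * x))"
    by (simp only: integral_mult_right_zero) (simp add: scaleR_conv_of_real)
  have "2 * pi * normal_density 0 \<delta> x = sqrt (2 * pi) / \<delta> * exp (- (x / \<delta>)\<^sup>2 / 2)"
  proof -
    have "2 * pi * (1 / sqrt (2 * pi * \<delta>\<^sup>2)) = sqrt (2 * pi) / \<delta>"
      using assms by (simp add: real_sqrt_mult field_simps)
    moreover have "- (x - 0)\<^sup>2 / (2 * \<delta>\<^sup>2) = - (x / \<delta>)\<^sup>2 / 2"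
      by (simp add: power_divide)
    ultimately show ?thesis
      unfolding normal_density_def by (simp only: mult.assoc[symmetric])
  qed
  hence n: "complex_of_real (2 * pi * normal_density 0 \<delta> x) =
      complex_of_real (sqrt (2 * pi) / \<delta>) * complex_of_real (exp (- (x / \<delta>)\<^sup>2 / 2))"
    by (simp only: of_real_mult)
  have one: "complex_of_real (sqrt (2 * pi) / \<delta>) * complex_of_real (\<delta> / sqrt (2 * pi)) = 1"
    using assms by simp
  have "i = x" if "x = A * e" "e = B * i" "A * B = 1" for A B e i x :: complex
    using that by (simp add: mult.assoc[symmetric])
  from this[OF n * one] show ?thesis .
qed

text \<open>The Gaussian factor makes the double integral absolutely convergent even where
  \<open>ft h\<close> is not integrable. Exchanging the integrals moves the transform onto the
  Gaussian, so \<open>h\<close> appears mollified at scale \<open>\<delta>\<close>. Inversion and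
  Plancherel both start from this identity.\<close>

lemma ft_gaussian_multiplication:
  fixes h :: "real \<Rightarrow> complex"
  assumes h: "integrable lborel h" and "0 < \<delta>"
  shows "(LINT v|lborel. complex_of_real (exp (- (\<delta> * v)\<^sup>2 / 2)) * (ft h v * iexp (- (v * t)))) =
    2 * pi * (LINT s|lborel. h s * normal_density 0 \<delta> (s - t))"
proof -
  have shift: "ft h v * iexp (- (v * t)) = (LINT s|lborel. h s * iexp (v * (s - t)))" for v
  proof -
    have "h s * iexp (v * (s - t)) = h s * iexp (v * s) * iexp (- (v * t))" for s
      by (simp add: mult.assoc flip: exp_add) (simp add: algebra_simps)
    thus ?thesis unfolding ft_def by (simp only: integral_mult_left_zero)
  qed
  have "(LINT v|lborel. complex_of_real (exp (- (\<delta> * v)\<^sup>2 / 2)) * (ft h v * iexp (- (v * t)))) =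
    (LINT v|lborel. complex_of_real (exp (- (\<delta> * v)\<^sup>2 / 2)) * (LINT s|lborel. h s * iexp (v * (s - t))))"
    unfolding shift ..
  also have "\<dots> = (LINT s|lborel. h s *
      (LINT v|lborel. complex_of_real (exp (- (\<delta> * v)\<^sup>2 / 2)) * iexp (v * (s - t))))"
    by (rule integral_swap_bounded_kernel[where C = 1])
       (use assms integrable_gaussian[OF \<open>0 < \<delta>\<close>] in \<open>simp_all add: split_beta\<close>)
  also have "\<dots> = (LINT s|lborel. complex_of_real (2 * pi) * (h s * normal_density 0 \<delta> (s - t)))"
    unfolding gaussian_transform[OF \<open>0 < \<delta>\<close>] by (simp add: mult_ac)
  finally show ?thesis by (simp only: integral_mult_right_zero)
qed

lemma normal_density_scaled:
  "0 < \<delta> \<Longrightarrow> \<delta> * normal_density 0 \<delta> (\<delta> * u) = std_normal_density u"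
  by (simp add: normal_density_def real_sqrt_mult power_mult_distrib)

lemma normal_density_antimono:
  assumes "0 < \<delta>" "0 \<le> r" "r \<le> \<bar>x\<bar>"
  shows "normal_density 0 \<delta> x \<le> normal_density 0 \<delta> r"
proof -
  have "r\<^sup>2 \<le> x\<^sup>2" using assms by (simp add: abs_le_square_iff[symmetric])
  thus ?thesis unfolding normal_density_def using assms
    by (intro mult_left_mono) (auto simp: divide_right_mono)
qed

text \<open>\<open>h\<close> may be unbounded away from \<open>t\<close>, so the rescaled integral
  has no evident dominating function. Near \<open>t\<close> it is bounded and dominated convergence
  applies; away from \<open>t\<close> the density is uniformly small and the integrability of
  \<open>h\<close> does the rest.\<close>

lemma gaussian_approximate_identity:
  fixes h :: "real \<Rightarrow> complex"
  assumes h: "integrable lborel h" and c: "isCont h t"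
  shows "(\<lambda>n. LINT s|lborel. h s * normal_density 0 (1 / real (Suc n)) (s - t)) \<longlonglongrightarrow> h t"
proof -
  have [measurable]: "h \<in> borel_measurable borel" using h by auto
  obtain r where r: "0 < r" "\<And>s. \<bar>s - t\<bar> < r \<Longrightarrow> cmod (h s - h t) < 1"
    using c unfolding continuous_at_eps_delta dist_norm real_norm_def by (meson zero_less_one)
  define near where "near = (\<lambda>s. if \<bar>s - t\<bar> < r then h s else 0)"
  define far where "far = (\<lambda>s. if \<bar>s - t\<bar> < r then 0 else h s)"
  have [measurable]: "near \<in> borel_measurable borel" "far \<in> borel_measurable borel"
    unfolding near_def far_def by measurable
  let ?d = "\<lambda>n. 1 / real (Suc n)"
  let ?N = "\<lambda>n s. complex_of_real (normal_density 0 (?d n) (s - t))"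
  have near_le: "cmod (near s) \<le> cmod (h t) + 1" for s
    using r(2)[of s] norm_triangle_ineq2[of "h s" "h t"] by (auto simp: near_def)
  have N_int: "integrable lborel (\<lambda>s. normal_density 0 (?d n) (s - t))" for n
    using lborel_integrable_real_affine[OF integrable_normal_density[of "?d n" 0], of 1 "-t"] by simp
  have near_int: "integrable lborel (\<lambda>s. near s * ?N n s)" for n
  proof (rule Bochner_Integration.integrable_bound)
    show "integrable lborel (\<lambda>s. (cmod (h t) + 1) * normal_density 0 (?d n) (s - t))"
      using N_int by simp
  qed (auto simp: norm_mult intro!: AE_I2 mult_right_mono near_le order_trans[OF near_le])
  have far_le: "cmod (far s * ?N n s) \<le> cmod (h s) * normal_density 0 (?d n) r" for n s
    using r(1) by (auto simp: far_def norm_mult intro!: mult_left_mono normal_density_antimono)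
  have far_int: "integrable lborel (\<lambda>s. far s * ?N n s)" for n
  proof (rule Bochner_Integration.integrable_bound)
    show "integrable lborel (\<lambda>s. cmod (h s) * normal_density 0 (?d n) r)"
      using h by simp
  qed (use far_le[of _ n] in \<open>auto intro!: AE_I2 simp: abs_mult\<close>)
  have "(\<lambda>n. LINT s|lborel. near s * ?N n s) \<longlonglongrightarrow> h t"
  proof -
    \<comment> \<open>Substituting \<open>s = t + u / (n + 1)\<close> fixes the density and moves
      the scale into the argument of \<open>near\<close>, where continuity at \<open>t\<close> gives
      the limit.\<close>
    have "(LINT s|lborel. near s * ?N n s) =
        (LINT u|lborel. near (t + ?d n * u) * complex_of_real (std_normal_density u))" for n
    proof -
      have "?d n \<noteq> 0" by simp
      from lborel_integral_real_affine[OF this, of "\<lambda>s. near s * ?N n s" t]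
      have "(LINT s|lborel. near s * ?N n s) =
          (LINT u|lborel. ?d n *\<^sub>R (near (t + ?d n * u) * ?N n (t + ?d n * u)))"
        by (simp del: of_nat_Suc)
      moreover have "?d n *\<^sub>R (near (t + ?d n * u) * ?N n (t + ?d n * u)) =
          near (t + ?d n * u) * complex_of_real (std_normal_density u)" for u
        by (subst normal_density_scaled[of "?d n" u, symmetric])
           (simp_all add: scaleR_conv_of_real del: of_nat_Suc)
      ultimately show ?thesis by (simp only:)
    qed
    moreover have "(\<lambda>n. LINT u|lborel. near (t + ?d n * u) * complex_of_real (std_normal_density u))
      \<longlonglongrightarrow> (LINT u|lborel. h t * complex_of_real (std_normal_density u))"
    proof (rule integral_dominated_convergence)
      show "integrable lborel (\<lambda>u. (cmod (h t) + 1) * std_normal_density u)" by simp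
      show "AE u in lborel. (\<lambda>n. near (t + ?d n * u) * complex_of_real (std_normal_density u)) \<longlonglongrightarrow>
          h t * complex_of_real (std_normal_density u)"
      proof (intro AE_I2 tendsto_mult tendsto_const)
        fix u
        have l: "(\<lambda>n. t + ?d n * u) \<longlonglongrightarrow> t" by real_asymp
        have "isCont near t"
        proof (rule isCont_cong[THEN iffD1, OF _ c])
          show "\<forall>\<^sub>F s in nhds t. h s = near s"
            using r(1) unfolding eventually_nhds_metric near_def dist_real_def by auto
        qed
        moreover have "near t = h t" using r(1) by (simp add: near_def)
        ultimately show "(\<lambda>n. near (t + ?d n * u)) \<longlonglongrightarrow> h t"
          using isCont_tendsto_compose[OF _ l] by metis
      qed
      show "AE u in lborel. cmod (near (t + ?d n * u) * complex_of_real (std_normal_density u))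
          \<le> (cmod (h t) + 1) * std_normal_density u" for n
        by (auto simp: norm_mult intro!: AE_I2 mult_right_mono near_le)
    qed measurable
    moreover have "(LINT u|lborel. h t * complex_of_real (std_normal_density u)) = h t"
      using integral_normal_density[of 1 0] by simp
    ultimately show ?thesis by simp
  qed
  moreover have "(\<lambda>n. LINT s|lborel. far s * ?N n s) \<longlonglongrightarrow> 0"
  proof (rule Lim_null_comparison)
    show "\<forall>\<^sub>F n in sequentially. cmod (LINT s|lborel. far s * ?N n s) \<le>
        (LINT s|lborel. cmod (h s)) * normal_density 0 (?d n) r"
    proof (intro always_eventually allI)
      fix n
      have "cmod (LINT s|lborel. far s * ?N n s) \<le> (LINT s|lborel. cmod (h s) * normal_density 0 (?d n) r)"
        using h far_int far_le by (intro order_trans[OF integral_norm_bound] integral_mono) auto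
      thus "cmod (LINT s|lborel. far s * ?N n s) \<le> (LINT s|lborel. cmod (h s)) * normal_density 0 (?d n) r"
        by simp
    qed
    have "(\<lambda>n. normal_density 0 (?d n) r) \<longlonglongrightarrow> 0"
      unfolding normal_density_def using r(1) by real_asymp
    from tendsto_mult_right_zero[OF this]
    show "(\<lambda>n. (LINT s|lborel. cmod (h s)) * normal_density 0 (?d n) r) \<longlonglongrightarrow> 0" .
  qed
  ultimately have "(\<lambda>n. (LINT s|lborel. near s * ?N n s) + (LINT s|lborel. far s * ?N n s)) \<longlonglongrightarrow> h t + 0"
    by (rule tendsto_add)
  moreover have "(LINT s|lborel. near s * ?N n s) + (LINT s|lborel. far s * ?N n s) =
      (LINT s|lborel. h s * ?N n s)" for n
    by (subst Bochner_Integration.integral_add[symmetric, OF near_int far_int])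
       (auto intro!: Bochner_Integration.integral_cong simp: near_def far_def)
  ultimately show ?thesis by simp
qed

text \<open>Both sides of \<open>ft_gaussian_multiplication\<close> are followed as
  \<open>\<delta>\<close> tends to 0: the weight tends to 1 under the dominating function
  \<open>cmod (ft h v)\<close>, while the mollification returns \<open>h t\<close>.\<close>

theorem fourier_inversion:
  fixes h :: "real \<Rightarrow> complex"
  assumes h: "integrable lborel h" and hh: "integrable lborel (ft h)" and c: "isCont h t"
  shows "h t = ft (ft h) (- t) / (2 * pi)"
proof -
  have [measurable]: "ft h \<in> borel_measurable borel" using hh by auto
  let ?w = "\<lambda>n v. complex_of_real (exp (- (1 / real (Suc n) * v)\<^sup>2 / 2))"
  have "(\<lambda>n. LINT v|lborel. ?w n v * (ft h v * iexp (- (v * t))))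
      \<longlonglongrightarrow> (LINT v|lborel. 1 * (ft h v * iexp (- (v * t))))"
  proof (rule integral_dominated_convergence)
    show "integrable lborel (\<lambda>v. cmod (ft h v))" using hh by simp
    show "AE v in lborel. (\<lambda>n. ?w n v * (ft h v * iexp (- (v * t)))) \<longlonglongrightarrow> 1 * (ft h v * iexp (- (v * t)))"
    proof (intro AE_I2 tendsto_mult tendsto_const)
      fix v
      have "(\<lambda>n. exp (- (1 / real (Suc n) * v)\<^sup>2 / 2)) \<longlonglongrightarrow> exp (- (0 * v)\<^sup>2 / 2)"
        by (intro tendsto_intros LIMSEQ_Suc[OF lim_1_over_n]) simp
      hence "(\<lambda>n. exp (- (1 / real (Suc n) * v)\<^sup>2 / 2)) \<longlonglongrightarrow> 1" by simp
      thus "(\<lambda>n. ?w n v) \<longlonglongrightarrow> 1" by (metis tendsto_of_real of_real_1)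
    qed
    show "AE v in lborel. cmod (?w n v * (ft h v * iexp (- (v * t)))) \<le> cmod (ft h v)" for n
      by (intro AE_I2) (simp add: norm_mult mult_left_le_one_le del: of_nat_Suc)
  qed measurable
  also have "(LINT v|lborel. 1 * (ft h v * iexp (- (v * t)))) = ft (ft h) (- t)"
    unfolding ft_def[of "ft h"] by (simp add: mult_ac)
  finally have "(\<lambda>n. 2 * pi * (LINT s|lborel. h s * normal_density 0 (1 / real (Suc n)) (s - t)))
      \<longlonglongrightarrow> ft (ft h) (- t)"
    by (subst ft_gaussian_multiplication[OF h, symmetric]) auto
  moreover have "(\<lambda>n. 2 * pi * (LINT s|lborel. h s * normal_density 0 (1 / real (Suc n)) (s - t)))
      \<longlonglongrightarrow> 2 * pi * h t"
    by (intro tendsto_mult_left gaussian_approximate_identity h c)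
  ultimately have "ft (ft h) (- t) = 2 * pi * h t" by (rule LIMSEQ_unique)
  thus ?thesis by simp
qed

text \<open>For a non-integrable \<open>f\<close> the integral is 0 by convention and the inequality
  is trivial, so integrability need not be checked at each application.\<close>

lemma ennreal_norm_integral_le:
  fixes f :: "'a \<Rightarrow> 'b :: {banach, second_countable_topology}"
  shows "ennreal (norm (integral\<^sup>L M f)) \<le> (\<integral>\<^sup>+ x. ennreal (norm (f x)) \<partial>M)"
  by (cases "integrable M f") (auto simp: integral_norm_bound_ennreal not_integrable_integral_eq)

section \<open>Plancherel's inequality\<close>

lemma nn_integral_normal_density_diff:
  assumes "0 < \<delta>"
  shows "(\<integral>\<^sup>+ s. ennreal (normal_density 0 \<delta> (s - t)) \<partial>lborel) = 1"
    and "(\<integral>\<^sup>+ t. ennreal (normal_density 0 \<delta> (s - t)) \<partial>lborel) = 1"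
proof -
  have 1: "(\<integral>\<^sup>+ s. ennreal (normal_density 0 \<delta> s) \<partial>lborel) = 1"
    using assms by (subst nn_integral_eq_integral) auto
  show "(\<integral>\<^sup>+ s. ennreal (normal_density 0 \<delta> (s - t)) \<partial>lborel) = 1"
    using nn_integral_real_affine[of "\<lambda>s. ennreal (normal_density 0 \<delta> s)" 1 "- t"] 1 by simp
  show "(\<integral>\<^sup>+ t. ennreal (normal_density 0 \<delta> (s - t)) \<partial>lborel) = 1"
    using nn_integral_real_affine[of "\<lambda>s. ennreal (normal_density 0 \<delta> s)" "-1" s] 1 by simp
qed

lemma cnj_ft: "cnj (ft h v) = (LINT t|lborel. cnj (h t) * iexp (- (v * t)))"
proof -
  have "cnj (ft h v) = (LINT t|lborel. cnj (h t * iexp (v * t)))"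
    unfolding ft_def by (simp del: complex_cnj_mult)
  thus ?thesis by (simp add: exp_cnj)
qed

text \<open>Schur's test: each of the two marginals of the Gaussian kernel has mass one.\<close>

lemma gaussian_quadratic_form_le:
  fixes h :: "real \<Rightarrow> complex"
  assumes [measurable]: "h \<in> borel_measurable borel" and "0 < \<delta>"
  shows "(\<integral>\<^sup>+ t. (\<integral>\<^sup>+ s. ennreal (cmod (h t) * cmod (h s) * normal_density 0 \<delta> (s - t)) \<partial>lborel) \<partial>lborel)
    \<le> (\<integral>\<^sup>+ t. ennreal ((cmod (h t))\<^sup>2) \<partial>lborel)"
proof -
  let ?N = "\<lambda>s t. ennreal (normal_density 0 \<delta> (s - t))"
  let ?h = "\<lambda>t. ennreal ((cmod (h t))\<^sup>2 / 2)"
  \<comment> \<open>The arithmetic-geometric mean inequality decouples the two factors; each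
    resulting term depends on one variable only, apart from a kernel of mass one in the
    other.\<close>
  have "cmod (h t) * cmod (h s) * normal_density 0 \<delta> (s - t) \<le>
      ((cmod (h t))\<^sup>2 / 2 + (cmod (h s))\<^sup>2 / 2) * normal_density 0 \<delta> (s - t)" for s t
    using sum_squares_bound[of "cmod (h t)" "cmod (h s)"] by (intro mult_right_mono) auto
  hence "ennreal (cmod (h t) * cmod (h s) * normal_density 0 \<delta> (s - t)) \<le> ?h t * ?N s t + ?h s * ?N s t" for s t
    by (simp add: ennreal_mult'[symmetric] ennreal_plus[symmetric] ring_distribs ennreal_leI del: ennreal_plus)
  hence "(\<integral>\<^sup>+ t. (\<integral>\<^sup>+ s. ennreal (cmod (h t) * cmod (h s) * normal_density 0 \<delta> (s - t)) \<partial>lborel) \<partial>lborel)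
      \<le> (\<integral>\<^sup>+ t. (\<integral>\<^sup>+ s. ?h t * ?N s t + ?h s * ?N s t \<partial>lborel) \<partial>lborel)"
    by (intro nn_integral_mono) auto
  also have "\<dots> = (\<integral>\<^sup>+ t. (\<integral>\<^sup>+ s. ?h t * ?N s t \<partial>lborel) \<partial>lborel) + (\<integral>\<^sup>+ t. (\<integral>\<^sup>+ s. ?h s * ?N s t \<partial>lborel) \<partial>lborel)"
    by (subst nn_integral_add[symmetric]) (auto intro!: nn_integral_cong nn_integral_add)
  also have "(\<integral>\<^sup>+ t. (\<integral>\<^sup>+ s. ?h s * ?N s t \<partial>lborel) \<partial>lborel) = (\<integral>\<^sup>+ s. (\<integral>\<^sup>+ t. ?h s * ?N s t \<partial>lborel) \<partial>lborel)"
    by (rule lborel_pair.Fubini') (simp add: split_beta)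
  also have "(\<integral>\<^sup>+ t. (\<integral>\<^sup>+ s. ?h t * ?N s t \<partial>lborel) \<partial>lborel) + (\<integral>\<^sup>+ s. (\<integral>\<^sup>+ t. ?h s * ?N s t \<partial>lborel) \<partial>lborel)
     = (\<integral>\<^sup>+ t. ?h t \<partial>lborel) + (\<integral>\<^sup>+ t. ?h t \<partial>lborel)"
    using nn_integral_normal_density_diff[OF \<open>0 < \<delta>\<close>] by (simp add: nn_integral_cmult)
  also have "\<dots> = (\<integral>\<^sup>+ t. ?h t + ?h t \<partial>lborel)"
    by (rule nn_integral_add[symmetric]) auto
  also have "\<dots> = (\<integral>\<^sup>+ t. ennreal ((cmod (h t))\<^sup>2) \<partial>lborel)"
    by (simp add: ennreal_plus[symmetric] del: ennreal_plus)
  finally show ?thesis .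
qed

text \<open>Gaussian damping makes the left side finite and the exchange of integrals legitimate. It
  turns the squared norm of the transform into a quadratic form with a mollifier as kernel, to which
  Schur's test applies; Fatou then removes the damping. The right side may be infinite.\<close>

theorem plancherel_le:
  fixes h :: "real \<Rightarrow> complex"
  assumes h: "integrable lborel h"
  shows "(\<integral>\<^sup>+ v. ennreal ((cmod (ft h v))\<^sup>2) \<partial>lborel) \<le>
    ennreal (2 * pi) * (\<integral>\<^sup>+ t. ennreal ((cmod (h t))\<^sup>2) \<partial>lborel)"
proof -
  have [measurable]: "h \<in> borel_measurable borel" using h by auto
  have damped: "(\<integral>\<^sup>+ v. ennreal (exp (- (\<delta> * v)\<^sup>2 / 2) * (cmod (ft h v))\<^sup>2) \<partial>lborel) \<le>
      ennreal (2 * pi) * (\<integral>\<^sup>+ t. ennreal ((cmod (h t))\<^sup>2) \<partial>lborel)" if "0 < \<delta>" for \<delta>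
  proof -
    let ?w = "\<lambda>v. complex_of_real (exp (- (\<delta> * v)\<^sup>2 / 2))"
    let ?N = "\<lambda>s t. complex_of_real (normal_density 0 \<delta> (s - t))"
    define C where "C = (LINT t|lborel. cmod (h t))"
    have C: "cmod (ft h v) \<le> C" for v
      unfolding C_def by (rule ft_bound[OF h])
    have wf_int: "integrable lborel (\<lambda>v. ?w v * ft h v)"
    proof (rule Bochner_Integration.integrable_bound)
      show "integrable lborel (\<lambda>v. ?w v * complex_of_real C)"
        using integrable_gaussian[OF that] by simp
      show "AE v in lborel. cmod (?w v * ft h v) \<le> cmod (?w v * complex_of_real C)"
        using C order_trans[OF C abs_ge_self] by (auto simp: norm_mult intro!: AE_I2 mult_left_mono)
    qed measurable
    have int: "integrable lborel (\<lambda>v. exp (- (\<delta> * v)\<^sup>2 / 2) * (cmod (ft h v))\<^sup>2)"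
    proof (rule Bochner_Integration.integrable_bound)
      show "integrable lborel (\<lambda>v. (?w v * ft h v) * complex_of_real C)"
        using wf_int by simp
      show "AE v in lborel. norm (exp (- (\<delta> * v)\<^sup>2 / 2) * (cmod (ft h v))\<^sup>2) \<le> cmod ((?w v * ft h v) * complex_of_real C)"
        using order_trans[OF C abs_ge_self]
        by (auto simp: norm_mult power2_eq_square mult.assoc intro!: AE_I2 mult_left_mono)
    qed measurable
    \<comment> \<open>The squared modulus is \<open>ft h v\<close> times its conjugate. Only the
      conjugate is opened as an integral, so that after the exchange the Gaussian multiplication
      formula acts on the remaining factor.\<close>
    have "complex_of_real (LINT v|lborel. exp (- (\<delta> * v)\<^sup>2 / 2) * (cmod (ft h v))\<^sup>2) =
        (LINT v|lborel. (?w v * ft h v) * (LINT t|lborel. cnj (h t) * iexp (- (v * t))))"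
      unfolding cnj_ft[symmetric] integral_complex_of_real[symmetric]
      by (intro Bochner_Integration.integral_cong) (simp_all add: mult.assoc complex_norm_square[symmetric])
    also have "\<dots> = (LINT t|lborel. cnj (h t) * (LINT v|lborel. (?w v * ft h v) * iexp (- (v * t))))"
      by (rule integral_swap_bounded_kernel[where C = 1, OF wf_int])
         (use h in \<open>simp_all add: split_beta\<close>)
    also have "\<dots> = (LINT t|lborel. cnj (h t) * (2 * pi * (LINT s|lborel. h s * ?N s t)))"
      unfolding mult.assoc ft_gaussian_multiplication[OF h that] ..
    finally have eq: "complex_of_real (LINT v|lborel. exp (- (\<delta> * v)\<^sup>2 / 2) * (cmod (ft h v))\<^sup>2) = \<dots>" .
    have "(\<integral>\<^sup>+ v. ennreal (exp (- (\<delta> * v)\<^sup>2 / 2) * (cmod (ft h v))\<^sup>2) \<partial>lborel) =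
        ennreal (cmod (complex_of_real (LINT v|lborel. exp (- (\<delta> * v)\<^sup>2 / 2) * (cmod (ft h v))\<^sup>2)))"
      by (subst nn_integral_eq_integral[OF int]) (auto intro!: integral_nonneg_AE simp del: of_real_mult)
    also have "\<dots> \<le> (\<integral>\<^sup>+ t. ennreal (cmod (cnj (h t) * (2 * pi * (LINT s|lborel. h s * ?N s t)))) \<partial>lborel)"
      unfolding eq by (rule ennreal_norm_integral_le)
    also have "\<dots> = (\<integral>\<^sup>+ t. ennreal (2 * pi) * (ennreal (cmod (h t)) * ennreal (cmod (LINT s|lborel. h s * ?N s t))) \<partial>lborel)"
      by (intro nn_integral_cong) (simp add: norm_mult ennreal_mult'[symmetric] mult_ac)
    also have "\<dots> \<le> (\<integral>\<^sup>+ t. ennreal (2 * pi) * (ennreal (cmod (h t)) * (\<integral>\<^sup>+ s. ennreal (cmod (h s * ?N s t)) \<partial>lborel)) \<partial>lborel)"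
      by (intro nn_integral_mono mult_left_mono ennreal_norm_integral_le) auto
    also have "\<dots> = ennreal (2 * pi) *
        (\<integral>\<^sup>+ t. (\<integral>\<^sup>+ s. ennreal (cmod (h t) * cmod (h s) * normal_density 0 \<delta> (s - t)) \<partial>lborel) \<partial>lborel)"
      by (simp add: nn_integral_cmult norm_mult ennreal_mult' mult.assoc)
    also have "\<dots> \<le> ennreal (2 * pi) * (\<integral>\<^sup>+ t. ennreal ((cmod (h t))\<^sup>2) \<partial>lborel)"
      by (intro mult_left_mono gaussian_quadratic_form_le that) auto
    finally show ?thesis .
  qed
  have "(\<integral>\<^sup>+ v. ennreal ((cmod (ft h v))\<^sup>2) \<partial>lborel) =
     (\<integral>\<^sup>+ v. liminf (\<lambda>n. ennreal (exp (- (1 / real (Suc n) * v)\<^sup>2 / 2) * (cmod (ft h v))\<^sup>2)) \<partial>lborel)"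
  proof (intro nn_integral_cong)
    fix v
    have "(\<lambda>n. exp (- (1 / real (Suc n) * v)\<^sup>2 / 2) * (cmod (ft h v))\<^sup>2) \<longlonglongrightarrow>
        exp (- (0 * v)\<^sup>2 / 2) * (cmod (ft h v))\<^sup>2"
      by (intro tendsto_intros LIMSEQ_Suc[OF lim_1_over_n]) simp
    hence "(\<lambda>n. ennreal (exp (- (1 / real (Suc n) * v)\<^sup>2 / 2) * (cmod (ft h v))\<^sup>2)) \<longlonglongrightarrow> ennreal ((cmod (ft h v))\<^sup>2)"
      by (intro tendsto_ennrealI) simp
    from lim_imp_Liminf[OF _ this]
    show "ennreal ((cmod (ft h v))\<^sup>2) = liminf (\<lambda>n. ennreal (exp (- (1 / real (Suc n) * v)\<^sup>2 / 2) * (cmod (ft h v))\<^sup>2))"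
      by simp
  qed
  also have "\<dots> \<le> liminf (\<lambda>n. (\<integral>\<^sup>+ v. ennreal (exp (- (1 / real (Suc n) * v)\<^sup>2 / 2) * (cmod (ft h v))\<^sup>2) \<partial>lborel))"
    by (rule nn_integral_liminf) measurable
  also have "\<dots> \<le> ennreal (2 * pi) * (\<integral>\<^sup>+ t. ennreal ((cmod (h t))\<^sup>2) \<partial>lborel)"
    by (intro Liminf_le always_eventually allI damped) auto
  finally show ?thesis .
qed

section \<open>Uniqueness of the Fourier transform\<close>

lemma real_distribution_density:
  fixes p :: "real \<Rightarrow> real"
  assumes "integrable lborel p" "\<And>x. 0 \<le> p x" "(LINT x|lborel. p x) = 1"
  shows "real_distribution (density lborel p)"
proof -
  have [measurable]: "p \<in> borel_measurable borel" using assms by auto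
  interpret prob_space "density lborel p"
  proof
    show "emeasure (density lborel p) (space (density lborel p)) = 1"
      using assms by (simp add: emeasure_density nn_integral_eq_integral)
  qed
  show ?thesis by unfold_locales auto
qed

text \<open>Positive and negative part have the same transform. Normalised to mass one they are
  probability densities with the same characteristic function, and Levy's uniqueness theorem
  identifies them.\<close>

lemma ft_eq_zero_imp_AE_real:
  fixes h :: "real \<Rightarrow> real"
  assumes h: "integrable lborel h" and z: "\<And>v. ft (\<lambda>t. complex_of_real (h t)) v = 0"
  shows "AE t in lborel. h t = 0"
proof -
  have [measurable]: "h \<in> borel_measurable borel" using h by auto
  define p where "p = (\<lambda>t. max 0 (h t))"
  define n where "n = (\<lambda>t. max 0 (- h t))"
  define m where "m = (LINT t|lborel. p t)"
  have p: "integrable lborel p" and n: "integrable lborel n"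
    unfolding p_def n_def using h by auto
  have [measurable]: "p \<in> borel_measurable borel" "n \<in> borel_measurable borel" using p n by auto
  have pn: "h t = p t - n t" "0 \<le> p t" "0 \<le> n t" for t
    by (auto simp: p_def n_def)
  have ft_eq: "ft (\<lambda>t. complex_of_real (p t)) v = ft (\<lambda>t. complex_of_real (n t)) v" for v
    using z[of v] ft_diff[of "\<lambda>t. complex_of_real (p t)" "\<lambda>t. complex_of_real (n t)" v] p n
    by (simp add: pn(1))
  \<comment> \<open>At frequency 0 the transforms are the total masses, so both parts share the
    normalising constant. If it is 0, both parts vanish almost everywhere.\<close>
  have m': "(LINT t|lborel. n t) = m"
    using ft_eq[of 0] by (simp add: ft_def m_def)
  show ?thesis
  proof (cases "m = 0")
    case True
    have "AE t in lborel. p t = 0" "AE t in lborel. n t = 0"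
      using True m' integral_nonneg_eq_0_iff_AE[OF p] integral_nonneg_eq_0_iff_AE[OF n] pn
      by (auto simp: m_def)
    thus ?thesis by eventually_elim (simp add: pn(1))
  next
    case False
    hence m: "0 < m" using pn by (simp add: m_def less_le)
    have char: "char (density lborel (\<lambda>t. ennreal (q t / m))) v = ft (\<lambda>t. complex_of_real (q t)) v / m"
      if [measurable]: "q \<in> borel_measurable borel" and "\<And>t. 0 \<le> q t" for q :: "real \<Rightarrow> real" and v
    proof -
      have "char (density lborel (\<lambda>t. ennreal (q t / m))) v = (LINT t|lborel. (q t / m) *\<^sub>R iexp (v * t))"
        unfolding char_def using that m by (subst integral_density) simp_all
      also have "\<dots> = (LINT t|lborel. complex_of_real (q t) * iexp (v * t) / m)"
        by (simp add: scaleR_conv_of_real)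
      finally show ?thesis unfolding ft_def by simp
    qed
    have "density lborel (\<lambda>t. ennreal (p t / m)) = density lborel (\<lambda>t. ennreal (n t / m))"
    proof (rule Levy_uniqueness)
      show "real_distribution (density lborel (\<lambda>t. ennreal (p t / m)))"
        using p pn m by (intro real_distribution_density) (auto simp: m_def)
      show "real_distribution (density lborel (\<lambda>t. ennreal (n t / m)))"
        using n pn m m' by (intro real_distribution_density) auto
      show "char (density lborel (\<lambda>t. ennreal (p t / m))) = char (density lborel (\<lambda>t. ennreal (n t / m)))"
        using pn ft_eq by (intro ext) (simp add: char)
    qed
    hence "AE t in lborel. ennreal (p t / m) = ennreal (n t / m)"
      by (intro sigma_finite_measure.density_unique[OF sigma_finite_lborel]) simp_all
    thus ?thesis
      by eventually_elim (use pn m in \<open>simp add: divide_right_mono\<close>)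
  qed
qed

text \<open>The transform of the conjugate of \<open>h\<close> at \<open>v\<close> is the conjugate
  of \<open>ft h (- v)\<close>, hence also zero. Real and imaginary part are combinations of
  \<open>h\<close> and its conjugate, and the real case applies to each.\<close>

lemma ft_eq_zero_imp_AE:
  fixes h :: "real \<Rightarrow> complex"
  assumes h: "integrable lborel h" and z: "\<And>v. ft h v = 0"
  shows "AE t in lborel. h t = 0"
proof -
  have hc: "integrable lborel (\<lambda>t. cnj (h t))" using h by simp
  have zc: "ft (\<lambda>t. cnj (h t)) v = 0" for v
  proof -
    have "ft (\<lambda>t. cnj (h t)) v = cnj (ft h (- v))"
      unfolding cnj_ft by (simp add: ft_def)
    thus ?thesis using z by simp
  qed
  have lin: "ft (\<lambda>t. c * (h t + d * cnj (h t))) v = 0" for c d v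
  proof -
    have "ft (\<lambda>t. c * (h t + d * cnj (h t))) v =
        (LINT t|lborel. c * (h t * iexp (v * t)) + (c * d) * (cnj (h t) * iexp (v * t)))"
      unfolding ft_def by (intro Bochner_Integration.integral_cong) (simp_all add: algebra_simps)
    also have "\<dots> = c * ft h v + (c * d) * ft (\<lambda>t. cnj (h t)) v"
      unfolding ft_def
      by (subst Bochner_Integration.integral_add)
         (use ft_integrable[OF h, of v] ft_integrable[OF hc, of v] in
           \<open>simp_all only: integrable_mult_right integral_mult_right_zero\<close>)
    finally show ?thesis using z zc by simp
  qed
  have "AE t in lborel. Re (h t) = 0"
  proof (rule ft_eq_zero_imp_AE_real)
    have "complex_of_real (Re w) = 1 / 2 * (w + 1 * cnj w)" for w
      by (simp add: complex_eq_iff)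
    thus "ft (\<lambda>t. complex_of_real (Re (h t))) v = 0" for v
      by (simp only: lin)
  qed (use h in auto)
  moreover have "AE t in lborel. Im (h t) = 0"
  proof (rule ft_eq_zero_imp_AE_real)
    have "complex_of_real (Im w) = 1 / (2 * \<i>) * (w + (-1) * cnj w)" for w
      by (simp add: complex_eq_iff Re_divide Im_divide)
    thus "ft (\<lambda>t. complex_of_real (Im (h t))) v = 0" for v
      by (simp only: lin)
  qed (use h in auto)
  ultimately show ?thesis
    by eventually_elim (simp add: complex_eq_iff)
qed

subsection \<open>Holomorphic functions on a strip\<close>

lemma nn_integral_exp_tail_le:
  fixes b s :: real
  assumes "0 < b" "0 \<le> s"
  shows "(\<integral>\<^sup>+ v. ennreal (exp (- b * \<bar>v\<bar>)) * indicator {v. s \<le> \<bar>v\<bar>} v \<partial>lborel) \<le> ennreal (2 / b * exp (- b * s))"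
proof -
  have half: "(\<integral>\<^sup>+ v. ennreal (exp (- b * v)) * indicator {s..} v \<partial>lborel) = ennreal (exp (- b * s) / b)"
  proof -
    have "((\<lambda>v. - exp (- b * v) / b) \<longlongrightarrow> 0) at_top" using assms by real_asymp
    hence "(\<integral>\<^sup>+ v. ennreal (exp (- b * v)) * indicator {s..} v \<partial>lborel) = ennreal (0 - (- exp (- b * s) / b))"
      using assms by (intro nn_integral_FTC_atLeast) (auto intro!: derivative_eq_intros)
    thus ?thesis by simp
  qed
  \<comment> \<open>An inequality and not an equality: for \<open>s = 0\<close> the two half-lines
    overlap at \<open>v = 0\<close>.\<close>
  have "(\<integral>\<^sup>+ v. ennreal (exp (- b * \<bar>v\<bar>)) * indicator {v. s \<le> \<bar>v\<bar>} v \<partial>lborel) \<le>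
      (\<integral>\<^sup>+ v. ennreal (exp (- b * v)) * indicator {s..} v + ennreal (exp (- b * (- v))) * indicator {s..} (- v) \<partial>lborel)"
    using assms by (intro nn_integral_mono) (auto simp: indicator_def abs_if)
  also have "\<dots> = (\<integral>\<^sup>+ v. ennreal (exp (- b * v)) * indicator {s..} v \<partial>lborel) +
      (\<integral>\<^sup>+ v. ennreal (exp (- b * (- v))) * indicator {s..} (- v) \<partial>lborel)"
    by (rule nn_integral_add) auto
  also have "(\<integral>\<^sup>+ v. ennreal (exp (- b * (- v))) * indicator {s..} (- v) \<partial>lborel) =
      (\<integral>\<^sup>+ v. ennreal (exp (- b * v)) * indicator {s..} v \<partial>lborel)"
    using nn_integral_real_affine[of "\<lambda>v. ennreal (exp (- b * v)) * indicator {s..} v" "-1" 0] by simp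
  finally show ?thesis
    unfolding half using assms by (simp add: ennreal_plus[symmetric] del: ennreal_plus)
qed

lemma integrable_exp_neg_abs:
  assumes "0 < (b::real)"
  shows "integrable lborel (\<lambda>v::real. exp (- b * \<bar>v\<bar>))"
proof (rule integrableI_bounded)
  have "(\<integral>\<^sup>+ v. ennreal (norm (exp (- b * \<bar>v\<bar>))) \<partial>lborel) \<le> ennreal (2 / b * exp (- b * 0))"
    using nn_integral_exp_tail_le[OF assms, of 0] by simp
  thus "(\<integral>\<^sup>+ v. ennreal (norm (exp (- b * \<bar>v\<bar>))) \<partial>lborel) < \<infinity>"
    by (rule order_le_less_trans) simp
qed measurable

text \<open>No limit of \<open>D\<close> at infinity is examined. The average of \<open>d\<close>
  over \<open>{x..x + 1}\<close> is \<open>D (x + 1) - D x\<close>, whose integral over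
  \<open>x\<close> is 0 by translation invariance, while Fubini evaluates the same integral as that
  of \<open>d\<close>.\<close>

lemma integral_derivative_eq_zero:
  fixes D d :: "real \<Rightarrow> complex"
  assumes D: "integrable lborel D" and d: "integrable lborel d" and cont: "continuous_on UNIV d"
    and deriv: "\<And>x. (D has_vector_derivative d x) (at x)"
  shows "(LINT x|lborel. d x) = 0"
proof -
  have [measurable]: "d \<in> borel_measurable borel" using d by auto
  have step: "(LINT u|lborel. indicator {0..1} u *\<^sub>R d (x + u)) = D (x + 1) - D x" for x
  proof -
    have "((\<lambda>u. D (x + u)) has_vector_derivative d (x + u)) (at u within {0..1})" for u
    proof -
      have "((\<lambda>u. x + u) has_vector_derivative 1) (at u)"
        by (auto intro!: derivative_eq_intros)
      from vector_diff_chain_at[OF this deriv] show ?thesis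
        by (simp add: o_def has_vector_derivative_at_within)
    qed
    moreover have "continuous_on {0..1} (\<lambda>u. d (x + u))"
      by (intro continuous_on_compose2[OF cont] continuous_intros) auto
    ultimately show ?thesis
      using integral_FTC_atLeastAtMost[of 0 1 "\<lambda>u. D (x + u)" "\<lambda>u. d (x + u)"] by simp
  qed
  have d_shift: "integrable lborel (\<lambda>x. d (x + u))" "(LINT x|lborel. d (x + u)) = (LINT x|lborel. d x)"
    "(LINT x|lborel. cmod (d (x + u))) = (LINT x|lborel. cmod (d x))" for u
    using lborel_integrable_real_affine[OF d, of 1 u] lborel_integral_real_affine[of 1 d u]
      lborel_integral_real_affine[of 1 "\<lambda>x. cmod (d x)" u] by (simp_all add: add.commute)
  have D_shift: "integrable lborel (\<lambda>x. D (x + 1))" "(LINT x|lborel. D (x + 1)) = (LINT x|lborel. D x)"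
    using lborel_integrable_real_affine[OF D, of 1 1] lborel_integral_real_affine[of 1 D 1]
    by (simp_all add: add.commute)
  have "integrable (lborel \<Otimes>\<^sub>M lborel) (\<lambda>(u, x). indicator {0..1} u *\<^sub>R d (x + u))"
  proof (rule lborel_pair.Fubini_integrable)
    have "integrable lborel (\<lambda>u::real. indicator {0..1} u * (LINT x|lborel. cmod (d x)))"
      by simp
    thus "integrable lborel (\<lambda>u. LINT x|lborel. norm (case (u, x) of (u, x) \<Rightarrow> indicator {0..1} u *\<^sub>R d (x + u)))"
      by (simp add: d_shift)
    show "AE u in lborel. integrable lborel (\<lambda>x. case (u, x) of (u, x) \<Rightarrow> indicator {0..1} u *\<^sub>R d (x + u))"
      by (simp add: d_shift)
  qed measurable
  from lborel_pair.Fubini_integral[OF this]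
  have "(LINT x|lborel. D (x + 1) - D x) = (LINT x|lborel. d x)"
    by (simp add: step d_shift)
  thus ?thesis using D D_shift by simp
qed

section \<open>Shifting the line of integration\<close>

definition strip :: "real \<Rightarrow> complex set"
  where "strip a = {z. \<bar>Im z\<bar> < a}"

lemma open_strip: "open (strip a)"
  unfolding strip_def by (intro open_Collect_less continuous_intros)

lemma convex_strip: "convex (strip a)"
proof -
  have "strip a = {z. Im z < a} \<inter> {z. Im z > - a}"
    by (auto simp: strip_def)
  thus ?thesis
    by (simp add: convex_Int convex_halfspace_Im_lt convex_halfspace_Im_gt)
qed

lemma continuous_on_line:
  assumes "F holomorphic_on strip a" "\<bar>\<theta>\<bar> < a"
  shows "continuous_on UNIV (\<lambda>x. F (Complex x \<theta>))"
proof -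
  have "continuous_on (strip a) F" by (rule holomorphic_on_imp_continuous_on[OF assms(1)])
  moreover have "continuous_on UNIV (\<lambda>x. Complex x \<theta>)"
    by (simp add: Complex_eq continuous_intros)
  ultimately show ?thesis
    by (rule continuous_on_compose2) (use assms(2) in \<open>auto simp: strip_def\<close>)
qed

lemma line_measurable:
  assumes "F holomorphic_on strip a" "\<bar>\<theta>\<bar> < a"
  shows "(\<lambda>x. F (Complex x \<theta>)) \<in> borel_measurable borel"
  by (rule borel_measurable_continuous_onI[OF continuous_on_line[OF assms]])

text \<open>A primitive \<open>P\<close> exists since the strip is convex. Its increment
  \<open>D\<close> across the vertical segment at \<open>x\<close> is integrable by Tonelli, with
  norm at most \<open>M\<close> times the height, and its derivative is the difference of the two
  integrands. So that difference integrates to 0, although the vertical sides are not known to tend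
  to 0.\<close>

lemma line_integral_shift:
  assumes hol: "H holomorphic_on strip a" and \<theta>: "- a < \<theta>1" "\<theta>1 \<le> \<theta>2" "\<theta>2 < a"
    and int: "\<And>\<theta>. \<theta> \<in> {\<theta>1..\<theta>2} \<Longrightarrow> integrable lborel (\<lambda>x. H (Complex x \<theta>))"
    and M: "\<And>\<theta>. \<theta> \<in> {\<theta>1..\<theta>2} \<Longrightarrow> (LINT x|lborel. cmod (H (Complex x \<theta>))) \<le> M"
  shows "(LINT x|lborel. H (Complex x \<theta>1)) = (LINT x|lborel. H (Complex x \<theta>2))"
proof -
  have in_strip: "Complex x y \<in> strip a" if "y \<in> {\<theta>1..\<theta>2}" for x y
    using that \<theta> by (auto simp: strip_def)
  obtain P where P: "\<And>z. z \<in> strip a \<Longrightarrow> (P has_field_derivative H z) (at z within strip a)"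
    using holomorphic_convex_primitive'[OF convex_strip open_strip hol] by blast
  have P: "(P has_field_derivative H z) (at z)" if "z \<in> strip a" for z
    using P[OF that] at_within_open[OF that open_strip] by simp
  have horizontal: "((\<lambda>x. P (Complex x y)) has_vector_derivative H (Complex x y)) (at x)"
    if "y \<in> {\<theta>1..\<theta>2}" for x y
  proof -
    have "((\<lambda>x. Complex x y) has_vector_derivative 1) (at x)"
      unfolding Complex_eq by (auto intro!: derivative_eq_intros)
    from field_vector_diff_chain_at[OF this P[OF in_strip[OF that]]] show ?thesis
      by (simp add: o_def)
  qed
  have vertical: "((\<lambda>y. P (Complex x y)) has_vector_derivative \<i> * H (Complex x y)) (at y)"
    if "y \<in> {\<theta>1..\<theta>2}" for x y
  proof -
    have "((\<lambda>y. Complex x y) has_vector_derivative \<i>) (at y)"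
      unfolding Complex_eq by (auto intro!: derivative_eq_intros)
    from field_vector_diff_chain_at[OF this P[OF in_strip[OF that]]] show ?thesis
      by (simp add: o_def)
  qed
  define D where "D x = P (Complex x \<theta>2) - P (Complex x \<theta>1)" for x
  have ends: "\<theta>1 \<in> {\<theta>1..\<theta>2}" "\<theta>2 \<in> {\<theta>1..\<theta>2}" using \<theta> by auto
  have D_deriv: "(D has_vector_derivative (H (Complex x \<theta>2) - H (Complex x \<theta>1))) (at x)" for x
    unfolding D_def[abs_def] by (intro has_vector_derivative_diff horizontal ends)
  have contH: "continuous_on (strip a) H" by (rule holomorphic_on_imp_continuous_on[OF hol])
  \<comment> \<open>\<open>H\<close> is controlled only inside the strip; extension by zero gives
    the jointly measurable function that Tonelli requires.\<close>
  have Hm: "(\<lambda>(x, y). indicator {\<theta>1..\<theta>2} y *\<^sub>R H (Complex x y)) \<in> borel_measurable (borel \<Otimes>\<^sub>M borel)"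
  proof -
    have "(\<lambda>p. indicator (UNIV \<times> {\<theta>1..\<theta>2}) p *\<^sub>R H (Complex (fst p) (snd p))) \<in> borel_measurable borel"
    proof (rule borel_measurable_continuous_on_indicator)
      show "UNIV \<times> {\<theta>1..\<theta>2} \<in> sets (borel :: (real \<times> real) measure)"
        by (intro borel_closed closed_Times) auto
      show "continuous_on (UNIV \<times> {\<theta>1..\<theta>2}) (\<lambda>p. H (Complex (fst p) (snd p)))"
        by (rule continuous_on_compose2[OF contH])
           (use in_strip in \<open>auto simp: Complex_eq intro!: continuous_intros\<close>)
    qed
    moreover have "(\<lambda>p. indicator (UNIV \<times> {\<theta>1..\<theta>2}) p *\<^sub>R H (Complex (fst p) (snd p))) =
        (\<lambda>(x, y). indicator {\<theta>1..\<theta>2} y *\<^sub>R H (Complex x y))"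
      by (auto simp: fun_eq_iff indicator_def)
    ultimately show ?thesis by (simp only: borel_prod)
  qed
  have D_le: "ennreal (cmod (D x)) \<le> (\<integral>\<^sup>+ y. ennreal (cmod (indicator {\<theta>1..\<theta>2} y *\<^sub>R H (Complex x y))) \<partial>lborel)" for x
  proof -
    have "continuous_on {\<theta>1..\<theta>2} (\<lambda>y. \<i> * H (Complex x y))"
      by (intro continuous_on_mult continuous_on_const continuous_on_compose2[OF contH])
         (use in_strip in \<open>auto simp: Complex_eq intro!: continuous_intros\<close>)
    hence "D x = (LINT y|lborel. indicator {\<theta>1..\<theta>2} y *\<^sub>R (\<i> * H (Complex x y)))"
      unfolding D_def using \<theta> vertical
      by (subst integral_FTC_atLeastAtMost) (auto intro: has_vector_derivative_at_within)
    also have "ennreal (cmod \<dots>) \<le> (\<integral>\<^sup>+ y. ennreal (cmod (indicator {\<theta>1..\<theta>2} y *\<^sub>R (\<i> * H (Complex x y)))) \<partial>lborel)"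
      by (rule ennreal_norm_integral_le)
    finally show ?thesis by (simp add: norm_mult)
  qed
  have D_int: "integrable lborel D"
  proof (rule integrableI_bounded)
    have "continuous_on UNIV D"
      using D_deriv by (auto simp: continuous_on_eq_continuous_at intro: has_vector_derivative_continuous)
    thus "D \<in> borel_measurable lborel"
      using borel_measurable_continuous_onI by auto
    have "(\<integral>\<^sup>+ x. ennreal (cmod (D x)) \<partial>lborel) \<le>
        (\<integral>\<^sup>+ x. (\<integral>\<^sup>+ y. ennreal (cmod (indicator {\<theta>1..\<theta>2} y *\<^sub>R H (Complex x y))) \<partial>lborel) \<partial>lborel)"
      by (intro nn_integral_mono D_le)
    also have "\<dots> = (\<integral>\<^sup>+ y. (\<integral>\<^sup>+ x. ennreal (cmod (indicator {\<theta>1..\<theta>2} y *\<^sub>R H (Complex x y))) \<partial>lborel) \<partial>lborel)"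
    proof (rule lborel_pair.Fubini'[symmetric])
      have "(\<lambda>p. ennreal (cmod (case p of (x, y) \<Rightarrow> indicator {\<theta>1..\<theta>2} y *\<^sub>R H (Complex x y))))
          \<in> borel_measurable (lborel \<Otimes>\<^sub>M lborel)"
        using Hm by simp
      thus "(\<lambda>(x, y). ennreal (cmod (indicator {\<theta>1..\<theta>2} y *\<^sub>R H (Complex x y))))
          \<in> borel_measurable (lborel \<Otimes>\<^sub>M lborel)"
        by (simp only: case_prod_unfold)
    qed
    also have "\<dots> \<le> (\<integral>\<^sup>+ y. ennreal M * indicator {\<theta>1..\<theta>2} y \<partial>lborel)"
    proof (intro nn_integral_mono)
      fix y
      show "(\<integral>\<^sup>+ x. ennreal (cmod (indicator {\<theta>1..\<theta>2} y *\<^sub>R H (Complex x y))) \<partial>lborel) \<le> ennreal M * indicator {\<theta>1..\<theta>2} y"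
      proof (cases "y \<in> {\<theta>1..\<theta>2}")
        case True
        thus ?thesis using M[OF True] int[OF True]
          by (simp add: nn_integral_eq_integral ennreal_leI)
      qed simp
    qed
    also have "\<dots> < \<infinity>" using \<theta> by (simp add: nn_integral_cmult_indicator ennreal_mult_less_top)
    finally show "(\<integral>\<^sup>+ x. ennreal (cmod (D x)) \<partial>lborel) < \<infinity>" .
  qed
  have line: "continuous_on UNIV (\<lambda>x. H (Complex x \<theta>))" if "\<theta> \<in> {\<theta>1..\<theta>2}" for \<theta>
    by (rule continuous_on_line[OF hol]) (use that \<theta> in auto)
  have "(LINT x|lborel. H (Complex x \<theta>2) - H (Complex x \<theta>1)) = 0"
    by (rule integral_derivative_eq_zero[OF D_int _ _ D_deriv])
       (auto intro!: Bochner_Integration.integrable_diff int continuous_on_diff line ends)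
  thus ?thesis using int ends by simp
qed

text \<open>The shift is applied to \<open>F z * exp (\<i> * v * z)\<close>: at height
  \<open>y\<close> its line integral is the transform of \<open>F\<close> on that line times
  \<open>exp (- (v * y))\<close>.\<close>

lemma ft_line:
  assumes hol: "F holomorphic_on strip a" and \<theta>: "\<bar>\<theta>\<bar> < a"
    and int: "\<And>\<theta>. \<bar>\<theta>\<bar> < a \<Longrightarrow> integrable lborel (\<lambda>x. F (Complex x \<theta>))"
    and M: "\<And>\<theta>. \<bar>\<theta>\<bar> < a \<Longrightarrow> (LINT x|lborel. cmod (F (Complex x \<theta>))) \<le> M"
  shows "ft (\<lambda>x. F (Complex x \<theta>)) v =
    complex_of_real (exp (v * \<theta>)) * ft (\<lambda>x. F (Complex x 0)) v"
proof -
  define H where "H z = F z * exp (\<i> * v * z)" for z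
  have H: "H holomorphic_on strip a"
    unfolding H_def[abs_def] by (intro holomorphic_intros hol)
  have H_line: "H (Complex x y) = exp (- (v * y)) * (F (Complex x y) * iexp (v * x))" for x y
  proof -
    have "\<i> * v * Complex x y = complex_of_real (- (v * y)) + \<i> * complex_of_real (v * x)"
      by (simp add: Complex_eq algebra_simps)
    thus ?thesis unfolding H_def by (simp only: exp_add exp_of_real[symmetric] mult_ac)
  qed
  have H_int: "integrable lborel (\<lambda>x. H (Complex x y))" if "\<bar>y\<bar> < a" for y
    unfolding H_line by (intro integrable_mult_right ft_integrable int that)
  have H_norm: "cmod (H (Complex x y)) = exp (- (v * y)) * cmod (F (Complex x y))" for x y
    unfolding H_line by (simp add: norm_mult)
  have "0 \<le> (LINT x|lborel. cmod (F (Complex x \<theta>)))" by simp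
  hence M0: "0 \<le> M" using M[OF \<theta>] by linarith
  have H_M: "(LINT x|lborel. cmod (H (Complex x y))) \<le> exp (\<bar>v\<bar> * a) * M" if "\<bar>y\<bar> < a" for y
  proof -
    have "- (v * y) \<le> \<bar>v\<bar> * \<bar>y\<bar>" by (metis abs_ge_minus_self abs_mult)
    also have "\<dots> \<le> \<bar>v\<bar> * a" using that by (intro mult_left_mono) auto
    finally have "exp (- (v * y)) * (LINT x|lborel. cmod (F (Complex x y))) \<le> exp (\<bar>v\<bar> * a) * M"
      using M[OF that] by (intro mult_mono) auto
    thus ?thesis unfolding H_norm by simp
  qed
  have H_ft: "(LINT x|lborel. H (Complex x y)) = exp (- (v * y)) * ft (\<lambda>x. F (Complex x y)) v" for y
    unfolding H_line ft_def by (rule integral_mult_right_zero)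
  have "(LINT x|lborel. H (Complex x 0)) = (LINT x|lborel. H (Complex x \<theta>))"
  proof (cases "0 \<le> \<theta>")
    case True
    show ?thesis
      by (rule line_integral_shift[OF H]) (use True \<theta> in \<open>auto intro!: H_int H_M\<close>)
  next
    case False
    show ?thesis
      by (rule sym, rule line_integral_shift[OF H]) (use False \<theta> in \<open>auto intro!: H_int H_M\<close>)
  qed
  hence "complex_of_real (exp (v * \<theta>)) * ft (\<lambda>x. F (Complex x 0)) v =
      complex_of_real (exp (v * \<theta>) * exp (- (v * \<theta>))) * ft (\<lambda>x. F (Complex x \<theta>)) v"
    unfolding H_ft of_real_mult mult.assoc by simp
  also have "exp (v * \<theta>) * exp (- (v * \<theta>)) = 1"
    by (simp flip: exp_add)
  finally show ?thesis by simp
qed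

section \<open>Decay of the spectrum of an integrable function on the strip\<close>

lemma exp_mult_abs_le: "exp (\<theta> * \<bar>v\<bar>) \<le> exp (v * \<theta>) + exp (v * (- \<theta> :: real))"
  by (cases "0 \<le> v") (simp_all add: mult.commute)

text \<open>The Hardy norm is a supremum over \<open>0 < \<theta> < a\<close> and leaves out the
  real line, whose value enters through the maximum. The outcome is the uniform bound that the line
  shift asks for.\<close>

lemma le_max_of_symmetric_sum:
  fixes I :: "real \<Rightarrow> real"
  assumes "\<And>\<theta>. 0 \<le> I \<theta>" and "\<And>\<theta>. 0 < \<theta> \<Longrightarrow> \<theta> < a \<Longrightarrow> I \<theta> + I (- \<theta>) \<le> N" and "\<bar>\<theta>\<bar> < a"
  shows "I \<theta> \<le> max N (I 0)"
  using assms(1)[of \<theta>] assms(1)[of "- \<theta>"] assms(2)[of "\<bar>\<theta>\<bar>"] assms(3)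
  by (cases "\<theta> = 0"; cases "0 \<le> \<theta>") auto

lemma strip_transform_L1_bound:
  assumes "0 < a" and hol: "F holomorphic_on strip a"
    and int: "\<And>\<theta>. \<bar>\<theta>\<bar> < a \<Longrightarrow> integrable lborel (\<lambda>x. F (Complex x \<theta>))"
    and N: "\<And>\<theta>. 0 < \<theta> \<Longrightarrow> \<theta> < a \<Longrightarrow>
      (LINT x|lborel. cmod (F (Complex x \<theta>))) + (LINT x|lborel. cmod (F (Complex x (- \<theta>)))) \<le> 2 * N"
  shows "cmod (ft (\<lambda>x. F (Complex x 0)) v) \<le> 2 * N * exp (- a * \<bar>v\<bar>)"
proof -
  let ?\<psi> = "ft (\<lambda>x. F (Complex x 0))"
  define M where "M = max (2 * N) (LINT x|lborel. cmod (F (Complex x 0)))"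
  have M: "(LINT x|lborel. cmod (F (Complex x \<theta>))) \<le> M" if "\<bar>\<theta>\<bar> < a" for \<theta>
    unfolding M_def by (rule le_max_of_symmetric_sum[where I = "\<lambda>\<theta>. LINT x|lborel. cmod (F (Complex x \<theta>))", OF _ N that]) auto
  have line: "cmod (ft (\<lambda>x. F (Complex x \<theta>)) v) = exp (v * \<theta>) * cmod (?\<psi> v)" if "\<bar>\<theta>\<bar> < a" for \<theta>
    by (subst ft_line[OF hol that int M]) (auto simp: norm_mult)
  have below: "cmod (?\<psi> v) \<le> 2 * N * exp (- \<theta> * \<bar>v\<bar>)" if \<theta>: "0 < \<theta>" "\<theta> < a" for \<theta>
  proof -
    \<comment> \<open>The one-sided weights produced by the lines \<open>\<theta>\<close> and
      \<open>- \<theta>\<close> together dominate the two-sided weight, and their sum is exactly the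
      quantity bounded by \<open>2 * N\<close>.\<close>
    have "exp (\<theta> * \<bar>v\<bar>) * cmod (?\<psi> v) \<le> exp (v * \<theta>) * cmod (?\<psi> v) + exp (v * (- \<theta>)) * cmod (?\<psi> v)"
      using mult_right_mono[OF exp_mult_abs_le, of "cmod (?\<psi> v)" \<theta> v] by (simp add: ring_distribs)
    also have "\<dots> = cmod (ft (\<lambda>x. F (Complex x \<theta>)) v) + cmod (ft (\<lambda>x. F (Complex x (- \<theta>))) v)"
      using line[of \<theta>] line[of "- \<theta>"] \<theta> by simp
    also have "\<dots> \<le> (LINT x|lborel. cmod (F (Complex x \<theta>))) + (LINT x|lborel. cmod (F (Complex x (- \<theta>))))"
      by (intro add_mono ft_bound int) (use \<theta> in simp_all)
    also have "\<dots> \<le> 2 * N" by (rule N[OF \<theta>])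
    finally show ?thesis by (simp add: exp_minus field_simps)
  qed
  show ?thesis
  \<comment> \<open>\<open>v\<close> is fixed, so the bound, known for every height below
    \<open>a\<close>, passes to the limit without reference to values of \<open>F\<close> at height
    \<open>a\<close>.\<close>
  proof (rule tendsto_lowerbound)
    show "((\<lambda>\<theta>. 2 * N * exp (- \<theta> * \<bar>v\<bar>)) \<longlongrightarrow> 2 * N * exp (- a * \<bar>v\<bar>)) (at_left a)"
      by (intro tendsto_intros)
    show "\<forall>\<^sub>F \<theta> in at_left a. cmod (?\<psi> v) \<le> 2 * N * exp (- \<theta> * \<bar>v\<bar>)"
      using eventually_at_left_real[OF \<open>0 < a\<close>] by eventually_elim (rule below, auto)
  qed simp
qed

lemma strip_transform_L1_integrable:
  assumes "0 < a" and hol: "F holomorphic_on strip a"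
    and int: "\<And>\<theta>. \<bar>\<theta>\<bar> < a \<Longrightarrow> integrable lborel (\<lambda>x. F (Complex x \<theta>))"
    and N: "\<And>\<theta>. 0 < \<theta> \<Longrightarrow> \<theta> < a \<Longrightarrow>
      (LINT x|lborel. cmod (F (Complex x \<theta>))) + (LINT x|lborel. cmod (F (Complex x (- \<theta>)))) \<le> 2 * N"
  shows "integrable lborel (ft (\<lambda>x. F (Complex x 0)))"
proof (rule Bochner_Integration.integrable_bound)
  show "integrable lborel (\<lambda>v. 2 * N * exp (- a * \<bar>v\<bar>))"
    by (intro integrable_mult_right integrable_exp_neg_abs \<open>0 < a\<close>)
  have [measurable]: "(\<lambda>x. F (Complex x 0)) \<in> borel_measurable borel"
    by (rule line_measurable[OF hol]) (use \<open>0 < a\<close> in simp)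
  show "ft (\<lambda>x. F (Complex x 0)) \<in> borel_measurable lborel" by measurable
  show "AE v in lborel. cmod (ft (\<lambda>x. F (Complex x 0)) v) \<le> norm (2 * N * exp (- a * \<bar>v\<bar>))"
    using order_trans[OF strip_transform_L1_bound[OF assms] abs_ge_self] by simp
qed

lemma strip_transform_L1_inversion:
  assumes "0 < a" and hol: "F holomorphic_on strip a"
    and int: "\<And>\<theta>. \<bar>\<theta>\<bar> < a \<Longrightarrow> integrable lborel (\<lambda>x. F (Complex x \<theta>))"
    and N: "\<And>\<theta>. 0 < \<theta> \<Longrightarrow> \<theta> < a \<Longrightarrow>
      (LINT x|lborel. cmod (F (Complex x \<theta>))) + (LINT x|lborel. cmod (F (Complex x (- \<theta>)))) \<le> 2 * N"
  shows "F (Complex t 0) = ft (ft (\<lambda>x. F (Complex x 0))) (- t) / (2 * pi)"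
proof (rule fourier_inversion)
  show "isCont (\<lambda>x. F (Complex x 0)) t"
    using continuous_on_line[OF hol, of 0] \<open>0 < a\<close> by (simp add: continuous_on_eq_continuous_at)
qed (use int[of 0] \<open>0 < a\<close> strip_transform_L1_integrable[OF assms] in auto)

text \<open>Completeness of L1 for a geometrically fast Cauchy sequence. The almost everywhere
  convergence is part of the result because Fatou will be applied to the same sequence.\<close>

lemma L1_fast_cauchy_converges:
  fixes f :: "nat \<Rightarrow> 'a \<Rightarrow> complex"
  assumes f: "\<And>k. integrable M (f k)"
    and B: "\<And>k. (\<integral>\<^sup>+ x. ennreal (cmod (f (Suc k) x - f k x)) \<partial>M) \<le> ennreal (B * (1 / 2) ^ k)"
  obtains g where "integrable M g" "AE x in M. (\<lambda>k. f k x) \<longlonglongrightarrow> g x"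
    "(\<lambda>k. LINT x|M. cmod (f k x - g x)) \<longlonglongrightarrow> 0"
proof -
  have [measurable]: "f k \<in> borel_measurable M" for k using f by auto
  define s where "s x = (\<Sum>k. ennreal (cmod (f (Suc k) x - f k x)))" for x
  have [measurable]: "s \<in> borel_measurable M" unfolding s_def[abs_def] by measurable
  have sums: "(\<lambda>k. B * (1 / 2) ^ k) sums (B * 2)"
    using sums_mult[OF geometric_sums[of "1 / 2 :: real"], of B] by simp
  have "(\<integral>\<^sup>+ x. s x \<partial>M) = (\<Sum>k. \<integral>\<^sup>+ x. ennreal (cmod (f (Suc k) x - f k x)) \<partial>M)"
    unfolding s_def by (rule nn_integral_suminf) measurable
  also have "\<dots> \<le> (\<Sum>k. ennreal (\<bar>B\<bar> * (1 / 2) ^ k))"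
    by (intro suminf_le order_trans[OF B] ennreal_leI mult_right_mono) auto
  also have "\<dots> = ennreal (\<Sum>k. \<bar>B\<bar> * (1 / 2) ^ k)"
    by (intro suminf_ennreal2) (auto intro!: summable_mult summable_geometric)
  finally have s_int: "(\<integral>\<^sup>+ x. s x \<partial>M) < \<infinity>"
    by (rule order_le_less_trans) simp
  hence s_fin: "AE x in M. s x \<noteq> \<infinity>"
    by (intro nn_integral_noteq_infinite) auto
  \<comment> \<open>The value of \<open>lim\<close> is arbitrary where the sequence diverges, which
    can happen only on the null set where \<open>s\<close> is infinite. By telescoping,
    \<open>w\<close> below dominates every \<open>f k\<close> off that set.\<close>
  define g where "g x = lim (\<lambda>k. f k x)" for x
  define w where "w x = cmod (f 0 x) + enn2real (s x)" for x
  have w: "integrable M w"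
  proof -
    have "integrable M (\<lambda>x. enn2real (s x))"
    proof (rule integrableI_bounded)
      have "(\<integral>\<^sup>+ x. ennreal (norm (enn2real (s x))) \<partial>M) \<le> (\<integral>\<^sup>+ x. s x \<partial>M)"
        by (intro nn_integral_mono) (simp add: ennreal_enn2real_if)
      thus "(\<integral>\<^sup>+ x. ennreal (norm (enn2real (s x))) \<partial>M) < \<infinity>"
        using s_int by (rule order_le_less_trans)
    qed measurable
    thus ?thesis unfolding w_def[abs_def] using f by auto
  qed
  have pointwise: "(\<lambda>k. f k x) \<longlonglongrightarrow> g x \<and> (\<forall>k. cmod (f k x) \<le> w x)" if "s x \<noteq> \<infinity>" for x
  proof -
    have summ: "summable (\<lambda>k. cmod (f (Suc k) x - f k x))"
      using that unfolding s_def by (intro summable_suminf_not_top) auto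
    have s_eq: "enn2real (s x) = (\<Sum>k. cmod (f (Suc k) x - f k x))"
      unfolding s_def using summ by (subst suminf_ennreal2) (auto intro!: enn2real_ennreal suminf_nonneg)
    have tele: "f n x = f 0 x + (\<Sum>k<n. f (Suc k) x - f k x)" for n
      by (subst sum_lessThan_telescope) simp
    have "(\<lambda>n. f 0 x + (\<Sum>k<n. f (Suc k) x - f k x)) \<longlonglongrightarrow> f 0 x + (\<Sum>k. f (Suc k) x - f k x)"
      by (intro tendsto_intros summable_LIMSEQ summable_norm_cancel[OF summ])
    hence "convergent (\<lambda>k. f k x)"
      unfolding tele[symmetric] by (auto simp: convergent_def)
    moreover have "cmod (f n x) \<le> w x" for n
    proof -
      have "cmod (f n x) \<le> cmod (f 0 x) + cmod (\<Sum>k<n. f (Suc k) x - f k x)"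
        by (subst tele) (rule norm_triangle_ineq)
      also have "cmod (\<Sum>k<n. f (Suc k) x - f k x) \<le> (\<Sum>k<n. cmod (f (Suc k) x - f k x))"
        by (rule norm_sum)
      also have "\<dots> \<le> enn2real (s x)"
        unfolding s_eq by (rule sum_le_suminf[OF summ]) auto
      finally show ?thesis by (simp add: w_def)
    qed
    ultimately show ?thesis
      unfolding g_def using convergent_LIMSEQ_iff by blast
  qed
  have lim: "AE x in M. (\<lambda>k. f k x) \<longlonglongrightarrow> g x"
    using s_fin by eventually_elim (use pointwise in blast)
  have dom: "AE x in M. cmod (f k x) \<le> w x" for k
    using s_fin by eventually_elim (use pointwise in blast)
  have [measurable]: "g \<in> borel_measurable M"
    unfolding g_def[abs_def] by measurable
  have g: "integrable M g"
    by (rule integrable_dominated_convergence[OF _ _ w lim dom]) measurable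
  have "(\<lambda>k. LINT x|M. cmod (f k x - g x)) \<longlonglongrightarrow> (LINT x|M. 0)"
  proof (rule integral_dominated_convergence)
    show "integrable M (\<lambda>x. w x + cmod (g x))" using w g by auto
    show "AE x in M. (\<lambda>k. cmod (f k x - g x)) \<longlonglongrightarrow> 0"
      using lim by eventually_elim (auto intro: tendsto_norm_zero LIM_zero)
    show "AE x in M. norm (cmod (f k x - g x)) \<le> w x + cmod (g x)" for k
      using dom[of k] by eventually_elim (use norm_triangle_ineq4 in \<open>fastforce intro: order_trans\<close>)
  qed measurable
  thus ?thesis using that g lim by simp
qed

section \<open>Square-integrable functions on the strip\<close>

lemma plancherel_strip:
  assumes hol: "F holomorphic_on strip a" and \<theta>: "\<bar>\<theta>\<bar> < a"
    and int: "\<And>\<theta>. \<bar>\<theta>\<bar> < a \<Longrightarrow> integrable lborel (\<lambda>x. F (Complex x \<theta>))"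
    and M: "\<And>\<theta>. \<bar>\<theta>\<bar> < a \<Longrightarrow> (LINT x|lborel. cmod (F (Complex x \<theta>))) \<le> M"
  shows "(\<integral>\<^sup>+ v. ennreal ((cmod (ft (\<lambda>x. F (Complex x 0)) v))\<^sup>2 * exp (2 * \<theta> * \<bar>v\<bar>)) \<partial>lborel) \<le>
    ennreal (2 * pi) * ((\<integral>\<^sup>+ x. ennreal ((cmod (F (Complex x \<theta>)))\<^sup>2) \<partial>lborel) +
      (\<integral>\<^sup>+ x. ennreal ((cmod (F (Complex x (- \<theta>))))\<^sup>2) \<partial>lborel))"
proof -
  let ?\<psi> = "ft (\<lambda>x. F (Complex x 0))"
  have [measurable]: "(\<lambda>x. F (Complex x 0)) \<in> borel_measurable borel"
    by (rule line_measurable[OF hol]) (use \<theta> in auto)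
  have line: "(\<integral>\<^sup>+ v. ennreal ((cmod (?\<psi> v))\<^sup>2 * exp (v * (2 * y))) \<partial>lborel) \<le>
      ennreal (2 * pi) * (\<integral>\<^sup>+ x. ennreal ((cmod (F (Complex x y)))\<^sup>2) \<partial>lborel)" if "\<bar>y\<bar> < a" for y
  proof -
    have "(cmod (ft (\<lambda>x. F (Complex x y)) v))\<^sup>2 = (cmod (?\<psi> v))\<^sup>2 * exp (v * (2 * y))" for v
    proof -
      have "exp (v * (2 * y)) = (exp (v * y))\<^sup>2" by (simp add: exp_double[symmetric] mult_ac)
      thus ?thesis by (subst ft_line[OF hol that int M]) (auto simp: norm_mult power_mult_distrib)
    qed
    thus ?thesis using plancherel_le[OF int[OF that]] by simp
  qed
  \<comment> \<open>Plancherel on the line of height \<open>y\<close> carries the weight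
    \<open>exp (2 * v * y)\<close>; the heights \<open>\<theta>\<close> and
    \<open>- \<theta>\<close> together cover the two-sided weight.\<close>
  have "(\<integral>\<^sup>+ v. ennreal ((cmod (?\<psi> v))\<^sup>2 * exp (2 * \<theta> * \<bar>v\<bar>)) \<partial>lborel) \<le>
      (\<integral>\<^sup>+ v. ennreal ((cmod (?\<psi> v))\<^sup>2 * exp (v * (2 * \<theta>))) + ennreal ((cmod (?\<psi> v))\<^sup>2 * exp (v * (2 * (- \<theta>)))) \<partial>lborel)"
    using mult_left_mono[OF exp_mult_abs_le[of "2 * \<theta>"]]
    by (intro nn_integral_mono) (simp add: ennreal_plus[symmetric] ring_distribs ennreal_leI del: ennreal_plus)
  also have "\<dots> = (\<integral>\<^sup>+ v. ennreal ((cmod (?\<psi> v))\<^sup>2 * exp (v * (2 * \<theta>))) \<partial>lborel) +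
      (\<integral>\<^sup>+ v. ennreal ((cmod (?\<psi> v))\<^sup>2 * exp (v * (2 * (- \<theta>)))) \<partial>lborel)"
    by (rule nn_integral_add) measurable
  also have "\<dots> \<le> ennreal (2 * pi) * (\<integral>\<^sup>+ x. ennreal ((cmod (F (Complex x \<theta>)))\<^sup>2) \<partial>lborel) +
      ennreal (2 * pi) * (\<integral>\<^sup>+ x. ennreal ((cmod (F (Complex x (- \<theta>))))\<^sup>2) \<partial>lborel)"
    by (intro add_mono line) (use \<theta> in auto)
  finally show ?thesis by (simp add: distrib_left)
qed

text \<open>Weighted Cauchy--Schwarz, in the linearised form \<open>2 x y \<le> l x\<^sup>2 + y\<^sup>2 / l\<close>.\<close>

lemma nn_integral_weighted_le:
  fixes g :: "real \<Rightarrow> complex"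
  assumes [measurable]: "g \<in> borel_measurable borel" and "0 < l" "0 < b" "0 \<le> S"
    and S: "(\<integral>\<^sup>+ v. ennreal ((cmod (g v))\<^sup>2 * exp (2 * b * \<bar>v\<bar>)) \<partial>lborel) \<le> ennreal S"
  shows "(\<integral>\<^sup>+ v. ennreal (cmod (g v)) \<partial>lborel) \<le> ennreal (l * S / 2 + 1 / (2 * b * l))"
proof -
  have pointwise: "cmod (g v) \<le> l / 2 * ((cmod (g v))\<^sup>2 * exp (2 * b * \<bar>v\<bar>)) + 1 / (2 * l) * exp (- (2 * b) * \<bar>v\<bar>)" for v
  proof -
    define e where "e = exp (b * \<bar>v\<bar>)"
    have e: "0 < e" "exp (2 * b * \<bar>v\<bar>) = e\<^sup>2" "exp (- (2 * b) * \<bar>v\<bar>) = 1 / e\<^sup>2"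
      by (auto simp: e_def exp_double[symmetric] exp_minus field_simps power2_eq_square simp flip: exp_add)
    have "0 \<le> (l * (cmod (g v) * e) - 1 / e)\<^sup>2 / (2 * l)"
      using \<open>0 < l\<close> by simp
    also have "\<dots> = l / 2 * ((cmod (g v))\<^sup>2 * e\<^sup>2) + 1 / (2 * l) * (1 / e\<^sup>2) - cmod (g v)"
      using \<open>0 < l\<close> e(1) by (simp add: power2_eq_square field_simps)
    finally show ?thesis unfolding e by linarith
  qed
  have "(\<integral>\<^sup>+ v. ennreal (cmod (g v)) \<partial>lborel) \<le>
      (\<integral>\<^sup>+ v. ennreal (l / 2) * ennreal ((cmod (g v))\<^sup>2 * exp (2 * b * \<bar>v\<bar>)) +
        ennreal (1 / (2 * l)) * ennreal (exp (- (2 * b) * \<bar>v\<bar>)) \<partial>lborel)"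
  proof (intro nn_integral_mono)
    fix v
    show "ennreal (cmod (g v)) \<le> ennreal (l / 2) * ennreal ((cmod (g v))\<^sup>2 * exp (2 * b * \<bar>v\<bar>)) +
        ennreal (1 / (2 * l)) * ennreal (exp (- (2 * b) * \<bar>v\<bar>))"
      using pointwise[of v] \<open>0 < l\<close>
      by (subst (1 2) ennreal_mult[symmetric]) (auto simp: ennreal_plus[symmetric] intro!: ennreal_leI simp del: ennreal_plus)
  qed
  also have "\<dots> = ennreal (l / 2) * (\<integral>\<^sup>+ v. ennreal ((cmod (g v))\<^sup>2 * exp (2 * b * \<bar>v\<bar>)) \<partial>lborel) +
      ennreal (1 / (2 * l)) * (\<integral>\<^sup>+ v. ennreal (exp (- (2 * b) * \<bar>v\<bar>)) \<partial>lborel)"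
    by (simp add: nn_integral_add nn_integral_cmult)
  also have "\<dots> \<le> ennreal (l / 2) * ennreal S + ennreal (1 / (2 * l)) * ennreal (2 / (2 * b))"
    using nn_integral_exp_tail_le[of "2 * b" 0] \<open>0 < b\<close> S by (intro add_mono mult_left_mono) auto
  also have "\<dots> = ennreal (l * S / 2 + 1 / (2 * b * l))"
    using assms by (simp add: ennreal_mult[symmetric] ennreal_plus[symmetric] field_simps del: ennreal_plus)
  finally show ?thesis .
qed

text \<open>An entire Gaussian, so that products with \<open>F\<close> stay holomorphic. The quarter
  makes its squared modulus on a line a constant times
  \<open>exp (- (x / (n + 1))\<^sup>2 / 2)\<close>, the Gaussian already known to be integrable. Off
  the real axis the modulus can exceed 1, by a factor that tends to 1 with growing
  \<open>n\<close>.\<close>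

definition damp :: "nat \<Rightarrow> complex \<Rightarrow> complex"
  where "damp n z = exp (- (z / of_nat (Suc n))\<^sup>2 / 4)"

lemma damp_holomorphic: "damp n holomorphic_on A"
  unfolding damp_def[abs_def] by (intro holomorphic_intros) auto

lemma norm_damp: "cmod (damp n (Complex x \<theta>)) = exp (((\<theta> / real (Suc n))\<^sup>2 - (x / real (Suc n))\<^sup>2) / 4)"
proof -
  have "Complex x \<theta> / of_nat (Suc n) = Complex (x / real (Suc n)) (\<theta> / real (Suc n))"
    by (simp add: complex_eq_iff del: of_nat_Suc)
  moreover have "Re (- (Complex u w)\<^sup>2 / 4) = (w\<^sup>2 - u\<^sup>2) / 4" for u w
    by (simp add: power2_eq_square field_simps)
  ultimately show ?thesis unfolding damp_def norm_exp_eq_Re by (simp only:)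
qed

lemma norm_damp_le: "cmod (damp n (Complex x \<theta>)) \<le> exp ((\<theta> / real (Suc n))\<^sup>2 / 4)"
  unfolding norm_damp by (simp del: of_nat_Suc)

lemma norm_damp_le': "cmod (damp n (Complex x \<theta>)) \<le> exp (\<theta>\<^sup>2 / 4)"
proof -
  have "\<bar>\<theta> / real (Suc n)\<bar> \<le> \<bar>\<theta>\<bar>"
    by (simp add: field_simps mult_le_cancel_left1)
  hence "(\<theta> / real (Suc n))\<^sup>2 \<le> \<theta>\<^sup>2" by (simp only: abs_le_square_iff)
  thus ?thesis using norm_damp_le[of n x \<theta>] by (intro order_trans[OF norm_damp_le]) simp
qed

lemma damp_tendsto: "(\<lambda>n. damp n z) \<longlonglongrightarrow> 1"
proof -
  have "(\<lambda>n. z / of_nat (Suc n)) \<longlonglongrightarrow> 0"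
    using LIMSEQ_Suc[OF lim_const_over_n[of z]] by simp
  hence "(\<lambda>n. damp n z) \<longlonglongrightarrow> exp (- 0\<^sup>2 / 4)"
    unfolding damp_def by (intro tendsto_intros) auto
  thus ?thesis by simp
qed

lemma damp_measurable: "(\<lambda>x. damp n (Complex x \<theta>)) \<in> borel_measurable borel"
  unfolding damp_def Complex_eq by (intro borel_measurable_continuous_onI continuous_intros) (auto simp del: of_nat_Suc)

lemma damp_square_integrable: "integrable lborel (\<lambda>x. (cmod (damp n (Complex x \<theta>)))\<^sup>2)"
  and damp_square_integral: "(LINT x|lborel. (cmod (damp n (Complex x \<theta>)))\<^sup>2) =
    exp ((\<theta> / real (Suc n))\<^sup>2 / 2) * (LINT x|lborel. exp (- (1 / real (Suc n) * x)\<^sup>2 / 2))"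
proof -
  have eq: "(cmod (damp n (Complex x \<theta>)))\<^sup>2 =
      exp ((\<theta> / real (Suc n))\<^sup>2 / 2) * exp (- (1 / real (Suc n) * x)\<^sup>2 / 2)" for x
  proof -
    have "2 * (((\<theta> / real (Suc n))\<^sup>2 - (x / real (Suc n))\<^sup>2) / 4) =
        (\<theta> / real (Suc n))\<^sup>2 / 2 + - (1 / real (Suc n) * x)\<^sup>2 / 2"
      by (simp del: of_nat_Suc add: field_simps)
    thus ?thesis unfolding norm_damp exp_double[symmetric] exp_add[symmetric] by (rule arg_cong)
  qed
  have "integrable lborel (\<lambda>v. exp (- (1 / real (Suc n) * v)\<^sup>2 / 2))"
    using integrable_gaussian[of "1 / real (Suc n)"] by (simp only: complex_of_real_integrable_eq) simp
  thus "integrable lborel (\<lambda>x. (cmod (damp n (Complex x \<theta>)))\<^sup>2)"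
    unfolding eq by (rule integrable_mult_right)
  show "(LINT x|lborel. (cmod (damp n (Complex x \<theta>)))\<^sup>2) =
    exp ((\<theta> / real (Suc n))\<^sup>2 / 2) * (LINT x|lborel. exp (- (1 / real (Suc n) * x)\<^sup>2 / 2))"
    unfolding eq by (rule integral_mult_right_zero)
qed

text \<open>An \<open>L\<^sup>2\<close> function on the strip need not be integrable along lines, so its transform is obtained
  as the \<open>L\<^sup>1\<close> limit of the transforms of the Gaussian regularisations \<open>F z * damp n z\<close>.\<close>

lemma strip_transform_L2:
  assumes "0 < a" and hol: "F holomorphic_on strip a"
    and int: "\<And>\<theta>. \<bar>\<theta>\<bar> < a \<Longrightarrow> integrable lborel (\<lambda>x. (cmod (F (Complex x \<theta>)))\<^sup>2)"
    and K: "\<And>\<theta>. 0 < \<theta> \<Longrightarrow> \<theta> < a \<Longrightarrow>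
      (LINT x|lborel. (cmod (F (Complex x \<theta>)))\<^sup>2) + (LINT x|lborel. (cmod (F (Complex x (- \<theta>))))\<^sup>2) \<le> 2 * K"
  obtains \<psi> where "integrable lborel \<psi>"
    "(\<integral>\<^sup>+ v. ennreal ((cmod (\<psi> v))\<^sup>2 * exp (2 * a * \<bar>v\<bar>)) \<partial>lborel) \<le> ennreal (4 * pi * K)"
    "\<And>t. F (Complex t 0) = ft \<psi> (- t) / (2 * pi)"
proof -
  define I where "I \<theta> = (LINT x|lborel. (cmod (F (Complex x \<theta>)))\<^sup>2)" for \<theta>
  define Imax where "Imax = max (2 * K) (I 0)"
  have I_le: "I \<theta> \<le> Imax" if "\<bar>\<theta>\<bar> < a" for \<theta>
    unfolding Imax_def
    by (rule le_max_of_symmetric_sum[where I = I, OF _ _ that]) (auto simp: I_def K)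
  have F_meas: "(\<lambda>x. F (Complex x \<theta>)) \<in> borel_measurable borel" if "\<bar>\<theta>\<bar> < a" for \<theta>
    by (rule line_measurable[OF hol that])
  define Fn where "Fn n z = F z * damp n z" for n z
  have Fn_hol: "Fn n holomorphic_on strip a" for n
    unfolding Fn_def[abs_def] by (intro holomorphic_on_mult hol damp_holomorphic)
  \<comment> \<open>A product of two square-integrable functions is integrable; the crude bound is
    enough because only the existence of some uniform constant matters here.\<close>
  have Fn_le: "cmod (Fn n (Complex x \<theta>)) \<le>
      (cmod (F (Complex x \<theta>)))\<^sup>2 + (cmod (damp n (Complex x \<theta>)))\<^sup>2" for n x \<theta>
  proof -
    have "2 * cmod (F (Complex x \<theta>)) * cmod (damp n (Complex x \<theta>)) \<le>
        (cmod (F (Complex x \<theta>)))\<^sup>2 + (cmod (damp n (Complex x \<theta>)))\<^sup>2"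
      by (rule sum_squares_bound)
    moreover have "0 \<le> cmod (F (Complex x \<theta>)) * cmod (damp n (Complex x \<theta>))" by simp
    ultimately show ?thesis unfolding Fn_def norm_mult by linarith
  qed
  have Fn_int: "integrable lborel (\<lambda>x. Fn n (Complex x \<theta>))" if "\<bar>\<theta>\<bar> < a" for n \<theta>
  proof (rule Bochner_Integration.integrable_bound)
    show "integrable lborel (\<lambda>x. (cmod (F (Complex x \<theta>)))\<^sup>2 + (cmod (damp n (Complex x \<theta>)))\<^sup>2)"
      by (intro Bochner_Integration.integrable_add int that damp_square_integrable)
    show "(\<lambda>x. Fn n (Complex x \<theta>)) \<in> borel_measurable lborel"
      using line_measurable[OF Fn_hol that] by simp
    show "AE x in lborel. cmod (Fn n (Complex x \<theta>)) \<le> norm ((cmod (F (Complex x \<theta>)))\<^sup>2 + (cmod (damp n (Complex x \<theta>)))\<^sup>2)"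
      using order_trans[OF Fn_le abs_ge_self] by simp
  qed
  define c where "c n = (LINT x|lborel. exp (- (1 / real (Suc n) * x)\<^sup>2 / 2))" for n
  \<comment> \<open>This constant depends on \<open>n\<close>, which is harmless: the line shift for
    \<open>Fn n\<close> asks for uniformity in \<open>\<theta>\<close> alone.\<close>
  define M where "M n = Imax + exp (a\<^sup>2 / 2) * c n" for n
  have M: "(LINT x|lborel. cmod (Fn n (Complex x \<theta>))) \<le> M n" if "\<bar>\<theta>\<bar> < a" for n \<theta>
  proof -
    have "(LINT x|lborel. cmod (Fn n (Complex x \<theta>))) \<le>
        (LINT x|lborel. (cmod (F (Complex x \<theta>)))\<^sup>2 + (cmod (damp n (Complex x \<theta>)))\<^sup>2)"
      using Fn_int[OF that]
      by (intro integral_mono Fn_le Bochner_Integration.integrable_add int that damp_square_integrable) auto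
    also have "\<dots> = I \<theta> + exp ((\<theta> / real (Suc n))\<^sup>2 / 2) * c n"
      unfolding I_def c_def damp_square_integral[symmetric]
      by (intro Bochner_Integration.integral_add int that damp_square_integrable)
    also have "\<dots> \<le> M n"
    proof -
      have "\<bar>\<theta> / real (Suc n)\<bar> \<le> \<bar>\<theta>\<bar>" by (simp add: field_simps mult_le_cancel_left1)
      also have "\<dots> \<le> \<bar>a\<bar>" using that by simp
      finally have "(\<theta> / real (Suc n))\<^sup>2 \<le> a\<^sup>2" by (simp only: abs_le_square_iff)
      moreover have "0 \<le> c n" by (simp add: c_def)
      ultimately show ?thesis unfolding M_def using I_le[OF that]
        by (intro add_mono mult_right_mono) auto
    qed
    finally show ?thesis .
  qed
  have MM: "(LINT x|lborel. cmod (Fn n (Complex x \<theta>))) + (LINT x|lborel. cmod (Fn n (Complex x (- \<theta>)))) \<le> 2 * M n"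
    if "0 < \<theta>" "\<theta> < a" for n \<theta>
    using M[of \<theta> n] M[of "- \<theta>" n] that by simp
  define \<psi>n where "\<psi>n n = ft (\<lambda>x. Fn n (Complex x 0))" for n
  have \<psi>n_int: "integrable lborel (\<psi>n n)" for n
    unfolding \<psi>n_def by (rule strip_transform_L1_integrable[OF \<open>0 < a\<close> Fn_hol Fn_int MM])
  have Fn_inv: "Fn n (Complex t 0) = ft (\<psi>n n) (- t) / (2 * pi)" for n t
    unfolding \<psi>n_def by (rule strip_transform_L1_inversion[OF \<open>0 < a\<close> Fn_hol Fn_int MM])
  have a0: "\<bar>0\<bar> < a" using \<open>0 < a\<close> by simp
  \<comment> \<open>Any height strictly between 0 and \<open>a\<close> would serve. The weight
    \<open>exp (2 * b * |v|)\<close> gained there is what lets a square norm of the spectrum control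
    its L1 norm.\<close>
  define b where "b = a / 2"
  have b: "0 < b" "\<bar>b\<bar> < a" "\<bar>- b\<bar> < a" using \<open>0 < a\<close> by (auto simp: b_def)

  define err where "err n \<theta> = (LINT x|lborel. (cmod (F (Complex x \<theta>) * (damp n (Complex x \<theta>) - 1)))\<^sup>2)" for n \<theta>
  have err_dom: "(cmod (F (Complex x \<theta>) * (damp n (Complex x \<theta>) - 1)))\<^sup>2 \<le>
      (exp (\<theta>\<^sup>2 / 4) + 1)\<^sup>2 * (cmod (F (Complex x \<theta>)))\<^sup>2" for n x \<theta>
  proof -
    have "cmod (damp n (Complex x \<theta>) - 1) \<le> exp (\<theta>\<^sup>2 / 4) + 1"
      using norm_triangle_ineq4[of "damp n (Complex x \<theta>)" 1] norm_damp_le'[of n x \<theta>] by simp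
    hence "(cmod (damp n (Complex x \<theta>) - 1))\<^sup>2 \<le> (exp (\<theta>\<^sup>2 / 4) + 1)\<^sup>2"
      by (rule power_mono) simp
    thus ?thesis by (simp add: norm_mult power_mult_distrib mult.commute mult_left_mono)
  qed
  have err_meas: "(\<lambda>x. (cmod (F (Complex x \<theta>) * (damp n (Complex x \<theta>) - 1)))\<^sup>2) \<in> borel_measurable borel"
    if "\<bar>\<theta>\<bar> < a" for n \<theta>
  proof -
    note [measurable] = F_meas[OF that] damp_measurable[of n \<theta>]
    show ?thesis by measurable
  qed
  have err_int: "integrable lborel (\<lambda>x. (cmod (F (Complex x \<theta>) * (damp n (Complex x \<theta>) - 1)))\<^sup>2)"
    if "\<bar>\<theta>\<bar> < a" for n \<theta>
  proof (rule Bochner_Integration.integrable_bound)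
    show "integrable lborel (\<lambda>x. (exp (\<theta>\<^sup>2 / 4) + 1)\<^sup>2 * (cmod (F (Complex x \<theta>)))\<^sup>2)"
      by (intro integrable_mult_right int that)
  qed (use err_dom err_meas[OF that] in \<open>auto intro!: AE_I2\<close>)
  have err_lim: "(\<lambda>n. err n \<theta>) \<longlonglongrightarrow> 0" if "\<bar>\<theta>\<bar> < a" for \<theta>
  proof -
    have "(\<lambda>n. err n \<theta>) \<longlonglongrightarrow> (LINT x::real|lborel. 0)"
      unfolding err_def
    proof (rule integral_dominated_convergence)
      show "integrable lborel (\<lambda>x. (exp (\<theta>\<^sup>2 / 4) + 1)\<^sup>2 * (cmod (F (Complex x \<theta>)))\<^sup>2)"
        by (intro integrable_mult_right int that)
      show "AE x in lborel. (\<lambda>n. (cmod (F (Complex x \<theta>) * (damp n (Complex x \<theta>) - 1)))\<^sup>2) \<longlonglongrightarrow> 0"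
      proof (rule AE_I2)
        fix x
        have "(\<lambda>n. (cmod (F (Complex x \<theta>) * (damp n (Complex x \<theta>) - 1)))\<^sup>2) \<longlonglongrightarrow>
            (cmod (F (Complex x \<theta>) * (1 - 1)))\<^sup>2"
          by (intro tendsto_intros damp_tendsto)
        thus "(\<lambda>n. (cmod (F (Complex x \<theta>) * (damp n (Complex x \<theta>) - 1)))\<^sup>2) \<longlonglongrightarrow> 0" by simp
      qed
    qed (use err_dom err_meas[OF that] in \<open>auto intro!: AE_I2\<close>)
    thus ?thesis by simp
  qed
  define E where "E n = err n b + err n (- b)" for n
  have E_lim: "E \<longlonglongrightarrow> 0 + 0"
    unfolding E_def[abs_def] by (intro tendsto_add err_lim b)
  \<comment> \<open>A squared error of order \<open>4 ^ (- k)\<close> becomes an L1 error of order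
    \<open>2 ^ (- k)\<close> after Cauchy-Schwarz. The condition \<open>k \<le> n\<close> makes the
    selected indices tend to infinity.\<close>
  have "\<exists>n\<ge>k. E n \<le> (1 / 4) ^ k" for k :: nat
  proof -
    have "\<forall>\<^sub>F n in sequentially. E n < (1 / 4) ^ k"
      by (rule order_tendstoD(2)[OF E_lim]) simp
    hence "\<forall>\<^sub>F n in sequentially. E n < (1 / 4) ^ k \<and> k \<le> n"
      by (intro eventually_conj eventually_ge_at_top)
    from eventually_happens[OF this] show ?thesis by (auto intro: less_imp_le)
  qed
  then obtain r where r: "\<And>k. k \<le> r k" "\<And>k. E (r k) \<le> (1 / 4) ^ k" by metis

  \<comment> \<open>\<open>Fn n - Fn m\<close> is the difference of two regularisation errors, each
    small in square norm on the lines \<open>b\<close> and \<open>- b\<close>; Plancherel transfers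
    this to the spectra.\<close>
  have diff: "(\<integral>\<^sup>+ v. ennreal ((cmod (\<psi>n n v - \<psi>n m v))\<^sup>2 * exp (2 * b * \<bar>v\<bar>)) \<partial>lborel) \<le>
      ennreal (2 * pi * (2 * E n + 2 * E m))" for n m
  proof -
    define G where "G z = Fn n z - Fn m z" for z
    have G_hol: "G holomorphic_on strip a"
      unfolding G_def[abs_def] by (intro holomorphic_on_diff Fn_hol)
    have G_int: "integrable lborel (\<lambda>x. G (Complex x \<theta>))" if "\<bar>\<theta>\<bar> < a" for \<theta>
      unfolding G_def by (intro Bochner_Integration.integrable_diff Fn_int that)
    have G_M: "(LINT x|lborel. cmod (G (Complex x \<theta>))) \<le> M n + M m" if "\<bar>\<theta>\<bar> < a" for \<theta>
    proof -
      have "(LINT x|lborel. cmod (G (Complex x \<theta>))) \<le>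
          (LINT x|lborel. cmod (Fn n (Complex x \<theta>)) + cmod (Fn m (Complex x \<theta>)))"
        using G_int[OF that] Fn_int[OF that]
        by (intro integral_mono) (auto simp: G_def norm_triangle_ineq4)
      also have "\<dots> \<le> M n + M m"
        using Fn_int[OF that] M[OF that, of n] M[OF that, of m] by simp
      finally show ?thesis .
    qed
    have ft_G: "ft (\<lambda>x. G (Complex x 0)) v = \<psi>n n v - \<psi>n m v" for v
      unfolding \<psi>n_def G_def by (intro ft_diff Fn_int a0)
    have G_sq: "(\<integral>\<^sup>+ x. ennreal ((cmod (G (Complex x \<theta>)))\<^sup>2) \<partial>lborel) \<le> ennreal (2 * err n \<theta> + 2 * err m \<theta>)"
      if "\<bar>\<theta>\<bar> < a" for \<theta>
    proof -
      have "(cmod (G z))\<^sup>2 \<le> 2 * (cmod (F z * (damp n z - 1)))\<^sup>2 + 2 * (cmod (F z * (damp m z - 1)))\<^sup>2" for z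
      proof -
        let ?p = "cmod (F z * (damp n z - 1))" and ?q = "cmod (F z * (damp m z - 1))"
        have "G z = F z * (damp n z - 1) - F z * (damp m z - 1)"
          by (simp add: G_def Fn_def algebra_simps)
        hence "(cmod (G z))\<^sup>2 \<le> (?p + ?q)\<^sup>2"
          by (intro power_mono) (simp_all add: norm_triangle_ineq4)
        also have "\<dots> \<le> 2 * ?p\<^sup>2 + 2 * ?q\<^sup>2"
          using sum_squares_bound[of ?p ?q] by (simp add: power2_sum)
        finally show ?thesis .
      qed
      hence "(\<integral>\<^sup>+ x. ennreal ((cmod (G (Complex x \<theta>)))\<^sup>2) \<partial>lborel) \<le>
          (\<integral>\<^sup>+ x. ennreal (2 * (cmod (F (Complex x \<theta>) * (damp n (Complex x \<theta>) - 1)))\<^sup>2 +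
            2 * (cmod (F (Complex x \<theta>) * (damp m (Complex x \<theta>) - 1)))\<^sup>2) \<partial>lborel)"
        by (intro nn_integral_mono ennreal_leI)
      also have "\<dots> = ennreal (LINT x|lborel. 2 * (cmod (F (Complex x \<theta>) * (damp n (Complex x \<theta>) - 1)))\<^sup>2 +
            2 * (cmod (F (Complex x \<theta>) * (damp m (Complex x \<theta>) - 1)))\<^sup>2)"
        by (rule nn_integral_eq_integral) (auto intro!: err_int that simp del: norm_mult)
      also have "\<dots> = ennreal (2 * err n \<theta> + 2 * err m \<theta>)"
        unfolding err_def
        by (subst Bochner_Integration.integral_add)
           (intro integrable_mult_right err_int that, intro integrable_mult_right err_int that, simp only: integral_mult_right_zero)
      finally show ?thesis .
    qed
    have "(\<integral>\<^sup>+ v. ennreal ((cmod (\<psi>n n v - \<psi>n m v))\<^sup>2 * exp (2 * b * \<bar>v\<bar>)) \<partial>lborel) \<le>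
      ennreal (2 * pi) * ((\<integral>\<^sup>+ x. ennreal ((cmod (G (Complex x b)))\<^sup>2) \<partial>lborel) +
      (\<integral>\<^sup>+ x. ennreal ((cmod (G (Complex x (- b))))\<^sup>2) \<partial>lborel))"
      using plancherel_strip[OF G_hol b(2) G_int G_M] unfolding ft_G .
    also have "\<dots> \<le> ennreal (2 * pi) * (ennreal (2 * err n b + 2 * err m b) + ennreal (2 * err n (- b) + 2 * err m (- b)))"
      by (intro mult_left_mono add_mono G_sq b) auto
    also have "\<dots> = ennreal (2 * pi * (2 * E n + 2 * E m))"
    proof -
      have "0 \<le> err n' y" for n' y by (simp add: err_def)
      thus ?thesis
        by (simp add: ennreal_plus[symmetric] ennreal_mult'[symmetric] E_def algebra_simps del: ennreal_plus)
    qed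
    finally show ?thesis .
  qed
  have step: "(\<integral>\<^sup>+ v. ennreal (cmod (\<psi>n (r (Suc k)) v - \<psi>n (r k) v)) \<partial>lborel) \<le>
      ennreal ((4 * pi + 1 / (2 * b)) * (1 / 2) ^ k)" for k
  proof -
    have "E (r (Suc k)) \<le> (1 / 4) ^ k"
      using r(2)[of "Suc k"] by (rule order_trans) simp
    hence "2 * pi * (2 * E (r (Suc k)) + 2 * E (r k)) \<le> 2 * pi * (2 * (1 / 4) ^ k + 2 * (1 / 4) ^ k)"
      using r(2)[of k] by (intro mult_left_mono add_mono) auto
    also have "\<dots> = 8 * pi * (1 / 4) ^ k" by simp
    finally have "(\<integral>\<^sup>+ v. ennreal ((cmod (\<psi>n (r (Suc k)) v - \<psi>n (r k) v))\<^sup>2 * exp (2 * b * \<bar>v\<bar>)) \<partial>lborel) \<le>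
        ennreal (8 * pi * (1 / 4) ^ k)"
      by (intro order_trans[OF diff] ennreal_leI)
    \<comment> \<open>The linearisation parameter is \<open>l = 2 ^ k\<close>, which balances the
      two terms: \<open>2 ^ k * 4 ^ (- k)\<close> and \<open>1 / 2 ^ k\<close> have the same
      order.\<close>
    hence "(\<integral>\<^sup>+ v. ennreal (cmod (\<psi>n (r (Suc k)) v - \<psi>n (r k) v)) \<partial>lborel) \<le>
        ennreal (2 ^ k * (8 * pi * (1 / 4) ^ k) / 2 + 1 / (2 * b * 2 ^ k))"
      using \<psi>n_int b(1) by (intro nn_integral_weighted_le) (auto intro!: borel_measurable_diff)
    also have "2 ^ k * (8 * pi * (1 / 4) ^ k) / 2 + 1 / (2 * b * 2 ^ k) = (4 * pi + 1 / (2 * b)) * (1 / 2) ^ k"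
    proof -
      have "(4::real) ^ k = 2 ^ k * 2 ^ k" by (simp flip: power_mult_distrib)
      thus ?thesis using b(1) by (simp add: power_divide field_simps)
    qed
    finally show ?thesis .
  qed
  obtain \<psi> where \<psi>: "integrable lborel \<psi>" "AE v in lborel. (\<lambda>k. \<psi>n (r k) v) \<longlonglongrightarrow> \<psi> v"
    "(\<lambda>k. LINT v|lborel. cmod (\<psi>n (r k) v - \<psi> v)) \<longlonglongrightarrow> 0"
    using L1_fast_cauchy_converges[of lborel "\<lambda>k. \<psi>n (r k)", OF \<psi>n_int step] by blast
  have [measurable]: "\<psi> \<in> borel_measurable borel" "\<psi>n n \<in> borel_measurable borel" for n
    using \<psi>(1) \<psi>n_int[of n] by auto
  \<comment> \<open>Plancherel at height \<open>\<theta>\<close> costs a factor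
    \<open>exp ((\<theta> / (n + 1))\<^sup>2 / 2)\<close> for the damping. It tends to 1 along the
    subsequence, so Fatou gives the constant \<open>2 * pi * 2 * K\<close> without loss.\<close>
  have inside: "(\<integral>\<^sup>+ v. ennreal ((cmod (\<psi> v))\<^sup>2 * exp (2 * \<theta> * \<bar>v\<bar>)) \<partial>lborel) \<le> ennreal (4 * pi * K)"
    if \<theta>: "0 < \<theta>" "\<theta> < a" for \<theta>
  proof -
    have Fn_sq: "(\<integral>\<^sup>+ x. ennreal ((cmod (Fn n (Complex x y)))\<^sup>2) \<partial>lborel) \<le> ennreal (exp ((y / real (Suc n))\<^sup>2 / 2) * I y)"
      if "\<bar>y\<bar> < a" for n y
    proof -
      have "(cmod (Fn n (Complex x y)))\<^sup>2 \<le> exp ((y / real (Suc n))\<^sup>2 / 2) * (cmod (F (Complex x y)))\<^sup>2" for x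
      proof -
        have "(cmod (damp n (Complex x y)))\<^sup>2 \<le> (exp ((y / real (Suc n))\<^sup>2 / 4))\<^sup>2"
          by (intro power_mono norm_damp_le) simp
        also have "\<dots> = exp ((y / real (Suc n))\<^sup>2 / 2)"
          unfolding exp_double[symmetric] by simp
        finally show ?thesis
          unfolding Fn_def norm_mult power_mult_distrib
          by (subst mult.commute) (intro mult_right_mono, auto)
      qed
      hence "(\<integral>\<^sup>+ x. ennreal ((cmod (Fn n (Complex x y)))\<^sup>2) \<partial>lborel) \<le>
          (\<integral>\<^sup>+ x. ennreal (exp ((y / real (Suc n))\<^sup>2 / 2) * (cmod (F (Complex x y)))\<^sup>2) \<partial>lborel)"
        by (intro nn_integral_mono ennreal_leI)
      also have "\<dots> = ennreal (LINT x|lborel. exp ((y / real (Suc n))\<^sup>2 / 2) * (cmod (F (Complex x y)))\<^sup>2)"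
        by (rule nn_integral_eq_integral) (auto intro!: int that)
      also have "\<dots> = ennreal (exp ((y / real (Suc n))\<^sup>2 / 2) * I y)"
        unfolding I_def by (simp only: integral_mult_right_zero)
      finally show ?thesis .
    qed
    have K0: "0 \<le> I y" for y by (simp add: I_def)
    have bound: "(\<integral>\<^sup>+ v. ennreal ((cmod (\<psi>n (r k) v))\<^sup>2 * exp (2 * \<theta> * \<bar>v\<bar>)) \<partial>lborel) \<le>
        ennreal (4 * pi * K * exp ((\<theta> / real (Suc k))\<^sup>2 / 2))" for k
    proof -
      let ?e = "exp ((\<theta> / real (Suc (r k)))\<^sup>2 / 2)"
      have "(\<integral>\<^sup>+ v. ennreal ((cmod (\<psi>n (r k) v))\<^sup>2 * exp (2 * \<theta> * \<bar>v\<bar>)) \<partial>lborel) \<le>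
          ennreal (2 * pi) * ((\<integral>\<^sup>+ x. ennreal ((cmod (Fn (r k) (Complex x \<theta>)))\<^sup>2) \<partial>lborel) +
            (\<integral>\<^sup>+ x. ennreal ((cmod (Fn (r k) (Complex x (- \<theta>))))\<^sup>2) \<partial>lborel))"
        unfolding \<psi>n_def by (rule plancherel_strip[OF Fn_hol _ Fn_int M]) (use \<theta> in auto)
      also have "\<dots> \<le> ennreal (2 * pi) * (ennreal (exp ((\<theta> / real (Suc (r k)))\<^sup>2 / 2) * I \<theta>) +
          ennreal (exp ((- \<theta> / real (Suc (r k)))\<^sup>2 / 2) * I (- \<theta>)))"
        by (intro mult_left_mono add_mono Fn_sq) (use \<theta> in auto)
      also have "\<dots> = ennreal (2 * pi * ?e * (I \<theta> + I (- \<theta>)))"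
        using K0 by (simp add: ennreal_plus[symmetric] ennreal_mult'[symmetric] algebra_simps del: ennreal_plus of_nat_Suc)
      also have "\<dots> \<le> ennreal (2 * pi * exp ((\<theta> / real (Suc k))\<^sup>2 / 2) * (2 * K))"
      proof (intro ennreal_leI mult_mono)
        have "\<bar>\<theta> / real (Suc (r k))\<bar> \<le> \<bar>\<theta> / real (Suc k)\<bar>"
          using \<theta> r(1)[of k] by (simp add: frac_le)
        hence "(\<theta> / real (Suc (r k)))\<^sup>2 \<le> (\<theta> / real (Suc k))\<^sup>2"
          by (simp only: abs_le_square_iff)
        thus "?e \<le> exp ((\<theta> / real (Suc k))\<^sup>2 / 2)" by simp
        show "I \<theta> + I (- \<theta>) \<le> 2 * K" using K[OF \<theta>] by (simp add: I_def)
      qed (use K0 in auto)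
      finally show ?thesis by (simp add: mult_ac)
    qed
    have "(\<integral>\<^sup>+ v. ennreal ((cmod (\<psi> v))\<^sup>2 * exp (2 * \<theta> * \<bar>v\<bar>)) \<partial>lborel) =
        (\<integral>\<^sup>+ v. liminf (\<lambda>k. ennreal ((cmod (\<psi>n (r k) v))\<^sup>2 * exp (2 * \<theta> * \<bar>v\<bar>))) \<partial>lborel)"
    proof (rule nn_integral_cong_AE)
      show "AE v in lborel. ennreal ((cmod (\<psi> v))\<^sup>2 * exp (2 * \<theta> * \<bar>v\<bar>)) =
          liminf (\<lambda>k. ennreal ((cmod (\<psi>n (r k) v))\<^sup>2 * exp (2 * \<theta> * \<bar>v\<bar>)))"
        using \<psi>(2)
      proof eventually_elim
        case (elim v)
        have "(\<lambda>k. ennreal ((cmod (\<psi>n (r k) v))\<^sup>2 * exp (2 * \<theta> * \<bar>v\<bar>))) \<longlonglongrightarrow>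
            ennreal ((cmod (\<psi> v))\<^sup>2 * exp (2 * \<theta> * \<bar>v\<bar>))"
          by (intro tendsto_ennrealI tendsto_intros elim)
        from lim_imp_Liminf[OF _ this] show ?case by simp
      qed
    qed
    also have "\<dots> \<le> liminf (\<lambda>k. \<integral>\<^sup>+ v. ennreal ((cmod (\<psi>n (r k) v))\<^sup>2 * exp (2 * \<theta> * \<bar>v\<bar>)) \<partial>lborel)"
      by (rule nn_integral_liminf) measurable
    also have "\<dots> \<le> liminf (\<lambda>k. ennreal (4 * pi * K * exp ((\<theta> / real (Suc k))\<^sup>2 / 2)))"
      by (intro Liminf_mono always_eventually allI bound)
    also have "\<dots> = ennreal (4 * pi * K)"
    proof -
      have "(\<lambda>k. 4 * pi * K * exp ((\<theta> / real (Suc k))\<^sup>2 / 2)) \<longlonglongrightarrow> 4 * pi * K * exp (0\<^sup>2 / 2)"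
        by (intro tendsto_intros LIMSEQ_Suc[OF lim_const_over_n]) simp
      hence "(\<lambda>k. ennreal (4 * pi * K * exp ((\<theta> / real (Suc k))\<^sup>2 / 2))) \<longlonglongrightarrow> ennreal (4 * pi * K)"
        by (intro tendsto_ennrealI) simp
      thus ?thesis by (intro lim_imp_Liminf) auto
    qed
    finally show ?thesis .
  qed
  \<comment> \<open>A second Fatou step lets the height increase to \<open>a\<close>. The double
    \<open>Suc\<close> matters: with a single one the first height would be 0, outside the range of
    \<open>inside\<close>.\<close>
  have "(\<integral>\<^sup>+ v. ennreal ((cmod (\<psi> v))\<^sup>2 * exp (2 * a * \<bar>v\<bar>)) \<partial>lborel) =
      (\<integral>\<^sup>+ v. liminf (\<lambda>j. ennreal ((cmod (\<psi> v))\<^sup>2 * exp (2 * (a - a / real (Suc (Suc j))) * \<bar>v\<bar>))) \<partial>lborel)"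
  proof (rule nn_integral_cong)
    fix v
    have "(\<lambda>j. (cmod (\<psi> v))\<^sup>2 * exp (2 * (a - a / real (Suc (Suc j))) * \<bar>v\<bar>)) \<longlonglongrightarrow>
        (cmod (\<psi> v))\<^sup>2 * exp (2 * (a - 0) * \<bar>v\<bar>)"
      by (intro tendsto_intros LIMSEQ_Suc[OF LIMSEQ_Suc[OF lim_const_over_n]])
    hence "(\<lambda>j. ennreal ((cmod (\<psi> v))\<^sup>2 * exp (2 * (a - a / real (Suc (Suc j))) * \<bar>v\<bar>))) \<longlonglongrightarrow>
        ennreal ((cmod (\<psi> v))\<^sup>2 * exp (2 * a * \<bar>v\<bar>))"
      by (intro tendsto_ennrealI) simp
    from lim_imp_Liminf[OF _ this]
    show "ennreal ((cmod (\<psi> v))\<^sup>2 * exp (2 * a * \<bar>v\<bar>)) =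
        liminf (\<lambda>j. ennreal ((cmod (\<psi> v))\<^sup>2 * exp (2 * (a - a / real (Suc (Suc j))) * \<bar>v\<bar>)))"
      by simp
  qed
  also have "\<dots> \<le> liminf (\<lambda>j. \<integral>\<^sup>+ v. ennreal ((cmod (\<psi> v))\<^sup>2 * exp (2 * (a - a / real (Suc (Suc j))) * \<bar>v\<bar>)) \<partial>lborel)"
    by (rule nn_integral_liminf) measurable
  also have "\<dots> \<le> ennreal (4 * pi * K)"
  proof (intro Liminf_le always_eventually allI inside)
    fix j
    show "0 < a - a / real (Suc (Suc j))" "a - a / real (Suc (Suc j)) < a"
      using \<open>0 < a\<close> by (auto simp: field_simps add_pos_nonneg)
  qed simp
  finally have "(\<integral>\<^sup>+ v. ennreal ((cmod (\<psi> v))\<^sup>2 * exp (2 * a * \<bar>v\<bar>)) \<partial>lborel) \<le> ennreal (4 * pi * K)" .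
  \<comment> \<open>L1 convergence of spectra implies pointwise convergence of their transforms, and
    \<open>damp n\<close> tends to 1 pointwise, so inversion for the regularised functions passes to
    the limit at every \<open>t\<close>.\<close>
  moreover have "F (Complex t 0) = ft \<psi> (- t) / (2 * pi)" for t
  proof -
    have r_lim: "filterlim r at_top sequentially"
      by (rule filterlim_at_top_mono[OF filterlim_ident]) (simp add: r(1))
    have "(\<lambda>k. ft (\<psi>n (r k)) (- t) - ft \<psi> (- t)) \<longlonglongrightarrow> 0"
    proof (rule Lim_null_comparison[OF _ \<psi>(3)])
      show "\<forall>\<^sub>F k in sequentially. cmod (ft (\<psi>n (r k)) (- t) - ft \<psi> (- t)) \<le> (LINT v|lborel. cmod (\<psi>n (r k) v - \<psi> v))"
      proof (intro always_eventually allI)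
        fix k
        show "cmod (ft (\<psi>n (r k)) (- t) - ft \<psi> (- t)) \<le> (LINT v|lborel. cmod (\<psi>n (r k) v - \<psi> v))"
          unfolding ft_diff[OF \<psi>n_int \<psi>(1), symmetric]
          by (rule ft_bound) (intro Bochner_Integration.integrable_diff \<psi>n_int \<psi>(1))
      qed
    qed
    from tendsto_divide[OF LIM_zero_cancel[OF this] tendsto_const, of "2 * complex_of_real pi"]
    have "(\<lambda>k. ft (\<psi>n (r k)) (- t) / (2 * pi)) \<longlonglongrightarrow> ft \<psi> (- t) / (2 * pi)"
      by simp
    moreover have "(\<lambda>k. Fn (r k) (Complex t 0)) \<longlonglongrightarrow> F (Complex t 0) * 1"
      unfolding Fn_def
      by (intro tendsto_mult tendsto_const filterlim_compose[OF damp_tendsto r_lim])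
    ultimately show ?thesis
      unfolding Fn_inv by (auto dest: LIMSEQ_unique)
  qed
  ultimately show ?thesis using that \<psi>(1) by blast
qed

subsection \<open>Logarithmic coordinates\<close>

lemma exp_difference_quotient_tendsto:
  fixes w0 :: complex
  shows "((\<lambda>w. (exp w - exp w0) / (w - w0)) \<longlongrightarrow> exp w0) (at w0)"
  using DERIV_exp[of w0] by (simp add: has_field_derivative_iff)

lemma rcis_eq_exp: "0 < r \<Longrightarrow> rcis r \<theta> = exp (Complex (ln r) \<theta>)"
  by (simp add: rcis_def Complex_eq exp_add cis_conv_exp exp_of_real mult.commute)

text \<open>With \<open>w = ln r + \<i> \<theta>\<close> the denominator of the polar quotient is a
  difference of values of \<open>exp\<close>. The polar quotient is thus the ordinary quotient of
  \<open>\<Phi>\<close> divided by that of \<open>exp\<close>, whose limit is never 0.\<close>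

lemma polar_analytic_on_entire:
  assumes "\<Phi> holomorphic_on UNIV"
  shows "polar_analytic_on (\<lambda>(r, \<theta>). \<Phi> (Complex (ln r) \<theta>)) polar_halfplane"
  unfolding polar_analytic_on_def
proof (intro ballI, clarsimp)
  fix r0 \<theta>0 assume "(r0, \<theta>0) \<in> polar_halfplane"
  hence r0: "0 < r0" by (simp add: polar_halfplane_def)
  define w0 where "w0 = Complex (ln r0) \<theta>0"
  define w where "w p = Complex (ln (fst p)) (snd p)" for p :: "real \<times> real"
  have "(\<Phi> has_field_derivative deriv \<Phi> w0) (at w0)"
    using holomorphic_derivI[OF assms open_UNIV] by simp
  hence quot: "((\<lambda>w. ((\<Phi> w - \<Phi> w0) / (w - w0)) / ((exp w - exp w0) / (w - w0))) \<longlongrightarrow> deriv \<Phi> w0 / exp w0) (at w0)"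
    by (intro tendsto_divide exp_difference_quotient_tendsto) (auto simp: has_field_derivative_iff)
  have "\<forall>\<^sub>F w in at w0. ((\<Phi> w - \<Phi> w0) / (w - w0)) / ((exp w - exp w0) / (w - w0)) =
      (\<Phi> w - \<Phi> w0) / (exp w - exp w0)"
  proof -
    \<comment> \<open>The difference \<open>B\<close> of exponentials also vanishes at translates of
      \<open>w0\<close> by multiples of \<open>2 * pi * \<i>\<close>. There both sides are 0, since
      division by zero yields zero.\<close>
    have cancel: "A / d / (B / d) = A / B" if "d \<noteq> 0" for A B d :: complex
      using that by simp
    show ?thesis
      unfolding eventually_at_filter by (intro always_eventually) (auto intro!: cancel)
  qed
  from tendsto_cong[OF this, THEN iffD1, OF quot]
  have "((\<lambda>w. (\<Phi> w - \<Phi> w0) / (exp w - exp w0)) \<longlongrightarrow> deriv \<Phi> w0 / exp w0) (at w0)" .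
  moreover have "filterlim w (at w0) (at (r0, \<theta>0) within polar_halfplane)"
    unfolding filterlim_at
  proof
    show "\<forall>\<^sub>F p in at (r0, \<theta>0) within polar_halfplane. w p \<in> UNIV \<and> w p \<noteq> w0"
      unfolding eventually_at_filter using r0
      by (intro always_eventually) (auto simp: w_def w0_def polar_halfplane_def)
    have "isCont w (r0, \<theta>0)"
      unfolding w_def[abs_def] Complex_eq using r0 by (intro continuous_intros) auto
    hence "(w \<longlongrightarrow> w0) (at (r0, \<theta>0))"
      by (simp add: isCont_def w_def w0_def)
    thus "(w \<longlongrightarrow> w0) (at (r0, \<theta>0) within polar_halfplane)"
      by (rule tendsto_within_subset) simp
  qed
  ultimately have lim: "((\<lambda>p. (\<Phi> (w p) - \<Phi> w0) / (exp (w p) - exp w0)) \<longlongrightarrow> deriv \<Phi> w0 / exp w0)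
      (at (r0, \<theta>0) within polar_halfplane)"
    by (rule filterlim_compose)
  have "\<forall>\<^sub>F p in at (r0, \<theta>0) within polar_halfplane.
      (\<Phi> (w p) - \<Phi> w0) / (exp (w p) - exp w0) =
      (case p of (r, \<theta>) \<Rightarrow> (\<Phi> (Complex (ln r) \<theta>) - \<Phi> (Complex (ln r0) \<theta>0)) / (rcis r \<theta> - rcis r0 \<theta>0))"
    unfolding eventually_at_filter using r0
    by (intro always_eventually) (auto simp: w_def w0_def polar_halfplane_def rcis_eq_exp)
  from tendsto_cong[OF this, THEN iffD1, OF lim]
  show "\<exists>L. ((\<lambda>(r, \<theta>). (\<Phi> (Complex (ln r) \<theta>) - \<Phi> (Complex (ln r0) \<theta>0)) / (rcis r \<theta> - rcis r0 \<theta>0)) \<longlongrightarrow> L)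
      (at (r0, \<theta>0) within polar_halfplane)"
    by blast
qed

text \<open>The chain rule by hand: the polar quotient, pulled back along
  \<open>z = ln r + \<i> \<theta>\<close>, times the difference quotient of \<open>exp\<close> is
  the quotient in \<open>z\<close>.\<close>

lemma holomorphic_on_strip_of_polar_analytic:
  assumes "polar_analytic_on f (polar_strip a)"
  shows "(\<lambda>z. f (exp (Re z), Im z)) holomorphic_on strip a"
  unfolding holomorphic_on_open[OF open_strip]
proof
  fix z0 assume z0: "z0 \<in> strip a"
  define p where "p z = (exp (Re z), Im z)" for z
  have p_in: "p z \<in> polar_strip a" if "z \<in> strip a" for z
    using that by (auto simp: p_def polar_strip_def strip_def)
  have p_rcis: "rcis (fst (p z)) (snd (p z)) = exp z" for z
    by (simp add: p_def rcis_eq_exp complex_surj)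
  from assms p_in[OF z0] obtain L where
    "((\<lambda>(r, \<theta>). (f (r, \<theta>) - f (p z0)) / (rcis r \<theta> - exp z0)) \<longlongrightarrow> L) (at (p z0) within polar_strip a)"
    unfolding polar_analytic_on_def using p_rcis[of z0] by (force simp: p_def)
  moreover have "filterlim p (at (p z0) within polar_strip a) (at z0)"
    unfolding filterlim_at
  proof
    have "\<forall>\<^sub>F z in at z0. z \<in> strip a"
      using open_strip z0 eventually_at_in_open' by blast
    moreover have "\<forall>\<^sub>F z in at z0. z \<noteq> z0"
      by (simp add: eventually_at_filter)
    ultimately show "\<forall>\<^sub>F z in at z0. p z \<in> polar_strip a \<and> p z \<noteq> p z0"
      by eventually_elim (use p_in in \<open>auto simp: p_def complex_eq_iff\<close>)
    show "(p \<longlongrightarrow> p z0) (at z0)"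
      unfolding p_def by (intro tendsto_intros)
  qed
  ultimately have "((\<lambda>z. (\<lambda>(r, \<theta>). (f (r, \<theta>) - f (p z0)) / (rcis r \<theta> - exp z0)) (p z)) \<longlongrightarrow> L) (at z0)"
    by (rule filterlim_compose)
  hence "((\<lambda>z. (f (p z) - f (p z0)) / (exp z - exp z0)) \<longlongrightarrow> L) (at z0)"
    by (simp add: case_prod_unfold p_rcis)
  hence quot: "((\<lambda>z. (f (p z) - f (p z0)) / (exp z - exp z0) * ((exp z - exp z0) / (z - z0))) \<longlongrightarrow> L * exp z0) (at z0)"
    by (intro tendsto_mult exp_difference_quotient_tendsto)
  have "\<forall>\<^sub>F z in at z0. (f (p z) - f (p z0)) / (exp z - exp z0) * ((exp z - exp z0) / (z - z0)) =
      (f (p z) - f (p z0)) / (z - z0)"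
  proof -
    \<comment> \<open>Here \<open>B = 0\<close> would break the identity. It is excluded near
      \<open>z0\<close> because the difference quotient of \<open>exp\<close> tends to a nonzero
      value.\<close>
    have cancel: "A / B * (B / d) = A / d" if "B / d \<noteq> 0" for A B d :: complex
      using that by auto
    show ?thesis
      using tendsto_imp_eventually_ne[OF exp_difference_quotient_tendsto[of z0] exp_not_eq_zero]
      by eventually_elim (rule cancel)
  qed
  from tendsto_cong[OF this, THEN iffD1, OF quot]
  have "((\<lambda>z. (f (p z) - f (p z0)) / (z - z0)) \<longlongrightarrow> L * exp z0) (at z0)" .
  thus "\<exists>f'. ((\<lambda>z. f (exp (Re z), Im z)) has_field_derivative f') (at z0)"
    unfolding has_field_derivative_iff p_def by blast
qed

text \<open>Under \<open>r = exp x\<close> the measure \<open>dr / r\<close> becomes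
  \<open>dx\<close>, so the X norm of \<open>\<phi>\<close> is the L^p norm of
  \<open>exp (c * x) * \<phi> (exp x)\<close>.\<close>

lemma exp_substitution:
  fixes \<phi> :: "real \<Rightarrow> complex"
  shows "set_integrable lebesgue {0<..} (\<lambda>r. cmod (\<phi> r) powr p * r powr (c * p - 1)) \<longleftrightarrow>
      integrable lebesgue (\<lambda>x. (exp (c * x) * cmod (\<phi> (exp x))) powr p)" (is ?int)
    and "set_integrable lebesgue {0<..} (\<lambda>r. cmod (\<phi> r) powr p * r powr (c * p - 1)) \<Longrightarrow>
      (LINT r:{0<..}|lebesgue. cmod (\<phi> r) powr p * r powr (c * p - 1)) =
      (LINT x|lebesgue. (exp (c * x) * cmod (\<phi> (exp x))) powr p)" (is "_ \<Longrightarrow> ?eq")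
proof -
  let ?f = "\<lambda>r. cmod (\<phi> r) powr p * r powr (c * p - 1)"
  have eq: "\<bar>exp x\<bar> * ?f (exp x) = (exp (c * x) * cmod (\<phi> (exp x))) powr p" for x
  proof -
    have "exp x * exp x powr (c * p - 1) = exp (c * x) powr p"
      by (simp add: powr_def algebra_simps flip: exp_add)
    thus ?thesis by (simp add: powr_mult mult_ac)
  qed
  have range: "exp ` UNIV = {0::real<..}"
    by (auto simp: image_iff) (metis exp_ln)
  \<comment> \<open>The equivalence is available for every value \<open>b\<close>; inserting the
    actual integral of one side yields both the transfer of integrability and the equality of the
    integrals.\<close>
  have cov: "(\<lambda>x. (exp (c * x) * cmod (\<phi> (exp x))) powr p) absolutely_integrable_on UNIV \<and>
      integral UNIV (\<lambda>x. (exp (c * x) * cmod (\<phi> (exp x))) powr p) = b \<longleftrightarrow>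
      ?f absolutely_integrable_on {0<..} \<and> integral {0<..} ?f = b" for b
    using has_absolute_integral_change_of_variables_1'[of UNIV "exp :: real \<Rightarrow> real" exp ?f b]
    unfolding eq range by (auto intro!: derivative_eq_intros injI)
  show ?int
    using cov[of "integral {0<..} ?f"] cov[of "integral UNIV (\<lambda>x. (exp (c * x) * cmod (\<phi> (exp x))) powr p)"]
    by (auto simp: set_integrable_def)
  show ?eq if "set_integrable lebesgue {0<..} ?f"
    using cov[of "integral {0<..} ?f"] that
    by (auto simp: set_lebesgue_integral_eq_integral(2)[symmetric] set_lebesgue_integral_def)
qed

subsection \<open>The competitor and the spectral norm\<close>

lemma norm_exp_ivz: "cmod (exp (- (\<i> * complex_of_real v * z))) = exp (v * Im z)"
  by (simp add: norm_exp_eq_Re)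

text \<open>The elementary half of Paley-Wiener: on the support, the modulus
  \<open>exp (v * Im z)\<close> of the kernel is at most \<open>exp (\<sigma> * |Im z|)\<close>, the
  growth allowed in the Bernstein space.\<close>

lemma compact_transform_integrable:
  fixes k :: "real \<Rightarrow> complex"
  assumes k: "integrable lborel k" and supp: "\<And>v. \<sigma> < \<bar>v\<bar> \<Longrightarrow> k v = 0"
  shows "integrable lborel (\<lambda>v. k v * exp (- (\<i> * complex_of_real v * z)))"
    and "cmod (LINT v|lborel. k v * exp (- (\<i> * complex_of_real v * z))) \<le>
      (LINT v|lborel. cmod (k v)) * exp (\<sigma> * \<bar>Im z\<bar>)"
proof -
  have [measurable]: "k \<in> borel_measurable borel" using k by auto
  have le: "cmod (k v * exp (- (\<i> * complex_of_real v * z))) \<le> cmod (k v) * exp (\<sigma> * \<bar>Im z\<bar>)" for v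
  proof (cases "\<sigma> < \<bar>v\<bar>")
    case False
    have "v * Im z \<le> \<bar>v\<bar> * \<bar>Im z\<bar>" by (metis abs_ge_self abs_mult)
    also have "\<dots> \<le> \<sigma> * \<bar>Im z\<bar>" using False by (intro mult_right_mono) auto
    finally show ?thesis unfolding norm_mult norm_exp_ivz by (intro mult_left_mono) auto
  qed (simp add: supp)
  show int: "integrable lborel (\<lambda>v. k v * exp (- (\<i> * complex_of_real v * z)))"
  proof (rule Bochner_Integration.integrable_bound)
    show "integrable lborel (\<lambda>v. cmod (k v) * exp (\<sigma> * \<bar>Im z\<bar>))" using k by simp
    show "AE v in lborel. cmod (k v * exp (- (\<i> * complex_of_real v * z))) \<le> norm (cmod (k v) * exp (\<sigma> * \<bar>Im z\<bar>))"
      using order_trans[OF le abs_ge_self] by simp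
  qed measurable
  have "cmod (LINT v|lborel. k v * exp (- (\<i> * complex_of_real v * z))) \<le>
      (LINT v|lborel. cmod (k v * exp (- (\<i> * complex_of_real v * z))))"
    by (rule integral_norm_bound)
  also have "\<dots> \<le> (LINT v|lborel. cmod (k v) * exp (\<sigma> * \<bar>Im z\<bar>))"
    using k int by (intro integral_mono le) auto
  finally show "cmod (LINT v|lborel. k v * exp (- (\<i> * complex_of_real v * z))) \<le>
      (LINT v|lborel. cmod (k v)) * exp (\<sigma> * \<bar>Im z\<bar>)" by simp
qed

text \<open>Differentiation under the integral sign. The limit is taken along sequences to fit
  dominated convergence, and the compact support makes the Lipschitz constants of the exponentials
  uniform in \<open>v\<close>.\<close>

lemma compact_transform_holomorphic:
  fixes k :: "real \<Rightarrow> complex"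
  assumes k: "integrable lborel k" and supp: "\<And>v. \<sigma> < \<bar>v\<bar> \<Longrightarrow> k v = 0" and "0 \<le> \<sigma>"
  shows "(\<lambda>z. LINT v|lborel. k v * exp (- (\<i> * complex_of_real v * z))) holomorphic_on UNIV"
  unfolding holomorphic_on_open[OF open_UNIV]
proof
  fix z :: complex
  have [measurable]: "k \<in> borel_measurable borel" using k by auto
  let ?e = "\<lambda>v z. exp (- (\<i> * complex_of_real v * z))"
  let ?D = "\<lambda>v z. ?e v z * (- (\<i> * complex_of_real v))"
  have deriv: "(?e v has_field_derivative ?D v w) (at w within S)" for v w S
    by (auto intro!: derivative_eq_intros)
  have "((\<lambda>y. ((LINT v|lborel. k v * ?e v y) - (LINT v|lborel. k v * ?e v z)) / (y - z)) \<longlongrightarrow>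
      (LINT v|lborel. k v * ?D v z)) (at z)"
    unfolding tendsto_at_iff_sequentially
  proof (intro allI impI)
    fix X :: "nat \<Rightarrow> complex"
    assume X: "\<forall>i. X i \<in> UNIV - {z}" "X \<longlonglongrightarrow> z"
    obtain R where R: "\<And>i. cmod (X i) \<le> R"
      using convergent_imp_Bseq[OF convergentI[OF X(2)]] by (auto simp: Bseq_def)
    \<comment> \<open>The convex ball of radius \<open>R'\<close> contains \<open>z\<close> and the
      whole sequence. On it, for \<open>|v| \<le> \<sigma>\<close>, the derivative has modulus at
      most \<open>B\<close>, and so have the difference quotients.\<close>
    define R' where "R' = max R (cmod z)"
    define B where "B = exp (\<sigma> * R') * \<sigma>"
    have quot_le: "cmod (k v * ((?e v (X i) - ?e v z) / (X i - z))) \<le> B * cmod (k v)" for i v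
    proof (cases "\<sigma> < \<bar>v\<bar>")
      case False
      have "cmod (?e v (X i) - ?e v z) \<le> B * cmod (X i - z)"
      proof (rule field_differentiable_bound[of "cball 0 R'"])
        show "(?e v has_field_derivative ?D v w) (at w within cball 0 R')" for w
          by (rule deriv)
        show "cmod (?D v w) \<le> B" if "w \<in> cball 0 R'" for w
        proof -
          have "v * Im w \<le> \<bar>v\<bar> * \<bar>Im w\<bar>" by (metis abs_ge_self abs_mult)
          also have "\<dots> \<le> \<sigma> * R'"
            using False that abs_Im_le_cmod[of w] \<open>0 \<le> \<sigma>\<close> by (intro mult_mono) auto
          finally have "exp (v * Im w) * \<bar>v\<bar> \<le> exp (\<sigma> * R') * \<sigma>"
            using False by (intro mult_mono) auto
          thus ?thesis unfolding norm_mult norm_exp_ivz B_def by (simp add: norm_mult)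
        qed
        show "X i \<in> cball 0 R'" "z \<in> cball 0 R'"
          using R[of i] by (auto simp: R'_def)
      qed simp
      moreover have "cmod (X i - z) > 0" using X(1) by auto
      ultimately have "cmod ((?e v (X i) - ?e v z) / (X i - z)) \<le> B"
        by (simp add: norm_divide field_simps)
      thus ?thesis unfolding norm_mult by (subst mult.commute) (rule mult_right_mono, auto)
    qed (simp add: supp)
    have "(\<lambda>i. LINT v|lborel. k v * ((?e v (X i) - ?e v z) / (X i - z))) \<longlonglongrightarrow> (LINT v|lborel. k v * ?D v z)"
    proof (rule integral_dominated_convergence)
      show "integrable lborel (\<lambda>v. B * cmod (k v))" using k by simp
      show "AE v in lborel. (\<lambda>i. k v * ((?e v (X i) - ?e v z) / (X i - z))) \<longlonglongrightarrow> k v * ?D v z"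
      proof (intro AE_I2 tendsto_mult tendsto_const)
        fix v
        have "((\<lambda>y. (?e v y - ?e v z) / (y - z)) \<longlongrightarrow> ?D v z) (at z)"
          using deriv[of v z UNIV] by (simp only: has_field_derivative_iff)
        thus "(\<lambda>i. (?e v (X i) - ?e v z) / (X i - z)) \<longlonglongrightarrow> ?D v z"
          using X unfolding tendsto_at_iff_sequentially by (auto simp: o_def)
      qed
      show "AE v in lborel. cmod (k v * ((?e v (X i) - ?e v z) / (X i - z))) \<le> B * cmod (k v)" for i
        using quot_le by simp
    qed measurable
    moreover have "(LINT v|lborel. k v * ((?e v (X i) - ?e v z) / (X i - z))) =
        ((LINT v|lborel. k v * ?e v (X i)) - (LINT v|lborel. k v * ?e v z)) / (X i - z)" for i
    proof -
      have "k v * ((?e v (X i) - ?e v z) / (X i - z)) = (k v * ?e v (X i) - k v * ?e v z) / (X i - z)" for v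
        by (simp add: right_diff_distrib)
      thus ?thesis
        by (simp only: integral_divide_zero Bochner_Integration.integral_diff[OF
          compact_transform_integrable(1)[OF k supp] compact_transform_integrable(1)[OF k supp]])
    qed
    ultimately show "((\<lambda>y. ((LINT v|lborel. k v * ?e v y) - (LINT v|lborel. k v * ?e v z)) / (y - z)) \<circ> X) \<longlonglongrightarrow>
        (LINT v|lborel. k v * ?D v z)"
      by (simp only: o_def)
  qed
  thus "\<exists>f'. ((\<lambda>z. LINT v|lborel. k v * exp (- (\<i> * complex_of_real v * z))) has_field_derivative f') (at z)"
    unfolding has_field_derivative_iff by blast
qed

text \<open>With \<open>w = ln r + \<i> \<theta>\<close> this is the integral of
  \<open>k v * exp (- (c + \<i> * v) * w) / (2 * pi)\<close> over \<open>v\<close>: the inverse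
  Mellin transform of \<open>k\<close>, continued from the half-line to the Riemann surface of the
  logarithm.\<close>

definition competitor :: "real \<Rightarrow> (real \<Rightarrow> complex) \<Rightarrow> real \<times> real \<Rightarrow> complex"
  where "competitor c k = (\<lambda>(r, \<theta>). exp (- (complex_of_real c * Complex (ln r) \<theta>)) *
    (LINT v|lborel. k v * exp (- (\<i> * complex_of_real v * Complex (ln r) \<theta>))) / (2 * pi))"

lemma competitor_real_line: "competitor c k (r, 0) = complex_of_real (exp (- c * ln r)) * (ft k (- ln r) / (2 * pi))"
proof -
  have "Complex (ln r) 0 = complex_of_real (ln r)" by (simp add: complex_eq_iff)
  thus ?thesis unfolding competitor_def ft_def by (simp add: exp_of_real mult_ac)
      (simp add: mult_ac flip: exp_of_real)
qed

text \<open>Compact support of \<open>k\<close> already yields polar analyticity and the growth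
  bound. The X space condition is the demanding one; by the substitution \<open>r = exp x\<close> it
  becomes p-integrability of \<open>ft k\<close>.\<close>

lemma competitor_in_mellin_bernstein:
  fixes k :: "real \<Rightarrow> complex"
  assumes k: "integrable lborel k" and supp: "\<And>v. \<sigma> < \<bar>v\<bar> \<Longrightarrow> k v = 0" and "0 \<le> \<sigma>"
    and int: "integrable lborel (\<lambda>x. cmod (ft k x) powr p)"
  shows "competitor c k \<in> mellin_bernstein p c \<sigma>"
  unfolding mellin_bernstein_def
proof (intro CollectI conjI)
  let ?G = "\<lambda>z. LINT v|lborel. k v * exp (- (\<i> * complex_of_real v * z))"
  have "(\<lambda>z. exp (- (complex_of_real c * z)) * ?G z / (2 * pi)) holomorphic_on UNIV"
    by (intro holomorphic_intros compact_transform_holomorphic[OF assms(1-3)]) auto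
  from polar_analytic_on_entire[OF this] show pa: "polar_analytic_on (competitor c k) polar_halfplane"
    by (simp only: competitor_def)
  have [measurable]: "k \<in> borel_measurable borel" using k by auto
  have norm_line: "exp (c * x) * cmod (competitor c k (exp x, 0)) = cmod (ft k (- x)) / (2 * pi)" for x
    unfolding competitor_real_line norm_mult norm_of_real
    by (simp add: norm_divide mult.assoc[symmetric] flip: exp_add)
  have "integrable lborel (\<lambda>x. (1 / (2 * pi)) powr p * cmod (ft k (0 + (-1) * x)) powr p)"
    by (intro integrable_mult_right lborel_integrable_real_affine[where f = "\<lambda>x. cmod (ft k x) powr p"] int) auto
  also have "(\<lambda>x. (1 / (2 * pi)) powr p * cmod (ft k (0 + (-1) * x)) powr p) =
      (\<lambda>x. (exp (c * x) * cmod (competitor c k (exp x, 0))) powr p)"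
    unfolding norm_line by (simp add: powr_mult[symmetric])
  finally have "integrable lebesgue (\<lambda>x. (exp (c * x) * cmod (competitor c k (exp x, 0))) powr p)"
    by (subst integrable_completion) auto
  hence "set_integrable lebesgue {0<..} (\<lambda>r. cmod (competitor c k (r, 0)) powr p * r powr (c * p - 1))"
    by (subst exp_substitution(1))
  moreover have "set_borel_measurable lebesgue {0<..} (\<lambda>r. competitor c k (r, 0))"
  proof -
    have "(\<lambda>r. indicator {0<..} r *\<^sub>R competitor c k (r, 0)) \<in> borel_measurable borel"
      unfolding competitor_real_line by measurable
    thus ?thesis unfolding set_borel_measurable_def by (intro measurable_completion) simp
  qed
  ultimately show "(\<lambda>r. competitor c k (r, 0)) \<in> X_space p c"
    by (simp add: X_space_def)
  \<comment> \<open>The summand 1 keeps the constant strictly positive when \<open>k\<close>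
    vanishes almost everywhere.\<close>
  define C where "C = (LINT v|lborel. cmod (k v)) / (2 * pi) + 1"
  have "cmod (competitor c k (r, \<theta>)) \<le> C * r powr (- c) * exp (\<sigma> * \<bar>\<theta>\<bar>)" if "0 < r" for r \<theta>
  proof -
    have "cmod (competitor c k (r, \<theta>)) = r powr (- c) * (cmod (?G (Complex (ln r) \<theta>)) / (2 * pi))"
      using that by (simp add: competitor_def norm_mult norm_divide powr_def)
    also have "\<dots> \<le> r powr (- c) * ((LINT v|lborel. cmod (k v)) * exp (\<sigma> * \<bar>\<theta>\<bar>) / (2 * pi))"
      using compact_transform_integrable(2)[OF k supp, where z = "Complex (ln r) \<theta>"]
      by (intro mult_left_mono divide_right_mono) auto
    also have "\<dots> \<le> C * r powr (- c) * exp (\<sigma> * \<bar>\<theta>\<bar>)"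
      by (simp add: C_def algebra_simps)
    finally show ?thesis .
  qed
  moreover have "0 < C" by (auto simp: C_def intro!: add_nonneg_pos divide_nonneg_pos)
  ultimately show "\<exists>C>0. \<forall>(r, \<theta>)\<in>polar_halfplane. cmod (competitor c k (r, \<theta>)) \<le> C * r powr - c * exp (\<sigma> * \<bar>\<theta>\<bar>)"
    by (intro exI[of _ C]) (auto simp: polar_halfplane_def)
qed

section \<open>Uniqueness of the representing function and the spectral norm\<close>

lemma ex_borel_AE_eq:
  fixes h :: "real \<Rightarrow> complex"
  assumes "h \<in> borel_measurable lebesgue"
  obtains h' where "h' \<in> borel_measurable borel" "AE v in lborel. h v = h' v"
proof -
  have "(\<lambda>v. Re (h v)) \<in> borel_measurable lebesgue" "(\<lambda>v. Im (h v)) \<in> borel_measurable lebesgue"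
    using assms by auto
  then obtain u w where uw: "u \<in> borel_measurable lborel" "AE v in lborel. Re (h v) = u v"
      "w \<in> borel_measurable lborel" "AE v in lborel. Im (h v) = w v"
    by (blast dest: completion_ex_borel_measurable_real)
  show ?thesis
  proof (rule that)
    show "(\<lambda>v. complex_of_real (u v) + \<i> * complex_of_real (w v)) \<in> borel_measurable borel"
      using uw(1,3) by simp
    show "AE v in lborel. h v = complex_of_real (u v) + \<i> * complex_of_real (w v)"
      using uw(2,4) by eventually_elim (simp add: complex_eq_iff)
  qed
qed

lemma mellin_kernel_exp: "complex_of_real (exp s) powr (- complex_of_real c - \<i> * complex_of_real v) =
    complex_of_real (exp (- c * s)) * iexp (- s * v)"
proof -
  have "complex_of_real (exp s) powr (- complex_of_real c - \<i> * complex_of_real v) =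
      exp ((- complex_of_real c - \<i> * complex_of_real v) * complex_of_real s)"
    by (simp add: powr_def Ln_of_real)
  also have "(- complex_of_real c - \<i> * complex_of_real v) * complex_of_real s =
      complex_of_real (- c * s) + \<i> * complex_of_real (- s * v)"
    by (simp add: algebra_simps)
  finally show ?thesis by (simp only: exp_add exp_of_real)
qed

lemma L_space_integrable:
  assumes "\<psi> \<in> L_space 1"
  shows "integrable lebesgue \<psi>"
  using assms by (auto simp: L_space_def integrable_norm_iff)

text \<open>At \<open>x = exp (- y)\<close> the Mellin kernel is a nonzero constant times the
  character of frequency \<open>y\<close>. Hence the difference of two representing functions has
  zero transform. This makes \<open>G_norm\<close> independent of the choice made inside it.\<close>

lemma G_representation_unique:
  fixes \<phi> \<psi>1 \<psi>2 :: "real \<Rightarrow> complex"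
  assumes "G_representation q c \<phi> \<psi>1" "G_representation q c \<phi> \<psi>2"
  shows "AE v in lebesgue. \<psi>1 v = \<psi>2 v"
proof -
  have int: "integrable lebesgue \<psi>1" "integrable lebesgue \<psi>2"
    using assms by (auto simp: G_representation_def intro: L_space_integrable)
  let ?h = "\<lambda>v. \<psi>1 v - \<psi>2 v"
  have h: "integrable lebesgue ?h" using int by auto
  \<comment> \<open>Representing functions are Lebesgue measurable, whereas the transform is treated
    over \<open>lborel\<close>; a Borel modification bridges the two settings.\<close>
  obtain h' where h': "h' \<in> borel_measurable borel" "AE v in lborel. ?h v = h' v"
    using ex_borel_AE_eq[of ?h] h by auto
  have h'_AE: "AE v in lebesgue. ?h v = h' v" by (rule AE_completion[OF h'(2)])
  have h'_meas: "h' \<in> borel_measurable lebesgue" using h'(1) by (intro measurable_completion) simp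
  have "integrable lebesgue h'"
    using integrable_cong_AE[THEN iffD1, OF _ h'_meas h'_AE h] h by auto
  hence h'_int: "integrable lborel h'"
    using integrable_completion[of h' lborel] h'(1) by simp
  have "ft h' y = 0" for y
  proof -
    let ?K = "\<lambda>v. complex_of_real (exp (- y)) powr (- complex_of_real c - \<i> * complex_of_real v)"
    have K: "?K v = complex_of_real (exp (c * y)) * iexp (y * v)" for v
      unfolding mellin_kernel_exp by simp
    have e_meas: "(\<lambda>v. complex_of_real (exp (c * y)) * iexp (y * v)) \<in> borel_measurable lebesgue"
      by (intro measurable_completion) simp
    have K_int: "integrable lebesgue (\<lambda>v. \<psi> v * ?K v)" if "integrable lebesgue \<psi>" for \<psi>
    proof (rule Bochner_Integration.integrable_bound)
      show "integrable lebesgue (\<lambda>v. exp (c * y) * cmod (\<psi> v))" using that by simp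
      show "(\<lambda>v. \<psi> v * ?K v) \<in> borel_measurable lebesgue"
        unfolding K by (intro borel_measurable_times borel_measurable_integrable[OF that] e_meas)
      show "AE v in lebesgue. cmod (\<psi> v * ?K v) \<le> norm (exp (c * y) * cmod (\<psi> v))"
        unfolding K by (simp add: norm_mult)
    qed
    have at: "\<phi> (exp (- y)) = 1 / (2 * complex_of_real pi) * (LINT v|lebesgue. \<psi> v * ?K v)"
      if "G_representation q c \<phi> \<psi>" for \<psi>
      using that[unfolded G_representation_def, THEN conjunct2, rule_format, OF exp_gt_zero, of "- y"] .
    have "1 / (2 * complex_of_real pi) * (LINT v|lebesgue. \<psi>1 v * ?K v) =
        1 / (2 * complex_of_real pi) * (LINT v|lebesgue. \<psi>2 v * ?K v)"
      unfolding at[OF assms(1), symmetric] at[OF assms(2), symmetric] ..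
    hence "(LINT v|lebesgue. \<psi>1 v * ?K v - \<psi>2 v * ?K v) = 0"
      using K_int int by simp
    also have "(LINT v|lebesgue. \<psi>1 v * ?K v - \<psi>2 v * ?K v) = (LINT v|lebesgue. h' v * ?K v)"
    proof (rule integral_cong_AE)
      show "(\<lambda>v. \<psi>1 v * ?K v - \<psi>2 v * ?K v) \<in> borel_measurable lebesgue"
        using K_int int by (intro borel_measurable_diff) auto
      show "(\<lambda>v. h' v * ?K v) \<in> borel_measurable lebesgue"
        unfolding K by (intro borel_measurable_times h'_meas e_meas)
      show "AE v in lebesgue. \<psi>1 v * ?K v - \<psi>2 v * ?K v = h' v * ?K v"
        using h'_AE by eventually_elim (simp flip: left_diff_distrib)
    qed
    also have "\<dots> = (LINT v|lborel. h' v * ?K v)"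
      unfolding K by (rule integral_completion) (use h'(1) in simp)
    also have "\<dots> = complex_of_real (exp (c * y)) * ft h' y"
      unfolding K ft_def by (simp only: integral_mult_right_zero[symmetric] mult_ac)
    finally show ?thesis by simp
  qed
  hence "AE v in lborel. h' v = 0" by (rule ft_eq_zero_imp_AE[OF h'_int])
  hence "AE v in lebesgue. h' v = 0" by (rule AE_completion)
  with h'_AE show ?thesis by eventually_elim simp
qed

lemma L_norm_cong_AE:
  fixes \<psi>1 \<psi>2 :: "real \<Rightarrow> complex"
  assumes "AE v in lebesgue. \<psi>1 v = \<psi>2 v" "\<psi>1 \<in> borel_measurable lebesgue" "\<psi>2 \<in> borel_measurable lebesgue"
  shows "L_norm q \<psi>1 = L_norm q \<psi>2"
proof -
  have "esssup lebesgue (\<lambda>v. ennreal (cmod (\<psi>1 v))) = esssup lebesgue (\<lambda>v. ennreal (cmod (\<psi>2 v)))"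
    using assms by (intro esssup_AE_cong) auto
  moreover have "(LINT v|lebesgue. cmod (\<psi>1 v) powr enn2real q) = (LINT v|lebesgue. cmod (\<psi>2 v) powr enn2real q)"
    using assms by (intro integral_cong_AE) auto
  ultimately show ?thesis by (simp add: L_norm_def)
qed

lemma G_norm_eq:
  fixes \<phi> \<psi> :: "real \<Rightarrow> complex"
  assumes "G_representation q c \<phi> \<psi>"
  shows "G_norm q c \<phi> = L_norm q \<psi>"
proof -
  define \<eta> where "\<eta> = (SOME \<psi>. G_representation q c \<phi> \<psi>)"
  have "\<exists>\<psi>. G_representation q c \<phi> \<psi>" using assms by blast
  hence \<eta>: "G_representation q c \<phi> \<eta>"
    unfolding \<eta>_def by (rule someI_ex)
  have "L_norm q \<eta> = L_norm q \<psi>"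
    by (rule L_norm_cong_AE[OF G_representation_unique[OF \<eta> assms]])
       (use \<eta> assms in \<open>auto simp: G_representation_def L_space_def\<close>)
  thus ?thesis unfolding G_norm_def \<eta>_def .
qed

lemma mellin_bernstein_dist_le:
  fixes f g :: "real \<times> real \<Rightarrow> complex" and \<psi> :: "real \<Rightarrow> complex"
  assumes "g \<in> mellin_bernstein p c \<sigma>" and "G_representation q c (\<lambda>x. f (x, 0) - g (x, 0)) \<psi>"
  shows "mellin_bernstein_dist q p c \<sigma> f \<le> ennreal (L_norm q \<psi>)"
proof -
  have "(\<lambda>x. f (x, 0) - g (x, 0)) \<in> G_space q c"
    using assms(2) by (auto simp: G_space_def)
  thus ?thesis unfolding mellin_bernstein_dist_def
    by (intro INF_lower2[OF assms(1)]) (simp add: Let_def G_norm_eq[OF assms(2)])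
qed

subsection \<open>Cutting off the spectrum\<close>

lemma box_autoconvolution:
  fixes s v :: real
  assumes "0 < s"
  shows "(LINT u|lborel. complex_of_real (indicator {- s / 2..s / 2} u) * complex_of_real (indicator {- s / 2..s / 2} (v - u))) =
    complex_of_real (max 0 (s - \<bar>v\<bar>))"
proof -
  let ?I = "{max (- s / 2) (v - s / 2)..min (s / 2) (v + s / 2)}"
  have "indicator {- s / 2..s / 2} u * indicator {- s / 2..s / 2} (v - u) = (indicator ?I u :: real)" for u
    by (auto simp: indicator_def)
  hence "(LINT u|lborel. complex_of_real (indicator {- s / 2..s / 2} u) * complex_of_real (indicator {- s / 2..s / 2} (v - u))) =
      (LINT u|lborel. complex_of_real (indicator ?I u))"
    by (simp only: of_real_mult[symmetric])
  also have "\<dots> = complex_of_real (LINT u|lborel. indicator ?I u)"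
    by (rule integral_complex_of_real)
  also have "(LINT u|lborel. indicator ?I u) = measure lborel ?I" by simp
  also have "\<dots> = max 0 (s - \<bar>v\<bar>)"
    using assms by (cases "\<bar>v\<bar> \<le> s") (auto simp: max_def min_def)
  finally show ?thesis .
qed

text \<open>The triangle is the convolution square of a box, so its transform is the square of an \<open>L\<^sup>2\<close> function.\<close>

lemma triangle_transform_integrable:
  fixes s :: real
  assumes "0 < s"
  shows "integrable lborel (ft (\<lambda>v. complex_of_real (max 0 (s - \<bar>v\<bar>))))"
proof -
  define B where "B u = complex_of_real (indicator {- s / 2..s / 2} u)" for u
  have [measurable]: "B \<in> borel_measurable borel" unfolding B_def[abs_def] by measurable
  have B: "integrable lborel B"
    unfolding B_def[abs_def] complex_of_real_integrable_eq using assms by simp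
  have square: "ft (\<lambda>v. complex_of_real (max 0 (s - \<bar>v\<bar>))) x = (ft B x)\<^sup>2" for x
  proof -
    have inner: "ft B x * iexp (x * u) = (LINT v|lborel. B (v - u) * iexp (x * v))" for u
    proof -
      have "(LINT v|lborel. B (v - u) * iexp (x * v)) = (LINT w|lborel. B w * iexp (x * (u + w)))"
        by (subst lborel_integral_real_affine[where c = 1 and t = u]) simp_all
      also have "\<dots> = (LINT w|lborel. B w * iexp (x * w) * iexp (x * u))"
      proof -
        have "iexp (x * (u + w)) = iexp (x * w) * iexp (x * u)" for w
          by (simp add: exp_add[symmetric] algebra_simps)
        thus ?thesis by (simp only: mult.assoc)
      qed
      finally show ?thesis unfolding ft_def by (simp only: integral_mult_left_zero)
    qed
    have "(ft B x)\<^sup>2 = (LINT u|lborel. B u * (LINT v|lborel. B (v - u) * iexp (x * v)))"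
    proof -
      have "(ft B x)\<^sup>2 = (LINT u|lborel. B u * iexp (x * u) * ft B x)"
        unfolding power2_eq_square by (subst (1) ft_def) (simp only: integral_mult_left_zero)
      moreover have "B u * iexp (x * u) * ft B x = B u * (LINT v|lborel. B (v - u) * iexp (x * v))" for u
        unfolding inner[symmetric] by simp
      ultimately show ?thesis by (simp only:)
    qed
    \<comment> \<open>For \<open>u\<close> in the box, \<open>B (v - u)\<close> vanishes unless
      \<open>v\<close> lies in \<open>{- s..s}\<close>. The inserted indicator is integrable in
      \<open>v\<close>, so the rest counts as a bounded kernel and the integrals can be
      exchanged.\<close>
    also have "\<dots> = (LINT u|lborel. B u * (LINT v|lborel. complex_of_real (indicator {- s..s} v) * (B (v - u) * iexp (x * v))))"
    proof (intro Bochner_Integration.integral_cong refl)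
      fix u
      show "B u * (LINT v|lborel. B (v - u) * iexp (x * v)) =
          B u * (LINT v|lborel. complex_of_real (indicator {- s..s} v) * (B (v - u) * iexp (x * v)))"
      proof (cases "u \<in> {- s / 2..s / 2}")
        case True
        hence "B (v - u) = complex_of_real (indicator {- s..s} v) * B (v - u)" for v
          by (auto simp: B_def indicator_def)
        thus ?thesis by (metis (no_types, lifting) mult.assoc)
      qed (simp add: B_def)
    qed
    also have "\<dots> = (LINT v|lborel. complex_of_real (indicator {- s..s} v) * (LINT u|lborel. B u * (B (v - u) * iexp (x * v))))"
    proof (rule integral_swap_bounded_kernel[where C = 1, OF B])
      show "integrable lborel (\<lambda>v. complex_of_real (indicator {- s..s} v))"
        unfolding complex_of_real_integrable_eq using assms by simp
      show "cmod (B (v - u) * iexp (x * v)) \<le> 1" for u v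
        by (simp add: norm_mult B_def indicator_def)
    qed (simp add: split_beta)
    also have "\<dots> = (LINT v|lborel. complex_of_real (max 0 (s - \<bar>v\<bar>)) * iexp (x * v))"
    proof (intro Bochner_Integration.integral_cong refl)
      fix v
      have "(LINT u|lborel. B u * (B (v - u) * iexp (x * v))) = complex_of_real (max 0 (s - \<bar>v\<bar>)) * iexp (x * v)"
        unfolding mult.assoc[symmetric] integral_mult_left_zero B_def box_autoconvolution[OF assms] ..
      thus "complex_of_real (indicator {- s..s} v) * (LINT u|lborel. B u * (B (v - u) * iexp (x * v))) =
          complex_of_real (max 0 (s - \<bar>v\<bar>)) * iexp (x * v)"
        by (auto simp: indicator_def)
    qed
    finally show ?thesis by (simp add: ft_def)
  qed
  have "(\<integral>\<^sup>+ v. ennreal ((cmod (B v))\<^sup>2) \<partial>lborel) = (\<integral>\<^sup>+ v. indicator {- s / 2..s / 2} v \<partial>lborel)"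
    by (intro nn_integral_cong) (auto simp: B_def indicator_def)
  hence "ennreal (2 * pi) * (\<integral>\<^sup>+ v. ennreal ((cmod (B v))\<^sup>2) \<partial>lborel) < \<infinity>"
    using assms by (simp add: ennreal_mult_less_top)
  hence "(\<integral>\<^sup>+ x. ennreal (cmod ((ft B x)\<^sup>2)) \<partial>lborel) < \<infinity>"
    using plancherel_le[OF B] by (auto simp: norm_power intro: order_le_less_trans)
  hence "integrable lborel (\<lambda>x. (ft B x)\<^sup>2)"
    by (intro integrableI_bounded) measurable
  thus ?thesis unfolding square[abs_def, symmetric] by (simp add: square)
qed

text \<open>Written as a difference of two triangles, so that its transform is integrable by
  \<open>triangle_transform_integrable\<close>; the subtraction produces the plateau of height 1
  that a single triangle lacks.\<close>

definition trapezoid :: "real \<Rightarrow> real \<Rightarrow> real \<Rightarrow> real"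
  where "trapezoid s \<sigma> v = (max 0 (\<sigma> - \<bar>v\<bar>) - max 0 (s - \<bar>v\<bar>)) / (\<sigma> - s)"

lemma trapezoid_props:
  assumes "0 < s" "s < \<sigma>"
  shows "0 \<le> trapezoid s \<sigma> v" "trapezoid s \<sigma> v \<le> 1"
    and "\<bar>v\<bar> \<le> s \<Longrightarrow> trapezoid s \<sigma> v = 1" and "\<sigma> < \<bar>v\<bar> \<Longrightarrow> trapezoid s \<sigma> v = 0"
  using assms by (auto simp: trapezoid_def field_simps max_def)

lemma trapezoid_integrable:
  assumes "0 < s" "s < \<sigma>"
  shows "integrable lborel (\<lambda>v. complex_of_real (trapezoid s \<sigma> v))"
proof (rule Bochner_Integration.integrable_bound)
  show "integrable lborel (indicator {- \<sigma>..\<sigma>} :: real \<Rightarrow> real)" using assms by simp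
  show "(\<lambda>v. complex_of_real (trapezoid s \<sigma> v)) \<in> borel_measurable lborel"
    unfolding trapezoid_def by measurable
  show "AE v in lborel. cmod (complex_of_real (trapezoid s \<sigma> v)) \<le> norm (indicator {- \<sigma>..\<sigma>} v :: real)"
    using trapezoid_props[OF assms] by (intro AE_I2) (auto simp: indicator_def abs_le_iff)
qed

lemma trapezoid_transform_integrable:
  assumes "0 < s" "s < \<sigma>"
  shows "integrable lborel (ft (\<lambda>v. complex_of_real (trapezoid s \<sigma> v)))"
proof -
  let ?T = "\<lambda>s v. complex_of_real (max 0 (s - \<bar>v\<bar>))"
  have T: "integrable lborel (?T s)" if "0 < s" for s :: real
  proof (rule Bochner_Integration.integrable_bound)
    show "integrable lborel (\<lambda>v. s * indicator {- s..s} v)" using that by simp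
  qed (auto simp: indicator_def max_def)
  have "ft (\<lambda>v. complex_of_real (trapezoid s \<sigma> v)) x = (ft (?T \<sigma>) x - ft (?T s) x) / (\<sigma> - s)" for x
  proof -
    have "ft (\<lambda>v. complex_of_real (trapezoid s \<sigma> v)) x = (LINT v|lborel. (?T \<sigma> v - ?T s v) * iexp (x * v) / (\<sigma> - s))"
      unfolding ft_def trapezoid_def by simp
    also have "\<dots> = ft (\<lambda>v. ?T \<sigma> v - ?T s v) x / (\<sigma> - s)"
      unfolding ft_def by (rule integral_divide_zero)
    finally show ?thesis using T assms by (simp add: ft_diff)
  qed
  hence eq: "ft (\<lambda>v. complex_of_real (trapezoid s \<sigma> v)) = (\<lambda>x. (ft (?T \<sigma>) x - ft (?T s) x) / (\<sigma> - s))"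
    by (rule ext)
  show ?thesis
    unfolding eq using assms
    by (intro integrable_divide_zero Bochner_Integration.integrable_diff triangle_transform_integrable) auto
qed

text \<open>Multiplying the spectrum by \<open>\<kappa>\<close> amounts to convolving
  \<open>h\<close> with \<open>ft \<kappa>\<close>, up to a reflection, and an L1 function convolved
  with an L1 function is L1. This keeps the competitor for \<open>p = 1\<close> in its X
  space.\<close>

lemma ft_multiplier_integrable:
  fixes h \<kappa> :: "real \<Rightarrow> complex"
  assumes h: "integrable lborel h" and \<kappa>: "integrable lborel \<kappa>" and K: "integrable lborel (ft \<kappa>)"
  shows "integrable lborel (ft (\<lambda>v. \<kappa> v * ft h v))"
proof -
  have [measurable]: "h \<in> borel_measurable borel" "\<kappa> \<in> borel_measurable borel" using h \<kappa> by auto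
  have conv: "ft (\<lambda>v. \<kappa> v * ft h v) x = (LINT t|lborel. h t * ft \<kappa> (t + x))" for x
  proof -
    have "ft h v * iexp (x * v) = (LINT t|lborel. h t * iexp (v * (t + x)))" for v
    proof -
      have "iexp (v * (t + x)) = iexp (v * t) * iexp (x * v)" for t
        by (simp add: exp_add[symmetric] algebra_simps)
      hence "(LINT t|lborel. h t * iexp (v * (t + x))) = (LINT t|lborel. h t * iexp (v * t) * iexp (x * v))"
        by (simp only: mult.assoc)
      thus ?thesis unfolding ft_def by (simp only: integral_mult_left_zero)
    qed
    hence "ft (\<lambda>v. \<kappa> v * ft h v) x = (LINT v|lborel. \<kappa> v * (LINT t|lborel. h t * iexp (v * (t + x))))"
      unfolding ft_def[of "\<lambda>v. \<kappa> v * ft h v"] by (simp only: mult.assoc)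
    also have "\<dots> = (LINT t|lborel. h t * (LINT v|lborel. \<kappa> v * iexp (v * (t + x))))"
      by (rule integral_swap_bounded_kernel[where C = 1, OF \<kappa> h]) (simp_all add: split_beta)
    also have "\<dots> = (LINT t|lborel. h t * ft \<kappa> (t + x))"
      unfolding ft_def by (simp add: mult_ac)
    finally show ?thesis .
  qed
  have shift: "(\<integral>\<^sup>+ x. ennreal (cmod (ft \<kappa> (t + x))) \<partial>lborel) = (\<integral>\<^sup>+ x. ennreal (cmod (ft \<kappa> x)) \<partial>lborel)" for t
    using nn_integral_real_affine[of "\<lambda>x. ennreal (cmod (ft \<kappa> x))" 1 t] by simp
  show ?thesis
  proof (rule integrableI_bounded)
    have "(\<integral>\<^sup>+ x. ennreal (cmod (ft (\<lambda>v. \<kappa> v * ft h v) x)) \<partial>lborel) \<le>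
        (\<integral>\<^sup>+ x. (\<integral>\<^sup>+ t. ennreal (cmod (h t * ft \<kappa> (t + x))) \<partial>lborel) \<partial>lborel)"
      unfolding conv by (intro nn_integral_mono ennreal_norm_integral_le)
    also have "\<dots> = (\<integral>\<^sup>+ t. (\<integral>\<^sup>+ x. ennreal (cmod (h t * ft \<kappa> (t + x))) \<partial>lborel) \<partial>lborel)"
      by (rule lborel_pair.Fubini') (simp add: split_beta)
    also have "\<dots> = (\<integral>\<^sup>+ t. ennreal (cmod (h t)) \<partial>lborel) * (\<integral>\<^sup>+ x. ennreal (cmod (ft \<kappa> x)) \<partial>lborel)"
      by (simp add: norm_mult ennreal_mult' nn_integral_cmult nn_integral_multc shift)
    also have "\<dots> < \<infinity>"
      using h K by (auto simp: integrable_iff_bounded ennreal_mult_less_top)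
    finally show "(\<integral>\<^sup>+ x. ennreal (cmod (ft (\<lambda>v. \<kappa> v * ft h v) x)) \<partial>lborel) < \<infinity>" .
  qed measurable
qed

section \<open>Translating the Hardy space to the strip\<close>

definition log_coords :: "real \<Rightarrow> (real \<times> real \<Rightarrow> complex) \<Rightarrow> complex \<Rightarrow> complex"
  where "log_coords c f z = exp (complex_of_real c * z) * f (exp (Re z), Im z)"

text \<open>\<open>exp (c * z)\<close> is the holomorphic counterpart of the weight
  \<open>r powr c\<close>. As \<open>c\<close> is real its modulus does not depend on
  \<open>\<theta>\<close>, so the L^p norms along horizontal lines are the X norms of
  \<open>f\<close> on the corresponding rays.\<close>

lemma norm_log_coords: "cmod (log_coords c f (Complex x \<theta>)) = exp (c * x) * cmod (f (exp x, \<theta>))"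
  by (simp add: log_coords_def norm_mult)

lemma log_coords_real_line:
  assumes "0 < x"
  shows "f (x, 0) = complex_of_real (exp (- c * ln x)) * log_coords c f (Complex (ln x) 0)"
proof -
  have "Complex (ln x) 0 = complex_of_real (ln x)"
    by (simp add: complex_eq_iff)
  hence "exp (complex_of_real c * Complex (ln x) 0) = complex_of_real (exp (c * ln x))"
    by (simp only: of_real_mult[symmetric] exp_of_real)
  moreover have "complex_of_real (exp (- c * ln x)) * complex_of_real (exp (c * ln x)) = 1"
    unfolding of_real_mult[symmetric] exp_add[symmetric] by simp
  ultimately show ?thesis
    using assms unfolding log_coords_def
    by (simp only: mult.assoc[symmetric] complex.sel exp_ln mult_1)
qed

lemma X_norm_powr:
  assumes "0 < p"
  shows "X_norm p c \<phi> powr p = (LINT r:{0<..}|lebesgue. cmod (\<phi> r) powr p * r powr (c * p - 1))"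
proof -
  have "0 \<le> (LINT r:{0<..}|lebesgue. cmod (\<phi> r) powr p * r powr (c * p - 1))"
    unfolding set_lebesgue_integral_def by (intro Bochner_Integration.integral_nonneg) auto
  thus ?thesis using assms by (simp add: X_norm_def powr_powr)
qed

text \<open>The dictionary through which alone the Hardy space enters the estimates. The third fact
  is the bound on the Hardy mean with the p-th root and the division by 2 undone.\<close>

lemma mellin_hardy_log_coords:
  assumes f: "f \<in> mellin_hardy p c a" and "0 < p" "0 < a"
  defines "F \<equiv> log_coords c f"
  shows "F holomorphic_on strip a"
    and "\<And>\<theta>. \<bar>\<theta>\<bar> < a \<Longrightarrow> integrable lborel (\<lambda>x. cmod (F (Complex x \<theta>)) powr p)"
    and "\<And>\<theta>. 0 < \<theta> \<Longrightarrow> \<theta> < a \<Longrightarrow> (LINT x|lborel. cmod (F (Complex x \<theta>)) powr p) +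
      (LINT x|lborel. cmod (F (Complex x (- \<theta>))) powr p) \<le> 2 * mellin_hardy_norm p c a f powr p"
    and "0 \<le> mellin_hardy_norm p c a f"
proof -
  show hol: "F holomorphic_on strip a"
    unfolding F_def log_coords_def[abs_def]
    using f by (intro holomorphic_intros holomorphic_on_strip_of_polar_analytic) (simp add: mellin_hardy_def)
  have meas: "(\<lambda>x. cmod (F (Complex x \<theta>)) powr p) \<in> borel_measurable borel" if "\<bar>\<theta>\<bar> < a" for \<theta>
    using line_measurable[OF hol that] by measurable
  have set_int: "set_integrable lebesgue {0<..} (\<lambda>r. cmod (f (r, \<theta>)) powr p * r powr (c * p - 1))"
    if "\<bar>\<theta>\<bar> < a" for \<theta>
  proof -
    have "\<theta> \<in> {- a<..<a}" using that by auto
    thus ?thesis using f by (simp add: mellin_hardy_def X_space_def)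
  qed
  show int: "integrable lborel (\<lambda>x. cmod (F (Complex x \<theta>)) powr p)" if "\<bar>\<theta>\<bar> < a" for \<theta>
    using set_int[OF that] meas[OF that] unfolding exp_substitution(1) F_def norm_log_coords
    by (subst (asm) integrable_completion) auto
  have I: "X_norm p c (\<lambda>r. f (r, \<theta>)) powr p = (LINT x|lborel. cmod (F (Complex x \<theta>)) powr p)" if "\<bar>\<theta>\<bar> < a" for \<theta>
    unfolding X_norm_powr[OF \<open>0 < p\<close>] exp_substitution(2)[OF set_int[OF that]]
    using meas[OF that] unfolding F_def norm_log_coords
    by (subst integral_completion) auto
  have bdd: "bdd_above (hardy_mean p c f ` {0<..<a})"
    using f by (simp add: mellin_hardy_def)
  have mean_le: "hardy_mean p c f \<theta> \<le> mellin_hardy_norm p c a f" if "0 < \<theta>" "\<theta> < a" for \<theta>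
    unfolding mellin_hardy_norm_def using that by (intro cSUP_upper bdd) auto
  have mean_nonneg: "0 \<le> hardy_mean p c f \<theta>" for \<theta>
    by (simp add: hardy_mean_def)
  \<comment> \<open>The supremum runs over a nonempty family of nonnegative means;
    \<open>a / 2\<close> supplies a member.\<close>
  show "0 \<le> mellin_hardy_norm p c a f"
    using order_trans[OF mean_nonneg mean_le[of "a / 2"]] \<open>0 < a\<close> by simp
  show "(LINT x|lborel. cmod (F (Complex x \<theta>)) powr p) +
      (LINT x|lborel. cmod (F (Complex x (- \<theta>))) powr p) \<le> 2 * mellin_hardy_norm p c a f powr p"
    if \<theta>: "0 < \<theta>" "\<theta> < a" for \<theta>
  proof -
    have "((LINT x|lborel. cmod (F (Complex x \<theta>)) powr p) + (LINT x|lborel. cmod (F (Complex x (- \<theta>))) powr p)) / 2 =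
        hardy_mean p c f \<theta> powr p"
    proof -
      have "0 \<le> (LINT x|lborel. cmod (F (Complex x y)) powr p)" for y by simp
      hence "0 \<le> ((LINT x|lborel. cmod (F (Complex x \<theta>)) powr p) + (LINT x|lborel. cmod (F (Complex x (- \<theta>))) powr p)) / 2"
        by (intro divide_nonneg_pos add_nonneg_nonneg) auto
      thus ?thesis
        using \<theta> \<open>0 < p\<close> I[of \<theta>] I[of "- \<theta>"] by (simp add: hardy_mean_def powr_powr)
    qed
    also have "\<dots> \<le> mellin_hardy_norm p c a f powr p"
      using mean_le[OF \<theta>] mean_nonneg \<open>0 < p\<close> by (intro powr_mono2) auto
    finally show ?thesis by simp
  qed
qed

lemma G_representation_ft:
  fixes \<phi> \<eta> :: "real \<Rightarrow> complex"
  assumes \<eta>: "integrable lborel \<eta>" "\<eta> \<in> L_space q"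
    and \<phi>: "\<And>x. 0 < x \<Longrightarrow> \<phi> x = complex_of_real (exp (- c * ln x)) * (ft \<eta> (- ln x) / (2 * pi))"
  shows "G_representation q c \<phi> \<eta>"
  unfolding G_representation_def
proof (intro conjI allI impI IntI)
  have [measurable]: "\<eta> \<in> borel_measurable borel" using \<eta> by auto
  have "integrable lebesgue (\<lambda>v. cmod (\<eta> v))"
    using \<eta>(1) by (subst integrable_completion) auto
  moreover have "\<eta> \<in> borel_measurable lebesgue"
    by (intro measurable_completion) simp
  ultimately show "\<eta> \<in> L_space 1"
    by (simp add: L_space_def)
  show "\<eta> \<in> L_space q" by fact
  fix x :: real assume "0 < x"
  have "(LINT v|lebesgue. \<eta> v * complex_of_real x powr (- complex_of_real c - \<i> * complex_of_real v)) =
      (LINT v|lebesgue. \<eta> v * (complex_of_real (exp (- c * ln x)) * iexp (- ln x * v)))"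
    using mellin_kernel_exp[of "ln x" c] \<open>0 < x\<close> by (simp only: exp_ln)
  also have "\<dots> = (LINT v|lborel. \<eta> v * (complex_of_real (exp (- c * ln x)) * iexp (- ln x * v)))"
    by (rule integral_completion) simp
  also have "\<dots> = (LINT v|lborel. complex_of_real (exp (- c * ln x)) * (\<eta> v * iexp (- ln x * v)))"
    by (simp only: mult_ac)
  also have "\<dots> = complex_of_real (exp (- c * ln x)) * ft \<eta> (- ln x)"
    unfolding ft_def by (rule integral_mult_right_zero)
  finally show "\<phi> x = 1 / (2 * complex_of_real pi) *
      (LINT v|lebesgue. \<eta> v * complex_of_real x powr (- complex_of_real c - \<i> * complex_of_real v))"
    unfolding \<phi>[OF \<open>0 < x\<close>] by simp
qed

text \<open>The competitor has spectrum \<open>\<kappa> v * \<psi> v\<close>, so the error has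
  spectrum \<open>(1 - \<kappa> v) * \<psi> v\<close> and its spectral norm is an L^q norm. What
  distinguishes the values of \<open>p\<close> is which \<open>\<kappa>\<close> makes the transform
  of the truncated spectrum p-integrable.\<close>

lemma dist_le_cutoff:
  fixes \<psi> :: "real \<Rightarrow> complex" and \<kappa> :: "real \<Rightarrow> real"
  assumes \<psi>: "integrable lborel \<psi>" and inv: "\<And>t. log_coords c f (Complex t 0) = ft \<psi> (- t) / (2 * pi)"
    and [measurable]: "\<kappa> \<in> borel_measurable borel"
    and \<kappa>: "\<And>v. 0 \<le> \<kappa> v" "\<And>v. \<kappa> v \<le> 1" "\<And>v. \<sigma> < \<bar>v\<bar> \<Longrightarrow> \<kappa> v = 0" and "0 \<le> \<sigma>"
    and int: "integrable lborel (\<lambda>x. cmod (ft (\<lambda>v. \<kappa> v * \<psi> v) x) powr p)"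
    and L: "(\<lambda>v. \<psi> v - \<kappa> v * \<psi> v) \<in> L_space q"
  shows "mellin_bernstein_dist q p c \<sigma> f \<le> ennreal (L_norm q (\<lambda>v. \<psi> v - \<kappa> v * \<psi> v))"
proof (rule mellin_bernstein_dist_le)
  have k: "integrable lborel (\<lambda>v. \<kappa> v * \<psi> v)"
  proof (rule Bochner_Integration.integrable_bound[OF \<psi>])
    show "(\<lambda>v. complex_of_real (\<kappa> v) * \<psi> v) \<in> borel_measurable lborel"
      using \<psi> by measurable
    show "AE v in lborel. cmod (\<kappa> v * \<psi> v) \<le> cmod (\<psi> v)"
      using \<kappa>(1,2) by (intro AE_I2) (simp add: norm_mult mult_left_le_one_le)
  qed
  show "competitor c (\<lambda>v. \<kappa> v * \<psi> v) \<in> mellin_bernstein p c \<sigma>"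
    by (rule competitor_in_mellin_bernstein[OF k _ \<open>0 \<le> \<sigma>\<close> int]) (simp add: \<kappa>(3))
  show "G_representation q c (\<lambda>x. f (x, 0) - competitor c (\<lambda>v. \<kappa> v * \<psi> v) (x, 0)) (\<lambda>v. \<psi> v - \<kappa> v * \<psi> v)"
  proof (rule G_representation_ft[OF Bochner_Integration.integrable_diff[OF \<psi> k] L])
    fix x :: real assume "0 < x"
    show "f (x, 0) - competitor c (\<lambda>v. \<kappa> v * \<psi> v) (x, 0) =
        complex_of_real (exp (- c * ln x)) * (ft (\<lambda>v. \<psi> v - \<kappa> v * \<psi> v) (- ln x) / (2 * pi))"
      unfolding competitor_real_line log_coords_real_line[OF \<open>0 < x\<close>, of f c] inv ft_diff[OF \<psi> k]
      by (simp add: diff_divide_distrib right_diff_distrib)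
  qed
qed

section \<open>Norms of the spectral tail\<close>

lemma L_space_norm_finite_bound:
  fixes \<eta> :: "real \<Rightarrow> complex"
  assumes [measurable]: "\<eta> \<in> borel_measurable borel" and q: "1 \<le> q" "q \<noteq> \<infinity>" and "0 \<le> B"
    and B: "(\<integral>\<^sup>+ v. ennreal (cmod (\<eta> v) powr enn2real q) \<partial>lborel) \<le> ennreal (B powr enn2real q)"
  shows "\<eta> \<in> L_space q" and "L_norm q \<eta> \<le> B"
proof -
  let ?r = "enn2real q"
  have r: "0 < ?r" using q by (cases q) auto
  have int: "integrable lborel (\<lambda>v. cmod (\<eta> v) powr ?r)"
    by (intro integrableI_bounded) (use B in \<open>auto intro: order_le_less_trans\<close>)
  hence int': "integrable lebesgue (\<lambda>v. cmod (\<eta> v) powr ?r)"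
    by (subst integrable_completion) auto
  moreover have "\<eta> \<in> borel_measurable lebesgue" by (intro measurable_completion) simp
  ultimately show "\<eta> \<in> L_space q" using q by (simp add: L_space_def)
  have "ennreal (LINT v|lborel. cmod (\<eta> v) powr ?r) \<le> ennreal (B powr ?r)"
    using B nn_integral_eq_integral[OF int] by simp
  hence "(LINT v|lborel. cmod (\<eta> v) powr ?r) \<le> B powr ?r"
    by simp
  hence "(LINT v|lborel. cmod (\<eta> v) powr ?r) powr (1 / ?r) \<le> (B powr ?r) powr (1 / ?r)"
    using r by (intro powr_mono2) auto
  also have "\<dots> = B" using r \<open>0 \<le> B\<close> by (simp add: powr_powr)
  finally show "L_norm q \<eta> \<le> B"
    using q by (simp add: L_norm_def integral_completion)
qed

text \<open>Origin of the constant: with \<open>r = enn2real q\<close>, the power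
  \<open>(A * exp (- a * |v|)) powr r\<close> integrates over \<open>|v| \<ge> s\<close> to at most
  \<open>A powr r * 2 / (a * r) * exp (- a * r * s)\<close>, and the root of order \<open>r\<close>
  is taken. For infinite \<open>q\<close> the exponential is simply largest at
  \<open>|v| = s\<close>.\<close>

lemma L_space_norm_exp_bound:
  fixes \<eta> :: "real \<Rightarrow> complex"
  assumes [measurable]: "\<eta> \<in> borel_measurable borel" and q: "1 \<le> q" and "0 < a" "0 \<le> s" "0 \<le> A"
    and le: "\<And>v. cmod (\<eta> v) \<le> A * exp (- a * \<bar>v\<bar>)" and zero: "\<And>v. \<bar>v\<bar> < s \<Longrightarrow> \<eta> v = 0"
  shows "\<eta> \<in> L_space q"
    and "L_norm q \<eta> \<le> A * (if q = \<infinity> then 1 else (2 / (a * enn2real q)) powr (1 / enn2real q)) * exp (- a * s)"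
proof -
  have "\<eta> \<in> L_space q \<and> L_norm q \<eta> \<le>
    A * (if q = \<infinity> then 1 else (2 / (a * enn2real q)) powr (1 / enn2real q)) * exp (- a * s)"
  proof (cases "q = \<infinity>")
    case True
    have \<eta>: "\<eta> \<in> borel_measurable lebesgue" by (intro measurable_completion) simp
    have "cmod (\<eta> v) \<le> A * exp (- a * s)" for v
    proof (cases "\<bar>v\<bar> < s")
      case False
      hence "exp (- a * \<bar>v\<bar>) \<le> exp (- a * s)" using \<open>0 < a\<close> by simp
      from mult_left_mono[OF this \<open>0 \<le> A\<close>] le[of v] show ?thesis by linarith
    qed (use \<open>0 \<le> A\<close> zero in auto)
    hence *: "esssup lebesgue (\<lambda>v. ennreal (cmod (\<eta> v))) \<le> ennreal (A * exp (- a * s))"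
      using \<eta> by (intro esssup_I) (auto intro!: AE_I2 ennreal_leI)
    hence "enn2real (esssup lebesgue (\<lambda>v. ennreal (cmod (\<eta> v)))) \<le> A * exp (- a * s)"
      using \<open>0 \<le> A\<close> by (intro enn2real_leI) auto
    moreover have "esssup lebesgue (\<lambda>v. ennreal (cmod (\<eta> v))) < \<infinity>"
      using * by (rule order_le_less_trans) simp
    ultimately show ?thesis using True \<eta> by (simp add: L_space_def L_norm_def)
  next
    case False
    define r where "r = enn2real q"
    have r: "0 < r" using q False by (cases q) (auto simp: r_def)
    let ?B = "A * (2 / (a * r)) powr (1 / r) * exp (- a * s)"
    have "ennreal (cmod (\<eta> v) powr r) \<le>
        ennreal (A powr r) * (ennreal (exp (- (a * r) * \<bar>v\<bar>)) * indicator {v. s \<le> \<bar>v\<bar>} v)" for v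
    proof (cases "\<bar>v\<bar> < s")
      case False
      have "cmod (\<eta> v) powr r \<le> (A * exp (- a * \<bar>v\<bar>)) powr r"
        using le r by (intro powr_mono2) auto
      also have "\<dots> = A powr r * exp (- (a * r) * \<bar>v\<bar>)"
        by (simp add: powr_mult exp_powr_real mult_ac)
      finally show ?thesis using False by (simp add: ennreal_mult'[symmetric] ennreal_leI)
    qed (simp add: zero)
    hence "(\<integral>\<^sup>+ v. ennreal (cmod (\<eta> v) powr r) \<partial>lborel) \<le>
        (\<integral>\<^sup>+ v. ennreal (A powr r) * (ennreal (exp (- (a * r) * \<bar>v\<bar>)) * indicator {v. s \<le> \<bar>v\<bar>} v) \<partial>lborel)"
      by (intro nn_integral_mono)
    also have "\<dots> = ennreal (A powr r) * (\<integral>\<^sup>+ v. ennreal (exp (- (a * r) * \<bar>v\<bar>)) * indicator {v. s \<le> \<bar>v\<bar>} v \<partial>lborel)"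
      by (rule nn_integral_cmult) measurable
    also have "\<dots> \<le> ennreal (A powr r) * ennreal (2 / (a * r) * exp (- (a * r) * s))"
      using \<open>0 < a\<close> r \<open>0 \<le> s\<close> by (intro mult_left_mono nn_integral_exp_tail_le) auto
    also have "\<dots> = ennreal (?B powr r)"
    proof -
      have "?B powr r = A powr r * (2 / (a * r) * exp (- (a * r) * s))"
        using \<open>0 \<le> A\<close> \<open>0 < a\<close> r by (simp add: powr_mult powr_powr exp_powr_real mult_ac)
      thus ?thesis by (simp only: ennreal_mult'[symmetric] powr_ge_zero)
    qed
    finally have "(\<integral>\<^sup>+ v. ennreal (cmod (\<eta> v) powr enn2real q) \<partial>lborel) \<le> ennreal (?B powr enn2real q)"
      unfolding r_def .
    from L_space_norm_finite_bound[OF assms(1) q False _ this] show ?thesis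
      using False \<open>0 \<le> A\<close> by (simp add: r_def)
  qed
  thus "\<eta> \<in> L_space q"
    "L_norm q \<eta> \<le> A * (if q = \<infinity> then 1 else (2 / (a * enn2real q)) powr (1 / enn2real q)) * exp (- a * s)"
    by auto
qed

text \<open>Hoelder with exponents \<open>1 / t\<close> and \<open>1 / (1 - t)\<close>, obtained by
  integrating Young's inequality for \<open>X v / P\<close> and \<open>Y v / Q\<close>. Dividing by
  \<open>P\<close> forces the separate case \<open>P = 0\<close>, where \<open>X\<close> vanishes
  almost everywhere.\<close>

lemma nn_integral_holder_le:
  fixes X Y :: "real \<Rightarrow> real"
  assumes [measurable]: "X \<in> borel_measurable borel" "Y \<in> borel_measurable borel"
    and nonneg: "\<And>v. 0 \<le> X v" "\<And>v. 0 \<le> Y v" and t: "0 < t" "t < 1" and "0 \<le> P" "0 < Q"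
    and P: "(\<integral>\<^sup>+ v. ennreal (X v) \<partial>lborel) \<le> ennreal P" and Q: "(\<integral>\<^sup>+ v. ennreal (Y v) \<partial>lborel) \<le> ennreal Q"
  shows "(\<integral>\<^sup>+ v. ennreal (X v powr t * Y v powr (1 - t)) \<partial>lborel) \<le> ennreal (P powr t * Q powr (1 - t))"
proof (cases "P = 0")
  case True
  hence "AE v in lborel. ennreal (X v) = 0"
    using P nn_integral_0_iff_AE[of "\<lambda>v. ennreal (X v)" lborel] by simp
  hence "AE v in lborel. X v = 0"
    by eventually_elim (use nonneg(1) in \<open>auto simp: ennreal_eq_0_iff intro: antisym\<close>)
  hence "(\<integral>\<^sup>+ v. ennreal (X v powr t * Y v powr (1 - t)) \<partial>lborel) = nn_integral lborel (\<lambda>v::real. 0)"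
    by (intro nn_integral_cong_AE) (auto elim!: eventually_mono)
  thus ?thesis by simp
next
  case False
  hence "0 < P" using \<open>0 \<le> P\<close> by simp
  let ?C = "P powr t * Q powr (1 - t)"
  have "X v powr t * Y v powr (1 - t) \<le> ?C * t / P * X v + ?C * (1 - t) / Q * Y v" for v
  proof (cases "X v = 0 \<or> Y v = 0")
    case True
    moreover have "0 \<le> ?C * t / P * X v + ?C * (1 - t) / Q * Y v"
      using nonneg t \<open>0 < P\<close> \<open>0 < Q\<close> by (intro add_nonneg_nonneg mult_nonneg_nonneg divide_nonneg_pos) auto
    ultimately show ?thesis using t by auto
  next
    case False
    hence "0 < X v" "0 < Y v" using nonneg[of v] by auto
    hence "(X v / P) powr t * (Y v / Q) powr (1 - t) \<le> t * (X v / P) + (1 - t) * (Y v / Q)"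
      using t \<open>0 < P\<close> \<open>0 < Q\<close> by (intro Youngs_inequality_0) auto
    hence "?C * ((X v / P) powr t * (Y v / Q) powr (1 - t)) \<le> ?C * (t * (X v / P) + (1 - t) * (Y v / Q))"
      by (intro mult_left_mono) auto
    moreover have "?C * ((X v / P) powr t * (Y v / Q) powr (1 - t)) = X v powr t * Y v powr (1 - t)"
      using nonneg \<open>0 < P\<close> \<open>0 < Q\<close> by (simp add: powr_divide)
    ultimately show ?thesis by (simp add: distrib_left mult_ac)
  qed
  hence "(\<integral>\<^sup>+ v. ennreal (X v powr t * Y v powr (1 - t)) \<partial>lborel) \<le>
      (\<integral>\<^sup>+ v. ennreal (?C * t / P) * ennreal (X v) + ennreal (?C * (1 - t) / Q) * ennreal (Y v) \<partial>lborel)"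
    using nonneg t \<open>0 < P\<close> \<open>0 < Q\<close>
    by (intro nn_integral_mono) (simp add: ennreal_mult[symmetric] ennreal_plus[symmetric] ennreal_leI del: ennreal_plus)
  also have "\<dots> = ennreal (?C * t / P) * (\<integral>\<^sup>+ v. ennreal (X v) \<partial>lborel) +
      ennreal (?C * (1 - t) / Q) * (\<integral>\<^sup>+ v. ennreal (Y v) \<partial>lborel)"
    by (simp add: nn_integral_add nn_integral_cmult)
  also have "\<dots> \<le> ennreal (?C * t / P) * ennreal P + ennreal (?C * (1 - t) / Q) * ennreal Q"
    by (intro add_mono mult_left_mono P Q) auto
  also have "\<dots> = ennreal (?C * t + ?C * (1 - t))"
    using t \<open>0 < P\<close> \<open>0 < Q\<close> by (simp add: ennreal_mult[symmetric] ennreal_plus[symmetric] del: ennreal_plus)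
  also have "?C * t + ?C * (1 - t) = ?C"
    by (simp add: algebra_simps)
  finally show ?thesis .
qed

subsection \<open>The distance estimates\<close>

lemma dist_bound_hardy_1:
  assumes "0 < a" "0 < \<sigma>" and f: "f \<in> mellin_hardy 1 c a" and q: "1 \<le> q"
  shows "mellin_bernstein_dist q 1 c \<sigma> f \<le>
    ennreal (2 * mellin_hardy_norm 1 c a f *
      (if q = \<infinity> then 1 else (2 / (a * enn2real q)) powr (1 / enn2real q)) * exp (- a * \<sigma>))"
proof -
  define F where "F = log_coords c f"
  define N where "N = mellin_hardy_norm 1 c a f"
  note F = mellin_hardy_log_coords[OF f _ \<open>0 < a\<close>, folded F_def N_def, simplified]
  have int: "integrable lborel (\<lambda>x. F (Complex x \<theta>))" if "\<bar>\<theta>\<bar> < a" for \<theta>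
    using F(2)[OF that] line_measurable[OF F(1) that] integrable_norm_iff[of "\<lambda>x. F (Complex x \<theta>)" lborel] by simp
  have bound: "(LINT x|lborel. cmod (F (Complex x \<theta>))) + (LINT x|lborel. cmod (F (Complex x (- \<theta>)))) \<le> 2 * N"
    if "0 < \<theta>" "\<theta> < a" for \<theta>
    using F(3)[OF that] F(4) by simp
  define h where "h x = F (Complex x 0)" for x
  define \<psi> where "\<psi> = ft h"
  have h: "integrable lborel h" unfolding h_def[abs_def] using int[of 0] \<open>0 < a\<close> by simp
  have \<psi>_le: "cmod (\<psi> v) \<le> 2 * N * exp (- a * \<bar>v\<bar>)" for v
    unfolding \<psi>_def h_def[abs_def] by (rule strip_transform_L1_bound[OF \<open>0 < a\<close> F(1) int bound])
  have \<psi>: "integrable lborel \<psi>"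
    unfolding \<psi>_def h_def[abs_def] by (rule strip_transform_L1_integrable[OF \<open>0 < a\<close> F(1) int bound])
  have inv: "F (Complex t 0) = ft \<psi> (- t) / (2 * pi)" for t
    unfolding \<psi>_def h_def[abs_def] by (rule strip_transform_L1_inversion[OF \<open>0 < a\<close> F(1) int bound])
  have [measurable]: "\<psi> \<in> borel_measurable borel" using \<psi> by auto
  let ?k = "if q = \<infinity> then 1 else (2 / (a * enn2real q)) powr (1 / enn2real q)"
  \<comment> \<open>The flanks occupy \<open>s \<le> |v| \<le> \<sigma>\<close>, so the error
    spectrum starts at \<open>s\<close> and the estimate is weaker by the factor
    \<open>exp (a * (\<sigma> - s))\<close>.\<close>
  have cutoff: "mellin_bernstein_dist q 1 c \<sigma> f \<le> ennreal (2 * N * ?k * exp (- a * s))" if s: "0 < s" "s < \<sigma>" for s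
  proof -
    let ?\<kappa> = "trapezoid s \<sigma>"
    let ?\<eta> = "\<lambda>v. \<psi> v - ?\<kappa> v * \<psi> v"
    have [measurable]: "?\<kappa> \<in> borel_measurable borel"
      unfolding trapezoid_def[abs_def] by measurable
    have le: "cmod (?\<eta> v) \<le> 2 * N * exp (- a * \<bar>v\<bar>)" for v
    proof -
      have "?\<eta> v = complex_of_real (1 - ?\<kappa> v) * \<psi> v" by (simp add: algebra_simps)
      hence "cmod (?\<eta> v) = (1 - ?\<kappa> v) * cmod (\<psi> v)"
        using trapezoid_props(2)[OF s, of v] by (simp only: norm_mult norm_of_real)
      also have "\<dots> \<le> cmod (\<psi> v)"
        using trapezoid_props(1,2)[OF s, of v] by (intro mult_left_le_one_le) auto
      finally show ?thesis using \<psi>_le[of v] by linarith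
    qed
    have zero: "?\<eta> v = 0" if "\<bar>v\<bar> < s" for v
      using trapezoid_props(3)[OF s, of v] that by simp
    have \<eta>_meas: "?\<eta> \<in> borel_measurable borel" by measurable
    have "0 \<le> 2 * N" using F(4) by simp
    note L = L_space_norm_exp_bound[OF \<eta>_meas q \<open>0 < a\<close> less_imp_le[OF s(1)] this le zero]
    have "integrable lborel (ft (\<lambda>v. complex_of_real (?\<kappa> v) * \<psi> v))"
      unfolding \<psi>_def
      by (intro ft_multiplier_integrable h trapezoid_integrable trapezoid_transform_integrable s)
    hence "integrable lborel (\<lambda>x. cmod (ft (\<lambda>v. complex_of_real (?\<kappa> v) * \<psi> v) x) powr 1)"
      by simp
    hence "mellin_bernstein_dist q 1 c \<sigma> f \<le> ennreal (L_norm q ?\<eta>)"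
      using trapezoid_props[OF s] \<open>0 < \<sigma>\<close> L(1)
      by (intro dist_le_cutoff[OF \<psi> inv[unfolded F_def]]) auto
    also have "\<dots> \<le> ennreal (2 * N * ?k * exp (- a * s))"
      by (intro ennreal_leI L(2))
    finally show ?thesis .
  qed
  \<comment> \<open>The left side of \<open>cutoff\<close> does not depend on \<open>s\<close>, so
    only the bounds are sent to the limit; the competitors themselves need not converge.\<close>
  have "((\<lambda>s. ennreal (2 * N * ?k * exp (- a * s))) \<longlongrightarrow> ennreal (2 * N * ?k * exp (- a * \<sigma>))) (at_left \<sigma>)"
    by (intro tendsto_intros tendsto_ennrealI)
  moreover have "\<forall>\<^sub>F s in at_left \<sigma>. mellin_bernstein_dist q 1 c \<sigma> f \<le> ennreal (2 * N * ?k * exp (- a * s))"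
    using eventually_at_left_real[OF \<open>0 < \<sigma>\<close>] by eventually_elim (rule cutoff, auto)
  ultimately show ?thesis
    unfolding N_def by (rule tendsto_lowerbound) simp
qed

text \<open>A sharp cutoff is admissible because the truncated spectrum is integrable and square
  integrable, so Plancherel makes its transform square integrable. The conditional guards
  \<open>q = 2\<close>, where base and exponent are both 0 and \<open>0 powr 0 = 0\<close> would
  give the wrong constant.\<close>

lemma dist_bound_hardy_2:
  assumes "0 < a" "0 < \<sigma>" and f: "f \<in> mellin_hardy 2 c a" and q: "1 \<le> q" "q \<le> 2"
  shows "mellin_bernstein_dist (ennreal q) 2 c \<sigma> f \<le>
    ennreal (2 * sqrt pi * (if q = 2 then 1 else ((2 - q) / (q * a)) powr (1 / q - 1 / 2)) *
      mellin_hardy_norm 2 c a f * exp (- a * \<sigma>))"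
proof -
  define F where "F = log_coords c f"
  define N where "N = mellin_hardy_norm 2 c a f"
  note F = mellin_hardy_log_coords[OF f _ \<open>0 < a\<close>, folded F_def N_def, simplified]
  obtain \<psi> where \<psi>: "integrable lborel \<psi>"
    "(\<integral>\<^sup>+ v. ennreal ((cmod (\<psi> v))\<^sup>2 * exp (2 * a * \<bar>v\<bar>)) \<partial>lborel) \<le> ennreal (4 * pi * N\<^sup>2)"
    "\<And>t. F (Complex t 0) = ft \<psi> (- t) / (2 * pi)"
    using strip_transform_L2[OF \<open>0 < a\<close> F(1,2), of "N\<^sup>2"] F(3,4) by auto
  have [measurable]: "\<psi> \<in> borel_measurable borel" using \<psi>(1) by auto
  define \<kappa> where "\<kappa> = (indicator {v. \<bar>v\<bar> \<le> \<sigma>} :: real \<Rightarrow> real)"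
  have [measurable]: "\<kappa> \<in> borel_measurable borel" unfolding \<kappa>_def by measurable
  let ?\<eta> = "\<lambda>v. \<psi> v - \<kappa> v * \<psi> v"
  have k_int: "integrable lborel (\<lambda>v. complex_of_real (\<kappa> v) * \<psi> v)"
    by (rule Bochner_Integration.integrable_bound[OF \<psi>(1)]) (auto simp: \<kappa>_def indicator_def)
  have "(\<integral>\<^sup>+ v. ennreal ((cmod (complex_of_real (\<kappa> v) * \<psi> v))\<^sup>2) \<partial>lborel) \<le>
      (\<integral>\<^sup>+ v. ennreal ((cmod (\<psi> v))\<^sup>2 * exp (2 * a * \<bar>v\<bar>)) \<partial>lborel)"
  proof (intro nn_integral_mono ennreal_leI)
    fix v
    have "(cmod (complex_of_real (\<kappa> v) * \<psi> v))\<^sup>2 \<le> (cmod (\<psi> v))\<^sup>2 * 1"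
      by (simp add: \<kappa>_def indicator_def)
    also have "\<dots> \<le> (cmod (\<psi> v))\<^sup>2 * exp (2 * a * \<bar>v\<bar>)"
      using \<open>0 < a\<close> by (intro mult_left_mono) auto
    finally show "(cmod (complex_of_real (\<kappa> v) * \<psi> v))\<^sup>2 \<le> (cmod (\<psi> v))\<^sup>2 * exp (2 * a * \<bar>v\<bar>)" .
  qed
  also have "\<dots> < \<infinity>" using \<psi>(2) by (rule order_le_less_trans) simp
  finally have "(\<integral>\<^sup>+ x. ennreal ((cmod (ft (\<lambda>v. complex_of_real (\<kappa> v) * \<psi> v) x))\<^sup>2) \<partial>lborel) < \<infinity>"
    by (intro order_le_less_trans[OF plancherel_le[OF k_int]]) (simp add: ennreal_mult_less_top)
  hence ft_k: "integrable lborel (\<lambda>x. cmod (ft (\<lambda>v. complex_of_real (\<kappa> v) * \<psi> v) x) powr 2)"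
    by (intro integrableI_bounded) (auto simp del: norm_mult)
  let ?k = "if q = 2 then 1 else ((2 - q) / (q * a)) powr (1 / q - 1 / 2)"
  let ?B = "2 * sqrt pi * ?k * N * exp (- a * \<sigma>)"
  have "(\<integral>\<^sup>+ v. ennreal (cmod (?\<eta> v) powr q) \<partial>lborel) \<le> ennreal (?B powr q)"
  proof (cases "q = 2")
    case True
    \<comment> \<open>Beyond \<open>\<sigma>\<close> the weight is at least
      \<open>exp (2 * a * \<sigma>)\<close>, so the weighted bound on \<open>\<psi>\<close> is a
      tail bound; the root of \<open>4 * pi * N\<^sup>2\<close> is
      \<open>2 * sqrt pi * N\<close>.\<close>
    have "ennreal (cmod (?\<eta> v) powr 2) \<le> ennreal (exp (- 2 * a * \<sigma>)) * ennreal ((cmod (\<psi> v))\<^sup>2 * exp (2 * a * \<bar>v\<bar>))" for v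
    proof (cases "\<bar>v\<bar> \<le> \<sigma>")
      case False
      hence "1 \<le> exp (- 2 * a * \<sigma>) * exp (2 * a * \<bar>v\<bar>)"
        using \<open>0 < a\<close> by (simp flip: exp_add)
      from mult_left_mono[OF this, of "(cmod (\<psi> v))\<^sup>2"] False show ?thesis
        by (simp add: ennreal_mult[symmetric] \<kappa>_def mult_ac ennreal_leI)
    qed (simp add: \<kappa>_def)
    hence "(\<integral>\<^sup>+ v. ennreal (cmod (?\<eta> v) powr 2) \<partial>lborel) \<le>
        (\<integral>\<^sup>+ v. ennreal (exp (- 2 * a * \<sigma>)) * ennreal ((cmod (\<psi> v))\<^sup>2 * exp (2 * a * \<bar>v\<bar>)) \<partial>lborel)"
      by (rule nn_integral_mono)
    also have "\<dots> = ennreal (exp (- 2 * a * \<sigma>)) * (\<integral>\<^sup>+ v. ennreal ((cmod (\<psi> v))\<^sup>2 * exp (2 * a * \<bar>v\<bar>)) \<partial>lborel)"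
      by (rule nn_integral_cmult) measurable
    also have "\<dots> \<le> ennreal (exp (- 2 * a * \<sigma>)) * ennreal (4 * pi * N\<^sup>2)"
      by (intro mult_left_mono \<psi>(2)) auto
    also have "\<dots> = ennreal ((2 * sqrt pi * 1 * N * exp (- a * \<sigma>))\<^sup>2)"
      by (simp add: ennreal_mult[symmetric] power_mult_distrib exp_double[symmetric] mult_ac)
    finally show ?thesis using True F(4) by simp
  next
    case False
    hence q2: "q < 2" using q by simp
    \<comment> \<open>Chosen so that the weighted square of \<open>\<psi>\<close>, raised to the
      power \<open>t\<close>, contains \<open>cmod (\<psi> v) powr q\<close>.\<close>
    define t where "t = q / 2"
    have t: "0 < t" "t < 1" "1 - t = (2 - q) / 2" using q q2 by (auto simp: t_def field_simps)
    \<comment> \<open>Forced by \<open>d * (1 - t) = q * a\<close>, so that the two exponential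
      weights cancel in the Hoelder product. Then \<open>2 / d = (2 - q) / (q * a)\<close>, and
      \<open>(1 - t) / q = 1 / q - 1 / 2\<close> is the exponent in the final constant.\<close>
    define d where "d = 2 * q * a / (2 - q)"
    have d: "0 < d" "d * (1 - t) = q * a"
      using \<open>0 < a\<close> q q2 by (auto simp: d_def t(3) field_simps)
    let ?X = "\<lambda>v. (cmod (\<psi> v))\<^sup>2 * exp (2 * a * \<bar>v\<bar>)"
    let ?Y = "\<lambda>v. exp (- d * \<bar>v\<bar>) * indicator {v. \<sigma> \<le> \<bar>v\<bar>} v"
    have "cmod (?\<eta> v) powr q \<le> ?X v powr t * ?Y v powr (1 - t)" for v
    proof (cases "\<bar>v\<bar> \<le> \<sigma>")
      case False
      have "?X v powr t = cmod (\<psi> v) powr q * exp (q * a * \<bar>v\<bar>)"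
        by (simp add: powr_mult exp_powr_real powr_powr t_def mult_ac flip: powr_numeral)
      moreover have "?Y v powr (1 - t) = exp (- (q * a) * \<bar>v\<bar>)"
      proof -
        have "?Y v powr (1 - t) = exp (- d * \<bar>v\<bar> * (1 - t))"
          using False by (simp add: exp_powr_real)
        also have "- d * \<bar>v\<bar> * (1 - t) = - (d * (1 - t)) * \<bar>v\<bar>" by simp
        finally show ?thesis unfolding d(2) .
      qed
      ultimately have "?X v powr t * ?Y v powr (1 - t) = cmod (\<psi> v) powr q"
        by (simp add: mult.assoc flip: exp_add)
      thus ?thesis using False by (simp add: \<kappa>_def)
    qed (simp add: \<kappa>_def)
    hence "(\<integral>\<^sup>+ v. ennreal (cmod (?\<eta> v) powr q) \<partial>lborel) \<le>
        (\<integral>\<^sup>+ v. ennreal (?X v powr t * ?Y v powr (1 - t)) \<partial>lborel)"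
      by (intro nn_integral_mono ennreal_leI)
    also have "\<dots> \<le> ennreal ((4 * pi * N\<^sup>2) powr t * (2 / d * exp (- d * \<sigma>)) powr (1 - t))"
    proof (rule nn_integral_holder_le[OF _ _ _ _ t(1,2)])
      have "(\<integral>\<^sup>+ v. ennreal (?Y v) \<partial>lborel) =
          (\<integral>\<^sup>+ v. ennreal (exp (- d * \<bar>v\<bar>)) * indicator {v. \<sigma> \<le> \<bar>v\<bar>} v \<partial>lborel)"
        by (intro nn_integral_cong) (auto simp: indicator_def)
      thus "(\<integral>\<^sup>+ v. ennreal (?Y v) \<partial>lborel) \<le> ennreal (2 / d * exp (- d * \<sigma>))"
        using nn_integral_exp_tail_le[of d \<sigma>] d(1) \<open>0 < \<sigma>\<close> by simp
    qed (use \<psi>(2) d(1) in auto)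
    also have "(4 * pi * N\<^sup>2) powr t * (2 / d * exp (- d * \<sigma>)) powr (1 - t) = ?B powr q"
    proof -
      have "(4 * pi * N\<^sup>2) powr t = (2 * sqrt pi * N) powr q"
      proof -
        have "4 * pi * N\<^sup>2 = (2 * sqrt pi * N) powr 2"
          using F(4) by (simp add: power_mult_distrib)
        thus ?thesis by (simp add: powr_powr t_def)
      qed
      moreover have "(2 / d * exp (- d * \<sigma>)) powr (1 - t) =
          (((2 - q) / (q * a)) powr (1 / q - 1 / 2) * exp (- a * \<sigma>)) powr q"
      proof -
        have "2 / d = (2 - q) / (q * a)" using q q2 \<open>0 < a\<close> by (simp add: d_def field_simps)
        moreover have "(1 / q - 1 / 2) * q = 1 - t" using q by (simp add: t_def field_simps)
        moreover have "- d * \<sigma> * (1 - t) = - a * \<sigma> * q" using d(2) by (simp add: mult_ac)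
        ultimately show ?thesis by (simp only: powr_mult powr_powr exp_powr_real)
      qed
      ultimately show ?thesis using False by (simp add: powr_mult mult_ac)
    qed
    finally show ?thesis .
  qed
  hence "(\<integral>\<^sup>+ v. ennreal (cmod (?\<eta> v) powr enn2real (ennreal q)) \<partial>lborel) \<le> ennreal (?B powr enn2real (ennreal q))"
    using q by simp
  note * = this
  have \<eta>_meas: "?\<eta> \<in> borel_measurable borel" by measurable
  have "1 \<le> ennreal q" "ennreal q \<noteq> \<infinity>" "0 \<le> ?B" using q F(4) by auto
  note L = L_space_norm_finite_bound[OF \<eta>_meas this *]
  have "mellin_bernstein_dist (ennreal q) 2 c \<sigma> f \<le> ennreal (L_norm (ennreal q) ?\<eta>)"
    using \<open>0 < \<sigma>\<close> L(1) ft_k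
    by (intro dist_le_cutoff[OF \<psi>(1) \<psi>(3)[unfolded F_def]]) (auto simp: \<kappa>_def)
  also have "\<dots> \<le> ennreal ?B" by (intro ennreal_leI L(2))
  finally show ?thesis unfolding N_def .
qed

theorem theorem6:
  fixes c a \<sigma> :: real
  assumes "0 < a" and "0 < \<sigma>"
  shows "(\<forall>f\<in>mellin_hardy 1 c a. \<forall>q::ennreal. 1 \<le> q \<longrightarrow>
      mellin_bernstein_dist q 1 c \<sigma> f \<le>
        ennreal (2 * mellin_hardy_norm 1 c a f *
          (if q = \<infinity> then 1 else (2 / (a * enn2real q)) powr (1 / enn2real q)) *
          exp (- a * \<sigma>))) \<and>
    (\<forall>f\<in>mellin_hardy 2 c a.
      mellin_bernstein_dist 2 2 c \<sigma> f \<le>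
        ennreal (2 * sqrt pi * mellin_hardy_norm 2 c a f * exp (- a * \<sigma>)) \<and>
      (\<forall>q::real. 1 \<le> q \<and> q < 2 \<longrightarrow>
        mellin_bernstein_dist (ennreal q) 2 c \<sigma> f \<le>
          ennreal (2 * sqrt pi * ((2 - q) / (q * a)) powr (1 / q - 1 / 2) *
            mellin_hardy_norm 2 c a f * exp (- a * \<sigma>))))"
proof (intro conjI ballI allI impI)
  fix f q assume "f \<in> mellin_hardy 1 c a" "(1::ennreal) \<le> q"
  thus "mellin_bernstein_dist q 1 c \<sigma> f \<le>
      ennreal (2 * mellin_hardy_norm 1 c a f *
        (if q = \<infinity> then 1 else (2 / (a * enn2real q)) powr (1 / enn2real q)) * exp (- a * \<sigma>))"
    by (rule dist_bound_hardy_1[OF assms])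
next
  fix f assume f: "f \<in> mellin_hardy 2 c a"
  show "mellin_bernstein_dist 2 2 c \<sigma> f \<le> ennreal (2 * sqrt pi * mellin_hardy_norm 2 c a f * exp (- a * \<sigma>))"
    using dist_bound_hardy_2[OF assms f, of 2] by simp
  fix q :: real assume "1 \<le> q \<and> q < 2"
  thus "mellin_bernstein_dist (ennreal q) 2 c \<sigma> f \<le>
      ennreal (2 * sqrt pi * ((2 - q) / (q * a)) powr (1 / q - 1 / 2) * mellin_hardy_norm 2 c a f * exp (- a * \<sigma>))"
    using dist_bound_hardy_2[OF assms f, of q] by simp
qed

end
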